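(* Let $\lambda$ be an essentially regular point, let $H_0\in\mathcal A$ and let $V\in\mathcal A_0(F)$ be a regularizing direction at $\lambda$. Let $r_\lambda$ be a real resonance point of the triple $(\lambda,H_0,V)$. If at least one of the following three conditions holds: (1) $\lambda$ does not belong to the (necessarily common) essential spectrum of operators from $\mathcal A$, (2) the order of $r_\lambda$ is equal to $1$, (3) the operator $V$ is non-negative or non-positive, then $r_\lambda$ is a point of type I.
   Context: Setting. $\mathcal H,\mathcal K$ are complex separable Hilbert spaces. $F:\mathcal H\to\mathcal K$ is a closed densely defined operator with trivial kernel and co-kernel (the rigging operator). $\mathcal A_0(F)$ is a real vector space of self-adjoint operators $V=F^*JF$ on $\mathcal H$, with $J$ running over a real subspace of the bounded self-adjoint operators on $\mathcal K$, and $\mathcal A=H+\mathcal A_0(F)$ is an affine space of self-adjoint operators. Standing assumptions: all $H\in\mathcal A$ have a common dense domain $\mathcal D$; $\mathcal D\subset\operatorname{dom}(F)$ and $\mathcal D\subset\operatorname{dom}(V)$ for all $V\in\mathcal A_0(F)$; every $V\in\mathcal A_0(F)$ is relatively compact with respect to every $H\in\mathcal A$ (so all $H\in\mathcal A$ have the same essential spectrum); and for non-real $z$ the operator $T_z(H):=F(H-z)^{-1}F^*$ (densely defined on $\operatorname{dom}F^*$) extends to a compact operator on $\mathcal K$, also denoted $T_z(H)$. $\Lambda(H,F)$ is the set of real $\lambda$ for which the norm limits $T_{\lambda\pm i0}(H):=\lim_{y\to0^+}T_{\lambda\pm iy}(H)$ exist; it is assumed to have full Lebesgue measure for every $H\in\mathcal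 A$. Elements of $\bigcup_{H\in\mathcal A}\Lambda(H,F)$ are called essentially regular. $H$ is regular at $\lambda$ if $\lambda\in\Lambda(H,F)$ and resonant otherwise. With $H_r=H_0+rV$, $V$ is a regularizing direction at $\lambda$ if $H_r$ is regular at $\lambda$ for some real $r$; a real $r$ is non-resonant if $H_r$ is regular at $\lambda$, otherwise a real resonance point of the triple $(\lambda,H_0,V)$. $\operatorname{Im}T=(T-T^* )/(2i)$. For non-resonant $s$ put $A_{\lambda+i0}(s)=T_{\lambda+i0}(H_s)J$; as a function of $s$ it extends meromorphically to $\mathbb C$, its real poles being the real resonance points. $\Upsilon^k_{\lambda+i0}(r_\lambda)=\{u\in\mathcal K:(1+(r_\lambda-s)A_{\lambda+i0}(s))^ku=0\}$ (independent of non-resonant real $s$); the order of $r_\lambda$ is the smallest positive integer $k$ with $\Upsilon^k_{\lambda+i0}(r_\lambda)=\Upsilon^{k+1}_{\lambda+i0}(r_\lambda)$. $P_{\lambda+i0}(r_\lambda)=\frac1{2\pi i}\oint_{C(r_\lambda)}A_{\lambda+i0}(s)\,ds$, with $C(r_\lambda)$ a small counter-clockwise circle around $r_\lambda$ enclosing no other poles. The point $r_\lambda$ is of type I if $\sqrt{\operatorname{Im}T_{\lambda+i0}(H_s)}\,JP_{\lambda+i0}(r_\lambda)=0$ for some non-resonant real $s$. *)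

theory Defs
  imports "HOL-Analysis.Analysis"
begin

section \<open>Complex Hilbert spaces\<close>

text \<open>The complex inner product is linear in the first argument; the norm, the topology and
  completeness are those of the underlying real inner product space.\<close>

class complex_hilbert = real_inner + complete_space +
  fixes scaleC :: "complex \<Rightarrow> 'a \<Rightarrow> 'a" (infixr "*\<^sub>C" 75)
    and cinner :: "'a \<Rightarrow> 'a \<Rightarrow> complex"
  assumes scaleC_add_right: "c *\<^sub>C (x + y) = c *\<^sub>C x + c *\<^sub>C y"
    and scaleC_add_left: "(c + d) *\<^sub>C x = c *\<^sub>C x + d *\<^sub>C x"
    and scaleC_scaleC: "c *\<^sub>C d *\<^sub>C x = (c * d) *\<^sub>C x"
    and scaleR_scaleC: "r *\<^sub>R x = complex_of_real r *\<^sub>C x"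
    and cinner_commute: "cinner x y = cnj (cinner y x)"
    and cinner_add_left: "cinner (x + y) z = cinner x z + cinner y z"
    and cinner_scaleC_left: "cinner (c *\<^sub>C x) y = c * cinner x y"
    and inner_eq_Re_cinner: "inner x y = Re (cinner x y)"

instantiation complex :: complex_hilbert
begin

definition scaleC_complex :: "complex \<Rightarrow> complex \<Rightarrow> complex"
  where "scaleC_complex c x = c * x"

definition cinner_complex :: "complex \<Rightarrow> complex \<Rightarrow> complex"
  where "cinner_complex x y = x * cnj y"

instance
  by standard
    (auto simp: scaleC_complex_def cinner_complex_def algebra_simps scaleR_conv_of_real
      inner_complex_def)

end

lemma norm_scaleC: "norm (c *\<^sub>C x) = norm c * norm x" for x :: "'a::complex_hilbert"
proof -
  have right: "cinner y (c *\<^sub>C x) = cnj c * cinner y x" for y :: 'a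
    by (metis cinner_commute cinner_scaleC_left complex_cnj_mult)
  have "inner (c *\<^sub>C x) (c *\<^sub>C x) = Re ((c * cnj c) * cinner x x)"
    by (simp add: inner_eq_Re_cinner cinner_scaleC_left right algebra_simps)
  also have "\<dots> = (norm c)\<^sup>2 * inner x x"
    unfolding cmod_power2 by (simp add: inner_eq_Re_cinner power2_eq_square algebra_simps)
  finally show ?thesis
    by (simp add: norm_eq_sqrt_inner real_sqrt_mult)
qed


section \<open>Bounded operators\<close>

text \<open>Bounded complex-linear operators are the elements of the (real) Banach space of real-linear
  bounded operators that satisfy the following predicate; the operator norm is the same.\<close>

definition clinear_op :: "('a::complex_hilbert \<Rightarrow>\<^sub>L 'b::complex_hilbert) \<Rightarrow> bool"
  where "clinear_op T \<longleftrightarrow> (\<forall>c x. T (c *\<^sub>C x) = c *\<^sub>C T x)"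

definition scaleC_op ::
    "complex \<Rightarrow> ('a::complex_hilbert \<Rightarrow>\<^sub>L 'b::complex_hilbert) \<Rightarrow> 'a \<Rightarrow>\<^sub>L 'b"
  where "scaleC_op c T = Blinfun (\<lambda>x. c *\<^sub>C T x)"

lemma scaleC_op_apply:
  fixes T :: "'a::complex_hilbert \<Rightarrow>\<^sub>L 'b::complex_hilbert"
  shows "scaleC_op c T x = c *\<^sub>C T x"
proof -
  have scaleC_swap: "c *\<^sub>C r *\<^sub>R y = r *\<^sub>R c *\<^sub>C y" for r and y :: 'b
    by (simp add: scaleR_scaleC scaleC_scaleC mult.commute)
  have "bounded_linear (\<lambda>x. c *\<^sub>C T x)"
  proof (rule bounded_linear_intro[where K = "norm c * norm T"])
    show "c *\<^sub>C T (x + y) = c *\<^sub>C T x + c *\<^sub>C T y" for x y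
      by (simp add: blinfun.add_right scaleC_add_right)
    show "c *\<^sub>C T (r *\<^sub>R x) = r *\<^sub>R (c *\<^sub>C T x)" for r x
      by (simp add: blinfun.scaleR_right scaleC_swap)
    show "norm (c *\<^sub>C T x) \<le> norm x * (norm c * norm T)" for x
      using norm_blinfun[of T x] by (metis mult.left_commute mult.commute mult_left_mono norm_ge_zero norm_scaleC)
  qed
  then show ?thesis
    by (simp add: scaleC_op_def bounded_linear_Blinfun_apply)
qed

definition adj_op ::
    "('a::complex_hilbert \<Rightarrow>\<^sub>L 'b::complex_hilbert) \<Rightarrow> 'b \<Rightarrow>\<^sub>L 'a"
  where "adj_op T = (THE S. \<forall>x y. cinner (T x) y = cinner x (blinfun_apply S y))"

definition selfadjoint_op :: "('a::complex_hilbert \<Rightarrow>\<^sub>L 'a) \<Rightarrow> bool"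
  where "selfadjoint_op T \<longleftrightarrow> clinear_op T \<and> (\<forall>x y. cinner (T x) y = cinner x (T y))"

definition nonneg_op :: "('a::complex_hilbert \<Rightarrow>\<^sub>L 'a) \<Rightarrow> bool"
  where "nonneg_op T \<longleftrightarrow> selfadjoint_op T \<and> (\<forall>x. 0 \<le> Re (cinner (T x) x))"

text \<open>A bounded non-negative operator has exactly one non-negative square root.\<close>

definition sqrt_op :: "('a::complex_hilbert \<Rightarrow>\<^sub>L 'a) \<Rightarrow> 'a \<Rightarrow>\<^sub>L 'a"
  where "sqrt_op T = (SOME S. nonneg_op S \<and> S o\<^sub>L S = T)"

definition Im_op :: "('a::complex_hilbert \<Rightarrow>\<^sub>L 'a) \<Rightarrow> 'a \<Rightarrow>\<^sub>L 'a"
  where "Im_op T = scaleC_op (1 / (2 * \<i>)) (T - adj_op T)"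

definition compact_op :: "('a::complex_hilbert \<Rightarrow>\<^sub>L 'b::complex_hilbert) \<Rightarrow> bool"
  where "compact_op T \<longleftrightarrow> clinear_op T \<and> compact (closure (blinfun_apply T ` cball 0 1))"


section \<open>Unbounded operators\<close>

text \<open>An unbounded operator is represented by its graph. The product of operators \<open>B A\<close> on its
  natural domain has the graph \<open>A O B\<close>, the closure of an operator is the topological closure of
  its graph, and the inverse is the converse relation.\<close>

definition op_graph :: "('a::complex_hilbert \<Rightarrow>\<^sub>L 'b::complex_hilbert) \<Rightarrow> ('a \<times> 'b) set"
  where "op_graph T = {(x, y). y = T x}"

definition linear_graph :: "('a::complex_hilbert \<times> 'b::complex_hilbert) set \<Rightarrow> bool"
  where "linear_graph G \<longleftrightarrow> subspace G \<and> single_valued G \<and>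
    (\<forall>c x y. (x, y) \<in> G \<longrightarrow> (c *\<^sub>C x, c *\<^sub>C y) \<in> G)"

definition adj_graph ::
    "('a::complex_hilbert \<times> 'b::complex_hilbert) set \<Rightarrow> ('b \<times> 'a) set"
  where "adj_graph G = {(y, z). \<forall>(x, w) \<in> G. cinner w y = cinner x z}"

definition selfadjoint_graph :: "('a::complex_hilbert \<times> 'a) set \<Rightarrow> bool"
  where "selfadjoint_graph G \<longleftrightarrow>
    linear_graph G \<and> closure (Domain G) = UNIV \<and> adj_graph G = G"

definition nonneg_graph :: "('a::complex_hilbert \<times> 'a) set \<Rightarrow> bool"
  where "nonneg_graph G \<longleftrightarrow> (\<forall>(x, y) \<in> G. 0 \<le> Re (cinner y x))"

definition nonpos_graph :: "('a::complex_hilbert \<times> 'a) set \<Rightarrow> bool"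
  where "nonpos_graph G \<longleftrightarrow> (\<forall>(x, y) \<in> G. Re (cinner y x) \<le> 0)"

text \<open>\<open>add_graph G r V\<close> is \<open>G + r V\<close> on the intersection of the domains, and \<open>shift_graph G z\<close> is
  \<open>G - z\<close>.\<close>

definition add_graph ::
    "('a::complex_hilbert \<times> 'a) set \<Rightarrow> real \<Rightarrow> ('a \<times> 'a) set \<Rightarrow> ('a \<times> 'a) set"
  where "add_graph G r V = {(x, y + r *\<^sub>R v) | x y v. (x, y) \<in> G \<and> (x, v) \<in> V}"

definition shift_graph :: "('a::complex_hilbert \<times> 'a) set \<Rightarrow> complex \<Rightarrow> ('a \<times> 'a) set"
  where "shift_graph G z = {(x, y - z *\<^sub>C x) | x y. (x, y) \<in> G}"

definition resolvent_set :: "('a::complex_hilbert \<times> 'a) set \<Rightarrow> complex set"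
  where "resolvent_set G = {z. \<exists>R. clinear_op R \<and> op_graph R = (shift_graph G z)\<inverse>}"

definition finite_dim :: "'a::real_vector set \<Rightarrow> bool"
  where "finite_dim S \<longleftrightarrow> (\<exists>B. finite B \<and> S \<subseteq> span B)"

definition fredholm_graph :: "('a::complex_hilbert \<times> 'a) set \<Rightarrow> bool"
  where "fredholm_graph G \<longleftrightarrow>
    finite_dim {x. (x, 0) \<in> G} \<and> closed (Range G) \<and>
    finite_dim {y. \<forall>w \<in> Range G. cinner w y = 0}"

text \<open>For self-adjoint operators the usual definitions of the essential spectrum coincide.\<close>

definition essential_spectrum :: "('a::complex_hilbert \<times> 'a) set \<Rightarrow> complex set"
  where "essential_spectrum G = {z. \<not> fredholm_graph (shift_graph G z)}"

text \<open>Compactness of \<open>V (G - z)\<^sup>-\<^sup>1\<close> for one \<open>z\<close> in the resolvent set implies it for every such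
  \<open>z\<close>. The equation of graphs forces the domain of \<open>V\<close> to contain the domain of \<open>G\<close>.\<close>

definition relatively_compact ::
    "('a::complex_hilbert \<times> 'a) set \<Rightarrow> ('a \<times> 'a) set \<Rightarrow> bool"
  where "relatively_compact V G \<longleftrightarrow>
    (\<exists>z \<in> resolvent_set G. \<exists>K. compact_op K \<and> op_graph K = (shift_graph G z)\<inverse> O V)"


section \<open>The sandwiched resolvent\<close>

text \<open>The graph of \<open>F\<^sup>* J F\<close> on its natural domain, and the operator \<open>V = F\<^sup>* J F\<close>. For unbounded
  \<open>F\<close> the natural-domain product need not be closed (for \<open>J = 0\<close> it is the zero operator on the
  domain of \<open>F\<close>), so the self-adjoint operator \<open>V\<close> is its closure; if the product is already
  self-adjoint, the closure changes nothing.\<close>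

definition sandwich_graph ::
    "('h::complex_hilbert \<times> 'k::complex_hilbert) set \<Rightarrow> ('k \<Rightarrow>\<^sub>L 'k) \<Rightarrow> ('h \<times> 'h) set"
  where "sandwich_graph F J = F O op_graph J O adj_graph F"

definition perturbation ::
    "('h::complex_hilbert \<times> 'k::complex_hilbert) set \<Rightarrow> ('k \<Rightarrow>\<^sub>L 'k) \<Rightarrow> ('h \<times> 'h) set"
  where "perturbation F J = closure (sandwich_graph F J)"

definition sandwiched_resolvent_graph ::
    "('h::complex_hilbert \<times> 'k::complex_hilbert) set \<Rightarrow> ('h \<times> 'h) set \<Rightarrow> complex
      \<Rightarrow> ('k \<times> 'k) set"
  where "sandwiched_resolvent_graph F H z = adj_graph F O (shift_graph H z)\<inverse> O F"

definition T_op ::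
    "('h::complex_hilbert \<times> 'k::complex_hilbert) set \<Rightarrow> complex \<Rightarrow> ('h \<times> 'h) set
      \<Rightarrow> 'k \<Rightarrow>\<^sub>L 'k"
  where "T_op F z H = (THE T. clinear_op T \<and> sandwiched_resolvent_graph F H z \<subseteq> op_graph T)"

definition Lambda_set ::
    "('h::complex_hilbert \<times> 'k::complex_hilbert) set \<Rightarrow> ('h \<times> 'h) set \<Rightarrow> real set"
  where "Lambda_set F H = {lam.
    (\<exists>L. ((\<lambda>y. T_op F (Complex lam y) H) \<longlongrightarrow> L) (at_right 0)) \<and>
    (\<exists>L. ((\<lambda>y. T_op F (Complex lam (- y)) H) \<longlongrightarrow> L) (at_right 0))}"

definition T_plus ::
    "('h::complex_hilbert \<times> 'k::complex_hilbert) set \<Rightarrow> real \<Rightarrow> ('h \<times> 'h) set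
      \<Rightarrow> 'k \<Rightarrow>\<^sub>L 'k"
  where "T_plus F lam H = Lim (at_right 0) (\<lambda>y. T_op F (Complex lam y) H)"

locale rigged_affine_space =
  fixes F :: "('h::{complex_hilbert, second_countable_topology} \<times>
      'k::{complex_hilbert, second_countable_topology}) set"
    and \<J> :: "('k \<Rightarrow>\<^sub>L 'k) set"
    and \<A> :: "('h \<times> 'h) set set"
    and \<D> :: "'h set"
  assumes F_linear: "linear_graph F"
    and F_closed: "closed F"
    and F_dense: "closure (Domain F) = UNIV"
    and F_kernel: "(x, 0) \<in> F \<Longrightarrow> x = 0"
    and F_cokernel: "(y, 0) \<in> adj_graph F \<Longrightarrow> y = 0"
    and J_subspace: "subspace \<J>"
    and J_selfadjoint: "J \<in> \<J> \<Longrightarrow> selfadjoint_op J"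
    and V_selfadjoint: "J \<in> \<J> \<Longrightarrow> selfadjoint_graph (perturbation F J)"
    and affine: "\<exists>H. \<A> = {add_graph H 1 (perturbation F J) | J. J \<in> \<J>}"
    and H_selfadjoint: "H \<in> \<A> \<Longrightarrow> selfadjoint_graph H"
    and common_domain: "H \<in> \<A> \<Longrightarrow> Domain H = \<D>"
    and domain_dense: "closure \<D> = UNIV"
    and domain_F: "\<D> \<subseteq> Domain F"
    and domain_V: "J \<in> \<J> \<Longrightarrow> \<D> \<subseteq> Domain (sandwich_graph F J)"
    and relcompact: "J \<in> \<J> \<Longrightarrow> H \<in> \<A> \<Longrightarrow> relatively_compact (perturbation F J) H"
    and T_compact: "H \<in> \<A> \<Longrightarrow> Im z \<noteq> 0 \<Longrightarrow>
      \<exists>T. compact_op T \<and> sandwiched_resolvent_graph F H z \<subseteq> op_graph T"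
    and full_measure: "H \<in> \<A> \<Longrightarrow> AE lam in lborel. lam \<in> Lambda_set F H"


section \<open>Resonance points\<close>

definition essentially_regular ::
    "('h::complex_hilbert \<times> 'k::complex_hilbert) set \<Rightarrow> ('h \<times> 'h) set set \<Rightarrow> real \<Rightarrow> bool"
  where "essentially_regular F \<A> lam \<longleftrightarrow> lam \<in> (\<Union>H \<in> \<A>. Lambda_set F H)"

definition non_resonant ::
    "('h::complex_hilbert \<times> 'k::complex_hilbert) set \<Rightarrow> real \<Rightarrow> ('h \<times> 'h) set
      \<Rightarrow> ('h \<times> 'h) set \<Rightarrow> real \<Rightarrow> bool"
  where "non_resonant F lam H V s \<longleftrightarrow> lam \<in> Lambda_set F (add_graph H s V)"

definition resonance_point ::
    "('h::complex_hilbert \<times> 'k::complex_hilbert) set \<Rightarrow> real \<Rightarrow> ('h \<times> 'h) set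
      \<Rightarrow> ('h \<times> 'h) set \<Rightarrow> real \<Rightarrow> bool"
  where "resonance_point F lam H V s \<longleftrightarrow> \<not> non_resonant F lam H V s"

definition regularizing_direction ::
    "('h::complex_hilbert \<times> 'k::complex_hilbert) set \<Rightarrow> real \<Rightarrow> ('h \<times> 'h) set
      \<Rightarrow> ('h \<times> 'h) set \<Rightarrow> bool"
  where "regularizing_direction F lam H V \<longleftrightarrow> (\<exists>s. non_resonant F lam H V s)"

definition op_holomorphic_on ::
    "(complex \<Rightarrow> 'a::complex_hilbert \<Rightarrow>\<^sub>L 'b::complex_hilbert) \<Rightarrow> complex set \<Rightarrow> bool"
  where "op_holomorphic_on f S \<longleftrightarrow>
    (\<forall>z \<in> S. \<exists>D. (f has_derivative (\<lambda>h. scaleC_op h D)) (at z))"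

text \<open>Meromorphic on the whole plane; values at poles and at removable singularities are
  arbitrary.\<close>

definition op_meromorphic ::
    "(complex \<Rightarrow> 'a::complex_hilbert \<Rightarrow>\<^sub>L 'b::complex_hilbert) \<Rightarrow> bool"
  where "op_meromorphic f \<longleftrightarrow>
    (\<forall>p. \<exists>n g U. open U \<and> p \<in> U \<and> op_holomorphic_on g U \<and>
      (\<forall>z \<in> U - {p}. scaleC_op ((z - p) ^ n) (f z) = g z))"

text \<open>The meromorphic extension is unique up to its values at isolated points.\<close>

definition A_plus ::
    "('h::complex_hilbert \<times> 'k::complex_hilbert) set \<Rightarrow> real \<Rightarrow> ('h \<times> 'h) set
      \<Rightarrow> ('k \<Rightarrow>\<^sub>L 'k) \<Rightarrow> complex \<Rightarrow> 'k \<Rightarrow>\<^sub>L 'k"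
  where "A_plus F lam H J = (SOME A. op_meromorphic A \<and>
    (\<forall>s. non_resonant F lam H (perturbation F J) s \<longrightarrow>
      A (complex_of_real s) = T_plus F lam (add_graph H s (perturbation F J)) o\<^sub>L J))"

definition Upsilon ::
    "('h::complex_hilbert \<times> 'k::complex_hilbert) set \<Rightarrow> real \<Rightarrow> ('h \<times> 'h) set
      \<Rightarrow> ('k \<Rightarrow>\<^sub>L 'k) \<Rightarrow> real \<Rightarrow> nat \<Rightarrow> 'k set"
  where "Upsilon F lam H J r k =
    (let s = (SOME s. non_resonant F lam H (perturbation F J) s);
         A = T_plus F lam (add_graph H s (perturbation F J)) o\<^sub>L J
     in {u. (blinfun_apply (id_blinfun + (r - s) *\<^sub>R A) ^^ k) u = 0})"

definition resonance_order ::
    "('h::complex_hilbert \<times> 'k::complex_hilbert) set \<Rightarrow> real \<Rightarrow> ('h \<times> 'h) set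
      \<Rightarrow> ('k \<Rightarrow>\<^sub>L 'k) \<Rightarrow> real \<Rightarrow> nat"
  where "resonance_order F lam H J r =
    (LEAST k. 0 < k \<and> Upsilon F lam H J r k = Upsilon F lam H J r (Suc k))"

definition op_circle_integral ::
    "(complex \<Rightarrow> 'a::complex_hilbert \<Rightarrow>\<^sub>L 'b::complex_hilbert) \<Rightarrow> complex \<Rightarrow> real
      \<Rightarrow> 'a \<Rightarrow>\<^sub>L 'b"
  where "op_circle_integral f c \<rho> =
    integral {0..2 * pi} (\<lambda>t. scaleC_op (\<i> * of_real \<rho> * cis t) (f (c + of_real \<rho> * cis t)))"

text \<open>The radius is chosen so that the closed disc contains no singularity other than, possibly,
  its centre; the integral does not depend on this choice.\<close>

definition P_plus ::
    "('h::complex_hilbert \<times> 'k::complex_hilbert) set \<Rightarrow> real \<Rightarrow> ('h \<times> 'h) set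
      \<Rightarrow> ('k \<Rightarrow>\<^sub>L 'k) \<Rightarrow> real \<Rightarrow> 'k \<Rightarrow>\<^sub>L 'k"
  where "P_plus F lam H J r =
    (let A = A_plus F lam H J; c = complex_of_real r;
         \<rho> = (SOME \<rho>. 0 < \<rho> \<and> op_holomorphic_on A (cball c \<rho> - {c}))
     in scaleC_op (1 / (2 * of_real pi * \<i>)) (op_circle_integral A c \<rho>))"

definition type_I ::
    "('h::complex_hilbert \<times> 'k::complex_hilbert) set \<Rightarrow> real \<Rightarrow> ('h \<times> 'h) set
      \<Rightarrow> ('k \<Rightarrow>\<^sub>L 'k) \<Rightarrow> real \<Rightarrow> bool"
  where "type_I F lam H J r \<longleftrightarrow>
    (\<exists>s. non_resonant F lam H (perturbation F J) s \<and>
      sqrt_op (Im_op (T_plus F lam (add_graph H s (perturbation F J)))) o\<^sub>L J o\<^sub>L P_plus F lam H J r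
        = 0)"

end

theory Submission
  imports Defs "HOL-Complex_Analysis.Complex_Analysis"
begin

text \<open>Fix a non-resonant \<open>s\<close> and put \<open>T = T\<^bsub>\<lambda>+i0\<^esub>(H\<^sub>s)\<close>, a compact operator, and \<open>A = T J\<close>. The second
  resolvent identity passes to the limit \<open>y \<rightarrow> 0\<close>: a real \<open>t\<close> is non-resonant if and only if
  \<open>1 + (t - s) A\<close> is invertible, and the meromorphic extension of \<open>A(t)\<close> is \<open>(1 + (z - s) A)\<^sup>-\<^sup>1 A\<close>. By Riesz
  theory its residue \<open>P\<close> at \<open>r\<close> factors through the algebraic kernel of \<open>N = 1 + (r - s) A\<close>.

  If \<open>N u = 0\<close>, then \<open>\<langle>T J u, J u\<rangle>\<close> is real, so the square root of \<open>Im T \<ge> 0\<close> annihilates \<open>J u\<close>. This settles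
  order one. If \<open>V\<close> is semidefinite, then so is \<open>J\<close> on the closure of \<open>F \<D>\<close>, which contains the
  range of \<open>T\<close> and whose complement \<open>T\<close> annihilates. For \<open>N\<^sup>2 u = 0\<close> and \<open>v = N u\<close> one finds \<open>\<langle>J v, v\<rangle> = 0\<close>,
  hence \<open>T J v = 0\<close> by the Cauchy--Schwarz inequality and \<open>v = 0\<close>: the order is one.

  If \<open>\<lambda>\<close> is not in the essential spectrum, then \<open>H\<^sub>s - \<lambda>\<close> has closed range, because the semi-Fredholm
  property survives relatively compact perturbations. Then \<open>\<langle>Im T\<^bsub>\<lambda>+iy\<^esub> x, x\<rangle> = y \<parallel>R\<^bsub>\<lambda>+iy\<^esub> F\<^sup>* x\<parallel>\<^sup>2\<close> can only
  stay bounded as \<open>y \<rightarrow> 0\<close> by tending to \<open>0\<close>, so \<open>Im T = 0\<close>.\<close>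

section \<open>Hilbert space geometry\<close>

text \<open>\<open>type_I\<close> asks that \<open>Q = sqrt(Im T) J\<close> annihilate the residue,
  yet the residue is never computed. The polar part of \<open>(1 + (z - s) A)^-1\<close> at
  \<open>r\<close> takes its values in the algebraic kernel of \<open>N\<close>; if \<open>Q\<close>
  vanishes there, then \<open>Q\<close> composed with the extension has a removable singularity, and
  its circle integral is 0 by Cauchy's theorem for matrix elements. The obstacle is that
  \<open>A = T J\<close> is not self-adjoint in general. \<open>N\<close> may act as a nonzero
  nilpotent on its algebraic kernel, while the reality of \<open><T J u, J u>\<close> is available
  for true eigenvectors only. Order one and semidefiniteness exclude the nilpotent part. Off the
  essential spectrum no bound on the order is at hand, so \<open>Im T\<close> itself has to vanish.
  A second obstacle is that the extension, the radius of the circle and the reference coupling in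
  \<open>Upsilon\<close> are choices made by \<open>SOME\<close>. Only their defining properties may
  be used, and the chosen extension has to be recognised near \<open>r\<close> from its values at
  real non-resonant points, by the identity theorem.\<close>

lemma orthogonal_projection_exists:
  fixes S :: "'a::{real_inner,complete_space} set"
  assumes sub: "subspace S" and cl: "closed S"
  obtains p where "p \<in> S" "\<And>s. s \<in> S \<Longrightarrow> inner (x - p) s = 0"
proof -
  define d where "d = infdist x S"
  have ne: "S \<noteq> {}" using sub subspace_0 by blast
  have d0: "0 \<le> d" by (simp add: d_def infdist_nonneg)
  have low: "d \<le> norm (x - s)" if "s \<in> S" for s
    using infdist_le[OF that, of x] by (simp add: d_def dist_norm)
  have "\<exists>y\<in>S. norm (x - y) < d + 1 / real (Suc n)" for n
  proof -
    have "(INF y\<in>S. dist x y) < d + 1 / real (Suc n)"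
      using infdist_notempty[OF ne, of x] by (simp add: d_def)
    then obtain t where "t \<in> dist x ` S" "t < d + 1 / real (Suc n)"
      using cInf_lessD[of "dist x ` S"] ne by blast
    then show ?thesis by (auto simp: dist_norm)
  qed
  then obtain y where y: "\<And>n. y n \<in> S" and yd: "\<And>n. norm (x - y n) < d + 1 / real (Suc n)"
    by metis
  \<comment> \<open>The parallelogram law for \<open>x - y m\<close> and \<open>x - y n\<close>; the
    midpoint of \<open>y m\<close> and \<open>y n\<close> lies in \<open>S\<close>, hence at
    distance at least \<open>d\<close> from \<open>x\<close>. This makes a minimising sequence
    Cauchy.\<close>
  have para: "(norm (y m - y n))\<^sup>2 \<le> 2 * (norm (x - y m))\<^sup>2 + 2 * (norm (x - y n))\<^sup>2 - 4 * d\<^sup>2" for m n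
  proof -
    have "(1/2) *\<^sub>R (y m + y n) \<in> S" using sub y by (simp add: subspace_add subspace_scale)
    then have "d \<le> norm (x - (1/2) *\<^sub>R (y m + y n))" by (rule low)
    then have "d\<^sup>2 \<le> (norm (x - (1/2) *\<^sub>R (y m + y n)))\<^sup>2" using d0 by (simp add: power_mono)
    moreover have "(norm (y m - y n))\<^sup>2 = 2 * (norm (x - y m))\<^sup>2 + 2 * (norm (x - y n))\<^sup>2
        - 4 * (norm (x - (1/2) *\<^sub>R (y m + y n)))\<^sup>2"
      by (simp add: power2_norm_eq_inner inner_diff_left inner_diff_right inner_add_left
          inner_add_right inner_commute algebra_simps)
    ultimately show ?thesis by linarith
  qed
  have tend: "(\<lambda>n. norm (x - y n)) \<longlonglongrightarrow> d"
  proof (rule real_tendsto_sandwich[of "\<lambda>n. d" _ _ "\<lambda>n. d + 1 / real (Suc n)"])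
    show "(\<lambda>n. d + 1 / real (Suc n)) \<longlonglongrightarrow> d"
      using tendsto_add[OF tendsto_const LIMSEQ_Suc[OF lim_1_over_n], of d] by simp
  qed (use low y yd less_imp_le in \<open>auto intro!: always_eventually less_imp_le\<close>)
  have "Cauchy y"
  proof (rule metric_CauchyI)
    fix e :: real assume e: "0 < e"
    have "(\<lambda>n. (norm (x - y n))\<^sup>2) \<longlonglongrightarrow> d\<^sup>2" by (intro tendsto_intros tend)
    then have "\<forall>\<^sub>F n in sequentially. (norm (x - y n))\<^sup>2 < d\<^sup>2 + e\<^sup>2 / 4"
      using e by (intro order_tendstoD) auto
    then obtain N where N: "\<And>n. n \<ge> N \<Longrightarrow> (norm (x - y n))\<^sup>2 < d\<^sup>2 + e\<^sup>2 / 4"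
      by (auto simp: eventually_sequentially)
    have "dist (y m) (y n) < e" if "m \<ge> N" "n \<ge> N" for m n
    proof -
      have "(norm (y m - y n))\<^sup>2 < e\<^sup>2" using para[of m n] N[OF that(1)] N[OF that(2)] by linarith
      then show ?thesis using e by (simp add: dist_norm power_less_imp_less_base)
    qed
    then show "\<exists>M. \<forall>m\<ge>M. \<forall>n\<ge>M. dist (y m) (y n) < e" by blast
  qed
  then obtain p where p: "y \<longlonglongrightarrow> p" using Cauchy_convergent convergent_def by blast
  have pS: "p \<in> S" using closed_sequentially[OF cl _ p] y by blast
  have "norm (x - p) = d"
    using tendsto_norm[OF tendsto_diff[OF tendsto_const p, of x]] tend LIMSEQ_unique by blast
  have "inner (x - p) s = 0" if s: "s \<in> S" for s
  proof (cases "s = 0")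
    case False
    \<comment> \<open>The minimiser of the quadratic polynomial
      \<open>t \<mapsto> (norm (x - p - t *\<^sub>R s))\<^sup>2\<close>.\<close>
    define t where "t = inner (x - p) s / (norm s)\<^sup>2"
    have "p + t *\<^sub>R s \<in> S" using sub pS s by (simp add: subspace_add subspace_scale)
    then have "norm (x - p) \<le> norm (x - p - t *\<^sub>R s)" using low \<open>norm (x - p) = d\<close>
      by (metis diff_diff_add)
    then have "(norm (x - p))\<^sup>2 \<le> (norm (x - p - t *\<^sub>R s))\<^sup>2" by (simp add: power_mono)
    also have "\<dots> = (norm (x - p))\<^sup>2 - 2 * t * inner (x - p) s + t\<^sup>2 * (norm s)\<^sup>2"
    proof -
      have "(norm (u - t *\<^sub>R s))\<^sup>2 = (norm u)\<^sup>2 - 2 * t * inner u s + t\<^sup>2 * (norm s)\<^sup>2" for u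
        unfolding power2_norm_eq_inner
        by (simp add: inner_diff_left inner_diff_right inner_commute power2_eq_square algebra_simps)
      then show ?thesis .
    qed
    also have "\<dots> = (norm (x - p))\<^sup>2 - (inner (x - p) s)\<^sup>2 / (norm s)\<^sup>2"
      using False by (simp add: t_def power2_eq_square)
    finally have "(inner (x - p) s)\<^sup>2 / (norm s)\<^sup>2 \<le> 0" by simp
    then show ?thesis using False
      by (metis divide_le_0_iff norm_eq_zero not_le power2_less_eq_zero_iff zero_eq_power2 zero_le_power2 zero_less_power2)
  qed simp
  then show ?thesis using that pS by blast
qed

text \<open>Riesz's lemma with constant 1, attained because an orthogonal projection is available.
  It produces the separated sequences in the ascent and descent arguments.\<close>

lemma orthogonal_unit_vector:
  fixes S T :: "'a::{real_inner,complete_space} set"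
  assumes "subspace S" "closed S" "subspace T" "S \<subseteq> T" "S \<noteq> T"
  obtains u where "u \<in> T" "norm u = 1" "\<And>s. s \<in> S \<Longrightarrow> inner u s = 0"
proof -
  obtain x where x: "x \<in> T" "x \<notin> S" using assms by blast
  obtain p where p: "p \<in> S" "\<And>s. s \<in> S \<Longrightarrow> inner (x - p) s = 0"
    using orthogonal_projection_exists[OF assms(1,2)] by blast
  have "x - p \<noteq> 0" using x p by auto
  moreover have "x - p \<in> T" using assms x p by (meson subsetD subspace_diff)
  ultimately show ?thesis
    by (intro that[of "(1 / norm (x - p)) *\<^sub>R (x - p)"]) (auto simp: assms(3) subspace_scale p)
qed

lemma subspace_closure:
  fixes S :: "'a::real_normed_vector set"
  assumes "subspace S" shows "subspace (closure S)"
proof (rule subspaceI)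
  show "0 \<in> closure S" using assms closure_subset subspace_0 by blast
  show "x + y \<in> closure S" if "x \<in> closure S" "y \<in> closure S" for x y
  proof -
    obtain a b where a: "\<And>n. a n \<in> S" "a \<longlonglongrightarrow> x" and b: "\<And>n. b n \<in> S" "b \<longlonglongrightarrow> y"
      using \<open>x \<in> closure S\<close> \<open>y \<in> closure S\<close> unfolding closure_sequential by blast
    have "a n + b n \<in> S" for n using a b assms by (simp add: subspace_add)
    then show ?thesis using tendsto_add[OF a(2) b(2)]
      unfolding closure_sequential by (intro exI[of _ "\<lambda>n. a n + b n"]) simp
  qed
  show "c *\<^sub>R x \<in> closure S" if "x \<in> closure S" for c x
  proof -
    obtain a where a: "\<And>n. a n \<in> S" "a \<longlonglongrightarrow> x"
      using \<open>x \<in> closure S\<close> unfolding closure_sequential by blast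
    have "c *\<^sub>R a n \<in> S" for n using a assms by (simp add: subspace_scale)
    then show ?thesis using tendsto_scaleR[OF tendsto_const a(2), of c]
      unfolding closure_sequential by (intro exI[of _ "\<lambda>n. c *\<^sub>R a n"]) simp
  qed
qed

lemma dense_if_trivial_complement:
  fixes S :: "'a::{real_inner,complete_space} set"
  assumes "subspace S" "\<And>u. (\<And>s. s \<in> S \<Longrightarrow> inner u s = 0) \<Longrightarrow> u = 0"
  shows "closure S = UNIV"
proof (rule ccontr)
  assume ne: "closure S \<noteq> UNIV"
  obtain u where "norm u = 1" "\<And>s. s \<in> closure S \<Longrightarrow> inner u s = 0"
    using orthogonal_unit_vector[OF subspace_closure[OF assms(1)] closed_closure subspace_UNIV _ ne]
    by auto
  then show False using assms(2)[of u] closure_subset by fastforce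
qed

text \<open>Extension by continuity in the form of a rule. Identities for \<open>T_op\<close> and
  \<open>T_plus\<close> are accessible only on the dense domain of the adjoint of \<open>F\<close>
  and are carried to the whole space this way.\<close>

lemma dense_closed_induct:
  assumes "closure S = UNIV" "closed {x. P x}" "\<And>x. x \<in> S \<Longrightarrow> P x"
  shows "P x"
  using closure_minimal[of S "{x. P x}"] assms by auto

lemma dense_complement_trivial:
  fixes S :: "'a::real_inner set"
  assumes "closure S = UNIV" "\<And>s. s \<in> S \<Longrightarrow> inner u s = 0"
  shows "u = 0"
proof -
  have "inner u u = 0"
    by (rule dense_closed_induct[where P = "\<lambda>s. inner u s = 0", OF assms(1)])
      (auto intro!: closed_Collect_eq continuous_intros assms(2))
  then show ?thesis by simp
qed

text \<open>Sokal's proof of the uniform boundedness principle: if the norms were unbounded, then a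
  geometrically convergent walk along suitably chosen members reaches a point at which the
  functionals are unbounded.\<close>

lemma weakly_bounded_imp_bounded:
  fixes f :: "nat \<Rightarrow> 'a::{real_inner,complete_space}"
  assumes sub: "subspace S" and cl: "closed S" and f: "\<And>n. f n \<in> S"
    and weak: "\<And>x. x \<in> S \<Longrightarrow> \<exists>C. \<forall>n. \<bar>inner (f n) x\<bar> \<le> C"
  shows "\<exists>C. \<forall>n. norm (f n) \<le> C"
proof (rule ccontr)
  assume "\<not> ?thesis"
  then have "\<exists>n. norm (f n) > C" for C by (meson not_le)
  then have "\<exists>n. norm (f n) \<ge> 4 ^ k" for k :: nat by (meson less_imp_le)
  then obtain m where m: "\<And>k. norm (f (m k)) \<ge> 4 ^ k" by metis
  define g where "g k = f (m k)" for k
  have g4: "norm (g k) \<ge> 4 ^ k" for k using m by (simp add: g_def)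
  have g0: "norm (g k) > 0" for k using g4[of k] by (meson less_le_trans zero_less_numeral zero_less_power)
  \<comment> \<open>The sign keeps the new step from cancelling \<open>inner (g k) (x k)\<close>.
    The step length \<open>(1/3) ^ k\<close> is matched to the growth \<open>4 ^ k\<close>: all
    later steps together undo at most half of the gain at step \<open>k\<close>, and
    \<open>(1/2) * (4/3) ^ k\<close> remains.\<close>
  define dir where "dir k y = ((if inner (g k) y \<ge> 0 then 1 else -1) * (1/3) ^ k / norm (g k)) *\<^sub>R g k" for k y
  define x where "x = rec_nat 0 (\<lambda>k y. y + dir k y)"
  have x0: "x 0 = 0" and xS: "x (Suc k) = x k + dir k (x k)" for k by (simp_all add: x_def)
  have nd: "norm (dir k y) = (1/3) ^ k" for k y using g0[of k] by (simp add: dir_def)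
  have inS: "x k \<in> S" for k
    by (induction k) (auto simp: x0 xS dir_def g_def f sub subspace_0 subspace_add subspace_scale subspace_diff subspace_neg)
  have big: "\<bar>inner (g k) (x (Suc k))\<bar> \<ge> (1/3) ^ k * norm (g k)" for k
  proof -
    have "inner (g k) (dir k (x k)) = (if inner (g k) (x k) \<ge> 0 then 1 else -1) * (1/3) ^ k * norm (g k)"
      using g0[of k] by (simp add: dir_def inner_commute dot_square_norm power2_eq_square)
    moreover have "0 \<le> (1/3) ^ k * norm (g k)" by simp
    ultimately show ?thesis by (simp add: xS inner_add_right split: if_splits)
  qed
  have step: "norm (x (k + j) - x k) \<le> (3/2) * (1/3) ^ k - (3/2) * (1/3) ^ (k + j)" for k j
  proof (induction j)
    case (Suc j)
    have "norm (x (k + Suc j) - x k) \<le> norm (x (k + j) - x k) + (1/3) ^ (k + j)"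
      using norm_triangle_ineq[of "x (k + j) - x k" "dir (k + j) (x (k + j))"] nd
      by (simp add: xS algebra_simps)
    also have "\<dots> \<le> (3/2) * (1/3) ^ k - (3/2) * (1/3) ^ (k + Suc j)"
      using Suc by simp
    finally show ?case .
  qed simp
  have step': "norm (x (k + j) - x k) \<le> (3/2) * (1/3) ^ k" for k j
  proof -
    have "0 \<le> (3/2) * (1/3::real) ^ (k + j)" by simp
    then show ?thesis using step[of k j] by linarith
  qed
  have "Cauchy x"
  proof (rule metric_CauchyI)
    fix e :: real assume e: "0 < e"
    have "(\<lambda>k. (3/2) * (1/3::real) ^ k) \<longlonglongrightarrow> (3/2) * 0"
      by (intro tendsto_intros LIMSEQ_power_zero) simp
    from order_tendstoD(2)[OF this, of "e / 2"] e obtain N where N: "(3/2) * (1/3::real) ^ N < e / 2" by (auto simp: eventually_sequentially)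
    have *: "dist (x n) (x N) < e / 2" if "n \<ge> N" for n
      using step'[of N "n - N"] that N by (simp add: dist_norm)
    have "dist (x m) (x n) < e" if "m \<ge> N" "n \<ge> N" for m n
      using *[OF that(1)] *[OF that(2)] by (metis dist_commute dist_triangle_half_r)
    then show "\<exists>M. \<forall>m\<ge>M. \<forall>n\<ge>M. dist (x m) (x n) < e" by blast
  qed
  then obtain z where z: "x \<longlonglongrightarrow> z" using Cauchy_convergent convergent_def by blast
  have zS: "z \<in> S" using closed_sequentially[OF cl _ z] inS by blast
  have tail: "norm (z - x k) \<le> (3/2) * (1/3) ^ k" for k
  proof (rule LIMSEQ_le_const2)
    show "(\<lambda>n. norm (x n - x k)) \<longlonglongrightarrow> norm (z - x k)" by (intro tendsto_intros z)
    show "\<exists>N. \<forall>n\<ge>N. norm (x n - x k) \<le> (3/2) * (1/3) ^ k"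
      using step'[of k] by (metis le_add_diff_inverse)
  qed
  obtain C where C: "\<And>n. \<bar>inner (f n) z\<bar> \<le> C" using weak[OF zS] by blast
  have "(1/2) * (4/3::real) ^ k \<le> C" for k
  proof -
    have "\<bar>inner (g k) (z - x (Suc k))\<bar> \<le> norm (g k) * ((3/2) * (1/3) ^ Suc k)"
      using Cauchy_Schwarz_ineq2[of "g k" "z - x (Suc k)"] tail[of "Suc k"]
      by (meson mult_left_mono norm_ge_zero order_trans)
    then have "\<bar>inner (g k) z - inner (g k) (x (Suc k))\<bar> \<le> (1/2) * ((1/3) ^ k * norm (g k))"
      by (simp add: inner_diff_right mult.commute)
    then have "\<bar>inner (g k) z\<bar> \<ge> (1/3) ^ k * norm (g k) - (1/2) * ((1/3) ^ k * norm (g k))"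
      using big[of k] by linarith
    then have "(1/2) * ((1/3) ^ k * norm (g k)) \<le> C" using C[of "m k"] by (simp add: g_def mult.commute)
    moreover have "(1/3) ^ k * 4 ^ k \<le> (1/3) ^ k * norm (g k)" using g4[of k] by simp
    ultimately show ?thesis by (simp add: power_divide)
  qed
  moreover obtain k where "(4/3::real) ^ k > 2 * C" using real_arch_pow[of "4/3" "2 * C"] by auto
  ultimately show False by (metis (no_types) divide_le_eq_numeral1(1) linorder_not_less mult.commute times_divide_eq_left mult_1)
qed

section \<open>Closed ranges of operators given by their graphs\<close>

lemma kernel_of_closed_graph:
  fixes G :: "('a::real_normed_vector \<times> 'b::real_normed_vector) set"
  assumes sub: "subspace G" and cl: "closed G"
  shows subspace_kernel: "subspace {x. (x, 0) \<in> G}" and closed_kernel: "closed {x. (x, 0) \<in> G}"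
proof -
  let ?K = "{x. (x, 0) \<in> G}"
  show "subspace ?K"
  proof (rule subspaceI)
    show "0 \<in> ?K" using subspace_0[OF sub] by (simp add: zero_prod_def)
    show "a + b \<in> ?K" if "a \<in> ?K" "b \<in> ?K" for a b
      using subspace_add[OF sub, of "(a, 0)" "(b, 0)"] that by simp
    show "c *\<^sub>R a \<in> ?K" if "a \<in> ?K" for a c
      using subspace_scale[OF sub, of "(a, 0)" c] that by simp
  qed
  have "closed ((\<lambda>x. (x, 0::'b)) -` G)" by (intro closed_vimage cl continuous_intros)
  then show "closed ?K" by (simp add: vimage_def)
qed

text \<open>The sequential hypothesis says that the operator with graph \<open>G\<close> is semi-Fredholm.\<close>

lemma closed_range_if_sequentially_proper:
  fixes G :: "('a::{real_inner,complete_space} \<times> 'b::{real_inner,complete_space}) set"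
  assumes sub: "subspace G" and cl: "closed G"
    and proper: "\<And>x y l. (\<And>n::nat. (x n, y n) \<in> G) \<Longrightarrow> bounded (range x) \<Longrightarrow> y \<longlonglongrightarrow> l
      \<Longrightarrow> \<exists>\<sigma> a. strict_mono (\<sigma>::nat\<Rightarrow>nat) \<and> (x \<circ> \<sigma>) \<longlonglongrightarrow> a"
  shows "closed (Range G)"
  unfolding closed_sequential_limits
proof (intro allI impI, elim conjE)
  fix y :: "nat \<Rightarrow> 'b" and l assume "\<forall>n. y n \<in> Range G" and yl: "y \<longlonglongrightarrow> l"
  then obtain x0 where x0: "\<And>n. (x0 n, y n) \<in> G" unfolding Range_iff by metis
  define K where "K = {x. (x, 0) \<in> G}"
  have subK: "subspace K" and clK: "closed K"
    unfolding K_def by (rule kernel_of_closed_graph[OF sub cl])+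
  have "\<exists>p\<in>K. \<forall>s\<in>K. inner (x0 n - p) s = 0" for n
    using orthogonal_projection_exists[OF subK clK, of "x0 n"] by metis
  then obtain p where p: "\<And>n. p n \<in> K" and po: "\<And>n s. s \<in> K \<Longrightarrow> inner (x0 n - p n) s = 0" by metis
  \<comment> \<open>The kernel component is removed, since it alone could make the preimages
    unbounded.\<close>
  define x where "x n = x0 n - p n" for n
  have xG: "(x n, y n) \<in> G" for n
    using subspace_diff[OF sub x0[of n], of "(p n, 0)"] p by (simp add: K_def x_def)
  have xo: "inner (x n) s = 0" if "s \<in> K" for n s using po that by (simp add: x_def)
  \<comment> \<open>Otherwise the normalised preimages accumulate, by \<open>proper\<close>, at a
    unit vector that lies in the kernel and is orthogonal to it.\<close>
  have bx: "bounded (range x)"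
  proof (rule ccontr)
    assume "\<not> bounded (range x)"
    then have "\<exists>n. norm (x n) > C" for C by (metis bounded_iff not_le rangeE)
    then have "\<exists>n. norm (x n) > real k" for k by blast
    then obtain m where m: "\<And>k::nat. norm (x (m k)) > real k" by metis
    have pos: "norm (x (m k)) > 0" for k using m[of k] by (meson le_less_trans of_nat_0_le_iff)
    define u where "u k = (1 / norm (x (m k))) *\<^sub>R x (m k)" for k
    define v where "v k = (1 / norm (x (m k))) *\<^sub>R y (m k)" for k
    have uv: "(u k, v k) \<in> G" for k
      using subspace_scale[OF sub xG[of "m k"], of "1 / norm (x (m k))"] by (simp add: u_def v_def)
    have nu: "norm (u k) = 1" for k using pos[of k] by (simp add: u_def)
    obtain C where C: "\<And>n. norm (y n) \<le> C"
      using convergent_imp_bounded[OF yl] by (auto simp: bounded_iff)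
    have "v \<longlonglongrightarrow> 0"
    proof (rule Lim_null_comparison)
      show "\<forall>\<^sub>F k in sequentially. norm (v k) \<le> C / real k"
      proof (rule eventually_sequentiallyI[of 1])
        fix k :: nat assume k: "1 \<le> k"
        have "norm (v k) = norm (y (m k)) / norm (x (m k))" by (simp add: v_def)
        also have "\<dots> \<le> C / real k"
          using C[of "m k"] m[of k] k pos[of k] by (intro frac_le) (auto intro: order_trans[OF norm_ge_zero])
        finally show "norm (v k) \<le> C / real k" .
      qed
      show "(\<lambda>k. C / real k) \<longlonglongrightarrow> 0" by (rule lim_const_over_n)
    qed
    moreover have "bounded (range u)" using nu by (auto simp: bounded_iff)
    ultimately obtain \<sigma> a where \<sigma>: "strict_mono (\<sigma>::nat\<Rightarrow>nat)" and ua: "(u \<circ> \<sigma>) \<longlonglongrightarrow> a"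
      using proper[of u v] uv by blast
    have "(\<lambda>k. ((u \<circ> \<sigma>) k, (v \<circ> \<sigma>) k)) \<longlonglongrightarrow> (a, 0)"
      using ua LIMSEQ_subseq_LIMSEQ[OF \<open>v \<longlonglongrightarrow> 0\<close> \<sigma>] by (rule tendsto_Pair)
    then have "(a, 0) \<in> G" using closed_sequentially[OF cl, rotated] uv by fastforce
    then have "a \<in> K" by (simp add: K_def)
    then have "inner (u k) a = 0" for k using xo by (simp add: u_def)
    moreover have "(\<lambda>k. inner ((u \<circ> \<sigma>) k) a) \<longlonglongrightarrow> inner a a" by (intro tendsto_intros ua)
    ultimately have "inner a a = 0" by (simp add: LIMSEQ_const_iff)
    moreover have "norm a = 1"
      using tendsto_norm[OF ua] nu by (simp add: LIMSEQ_const_iff)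
    ultimately show False by simp
  qed
  obtain \<sigma> a where \<sigma>: "strict_mono (\<sigma>::nat\<Rightarrow>nat)" and xa: "(x \<circ> \<sigma>) \<longlonglongrightarrow> a"
    using proper[OF xG bx yl] by blast
  have "(\<lambda>k. ((x \<circ> \<sigma>) k, (y \<circ> \<sigma>) k)) \<longlonglongrightarrow> (a, l)"
    using xa LIMSEQ_subseq_LIMSEQ[OF yl \<sigma>] by (rule tendsto_Pair)
  then have "(a, l) \<in> G" using closed_sequentially[OF cl, rotated] xG by fastforce
  then show "l \<in> Range G" by blast
qed

section \<open>The complex inner product\<close>

lemma cinner_add_right: "cinner x (y + z) = cinner x y + cinner x z"
  for x y z :: "'a::complex_hilbert"
  by (metis cinner_add_left cinner_commute complex_cnj_add)

lemma cinner_scaleC_right: "cinner x (c *\<^sub>C y) = cnj c * cinner x y"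
  for x y :: "'a::complex_hilbert"
  by (metis cinner_commute cinner_scaleC_left complex_cnj_mult)

lemma cinner_scaleR_left: "cinner (r *\<^sub>R x) y = of_real r * cinner x y"
  for x y :: "'a::complex_hilbert"
  by (simp add: scaleR_scaleC cinner_scaleC_left)

lemma cinner_scaleR_right: "cinner x (r *\<^sub>R y) = of_real r * cinner x y"
  for x y :: "'a::complex_hilbert"
  by (simp add: scaleR_scaleC cinner_scaleC_right)

lemma Im_cinner: "Im (cinner x y) = inner x (\<i> *\<^sub>C y)" for x y :: "'a::complex_hilbert"
  by (subst inner_eq_Re_cinner, subst cinner_scaleC_right) simp

lemma cinner_eq_inner: "cinner x y = Complex (inner x y) (inner x (\<i> *\<^sub>C y))"
  for x y :: "'a::complex_hilbert"
  by (rule complex_eqI) (simp_all add: Im_cinner, simp add: inner_eq_Re_cinner)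

text \<open>Multiplying \<open>x\<close> by a unimodular scalar makes the complex inner product real
  and non-negative, which reduces the claim to the real Cauchy-Schwarz inequality.\<close>

lemma norm_cinner_le: "norm (cinner x y) \<le> norm x * norm y" for x y :: "'a::complex_hilbert"
proof (cases "cinner x y = 0")
  case False
  define u where "u = cnj (sgn (cinner x y))"
  have "norm u = 1" using False by (simp add: u_def norm_sgn)
  have "cinner (u *\<^sub>C x) y = of_real (norm (cinner x y))"
    using False by (simp add: cinner_scaleC_left u_def sgn_eq)
      (metis complex_norm_square mult.commute of_real_power power2_eq_square nonzero_mult_div_cancel_right of_real_eq_0_iff norm_eq_zero)
  then have "norm (cinner x y) = inner (u *\<^sub>C x) y" by (simp add: inner_eq_Re_cinner)
  also have "\<dots> \<le> norm (u *\<^sub>C x) * norm y" by (rule norm_cauchy_schwarz)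
  finally show ?thesis by (simp add: norm_scaleC \<open>norm u = 1\<close>)
qed simp

lemma bounded_bilinear_cinner: "bounded_bilinear (cinner :: 'a::complex_hilbert \<Rightarrow> 'a \<Rightarrow> complex)"
  by (rule bounded_bilinear.intro)
    (auto simp: cinner_add_left cinner_add_right cinner_scaleR_left cinner_scaleR_right
      scaleR_conv_of_real intro!: exI[of _ 1] norm_cinner_le)

lemmas cinner_zero_left [simp] = bounded_bilinear.zero_left[OF bounded_bilinear_cinner]
lemmas cinner_zero_right [simp] = bounded_bilinear.zero_right[OF bounded_bilinear_cinner]
lemmas cinner_diff_left = bounded_bilinear.diff_left[OF bounded_bilinear_cinner]
lemmas cinner_diff_right = bounded_bilinear.diff_right[OF bounded_bilinear_cinner]
lemmas cinner_minus_left = bounded_bilinear.minus_left[OF bounded_bilinear_cinner]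
lemmas tendsto_cinner = bounded_bilinear.tendsto[OF bounded_bilinear_cinner]
lemmas continuous_on_cinner = bounded_bilinear.continuous_on[OF bounded_bilinear_cinner]

lemma bounded_linear_scaleC_right: "bounded_linear (\<lambda>x::'a::complex_hilbert. c *\<^sub>C x)"
  by (rule bounded_linear_intro[where K = "norm c"])
    (auto simp: scaleC_add_right norm_scaleC scaleR_scaleC scaleC_scaleC mult.commute)

lemmas scaleC_zero_right [simp] = linear_0[OF bounded_linear.linear[OF bounded_linear_scaleC_right]]
lemmas scaleC_diff_right = linear_diff[OF bounded_linear.linear[OF bounded_linear_scaleC_right]]
lemmas scaleC_minus_right = linear_neg[OF bounded_linear.linear[OF bounded_linear_scaleC_right]]

lemma bounded_linear_scaleC_left: "bounded_linear (\<lambda>c. c *\<^sub>C (x::'a::complex_hilbert))"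
  by (rule bounded_linear_intro[where K = "norm x"])
    (auto simp: scaleC_add_left norm_scaleC scaleR_scaleC[where 'a='a] scaleC_scaleC scaleR_conv_of_real)

lemmas scaleC_zero_left [simp] = linear_0[OF bounded_linear.linear[OF bounded_linear_scaleC_left]]
lemmas scaleC_diff_left = linear_diff[OF bounded_linear.linear[OF bounded_linear_scaleC_left]]
lemmas scaleC_minus_left = linear_neg[OF bounded_linear.linear[OF bounded_linear_scaleC_left]]

lemma scaleC_one [simp]: "1 *\<^sub>C x = (x::'a::complex_hilbert)"
  by (metis of_real_1 scaleR_one scaleR_scaleC)

lemma cinner_self: "cinner x x = of_real ((norm x)\<^sup>2)" for x :: "'a::complex_hilbert"
proof -
  have "cnj (cinner x x) = cinner x x" by (simp flip: cinner_commute)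
  then have "Im (cinner x x) = 0" by (simp add: complex_eq_iff)
  then show ?thesis by (simp add: complex_eq_iff inner_eq_Re_cinner[symmetric] power2_norm_eq_inner)
qed

lemma cinner_extensional:
  assumes "\<And>x. cinner x y = cinner x z" shows "y = (z::'a::complex_hilbert)"
proof -
  have "cinner (y - z) (y - z) = 0" by (simp add: assms cinner_diff_right)
  then show ?thesis by (simp add: cinner_self)
qed

lemma dense_cinner_extensional:
  fixes y z :: "'a::complex_hilbert"
  assumes "closure S = UNIV" "\<And>x. x \<in> S \<Longrightarrow> cinner x y = cinner x z" shows "y = z"
proof -
  have "inner (y - z) s = 0" if "s \<in> S" for s
    using assms(2)[OF that]
    by (subst inner_commute, subst inner_eq_Re_cinner, subst cinner_diff_right) simp
  then show ?thesis using dense_complement_trivial[OF assms(1), of "y - z"] by simp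
qed

section \<open>Bounded operators\<close>

instance complex_hilbert \<subseteq> banach ..

lemma clinear_op_apply: "clinear_op T \<Longrightarrow> T (c *\<^sub>C x) = c *\<^sub>C T x"
  by (simp add: clinear_op_def)

lemma clinear_op_scaleC_op: "clinear_op T \<Longrightarrow> clinear_op (scaleC_op c T)"
  by (simp add: clinear_op_def scaleC_op_apply scaleC_scaleC mult.commute)

lemma clinear_op_add: "clinear_op S \<Longrightarrow> clinear_op T \<Longrightarrow> clinear_op (S + T)"
  by (simp add: clinear_op_def blinfun.add_left scaleC_add_right)

lemma clinear_op_diff: "clinear_op S \<Longrightarrow> clinear_op T \<Longrightarrow> clinear_op (S - T)"
  by (simp add: clinear_op_def blinfun.diff_left scaleC_diff_right)

lemma clinear_op_scaleR: "clinear_op T \<Longrightarrow> clinear_op (a *\<^sub>R T)"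
  by (simp add: clinear_op_def blinfun.scaleR_left scaleR_scaleC scaleC_scaleC mult.commute)

lemma clinear_op_compose: "clinear_op S \<Longrightarrow> clinear_op T \<Longrightarrow> clinear_op (S o\<^sub>L T)"
  by (simp add: clinear_op_def)

lemma clinear_op_id: "clinear_op id_blinfun" and clinear_op_zero: "clinear_op 0"
  by (simp_all add: clinear_op_def)

lemmas clinear_op_intros = clinear_op_scaleC_op clinear_op_add clinear_op_diff clinear_op_scaleR
  clinear_op_compose clinear_op_id clinear_op_zero

lemma scaleC_op_of_real: "scaleC_op (of_real a) T = a *\<^sub>R T"
  by (rule blinfun_eqI) (simp add: scaleC_op_apply blinfun.scaleR_left scaleR_scaleC)

lemma norm_scaleC_op: "norm (scaleC_op c T) = norm c * norm T"
proof -
  have le: "norm (scaleC_op c T) \<le> norm c * norm T" for c and T :: "'a::complex_hilbert \<Rightarrow>\<^sub>L 'b::complex_hilbert"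
    by (rule norm_blinfun_bound)
      (auto simp: scaleC_op_apply norm_scaleC mult.assoc intro!: mult_left_mono norm_blinfun)
  show ?thesis
  proof (cases "c = 0")
    case True
    then show ?thesis using le[of c T] by (simp add: antisym)
  next
    case False
    then have "T = scaleC_op (inverse c) (scaleC_op c T)"
      by (intro blinfun_eqI) (simp add: scaleC_op_apply scaleC_scaleC)
    then have "norm T \<le> norm (inverse c) * norm (scaleC_op c T)" using le by metis
    then have "norm c * norm T \<le> norm (scaleC_op c T)"
      using False by (simp add: norm_inverse norm_divide field_simps)
    then show ?thesis using le[of c T] by simp
  qed
qed

lemma bounded_bilinear_scaleC_op:
  "bounded_bilinear (scaleC_op :: complex \<Rightarrow> ('a::complex_hilbert \<Rightarrow>\<^sub>L 'b::complex_hilbert) \<Rightarrow> _)"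
  by (rule bounded_bilinear.intro)
    (auto intro!: blinfun_eqI exI[of _ 1] simp: scaleC_op_apply blinfun.add_left scaleC_add_left
      scaleC_add_right blinfun.scaleR_left scaleR_scaleC[where 'a='b] scaleC_scaleC mult.commute
      scaleR_conv_of_real norm_scaleC_op)

lemma clinear_op_limit:
  assumes "(f \<longlongrightarrow> T) F" "F \<noteq> bot" "\<forall>\<^sub>F y in F. clinear_op (f y)"
  shows "clinear_op T"
  unfolding clinear_op_def
proof (intro allI)
  fix c x
  have "((\<lambda>y. f y (c *\<^sub>C x)) \<longlongrightarrow> T (c *\<^sub>C x)) F" by (intro blinfun.tendsto assms tendsto_const)
  moreover have "((\<lambda>y. c *\<^sub>C f y x) \<longlongrightarrow> c *\<^sub>C T x) F"
    by (intro bounded_linear.tendsto[OF bounded_linear_scaleC_right] blinfun.tendsto assms tendsto_const)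
  then have "((\<lambda>y. f y (c *\<^sub>C x)) \<longlongrightarrow> c *\<^sub>C T x) F"
    by (rule Lim_transform_eventually) (use assms(3) in eventually_elim, simp add: clinear_op_def)
  ultimately show "T (c *\<^sub>C x) = c *\<^sub>C T x" using assms(2) tendsto_unique by blast
qed

text \<open>The lower bound gives injectivity and at the same time the norm bound for the inverse,
  so the open mapping theorem does not enter.\<close>

lemma bounded_inverse_exists:
  fixes M :: "'a::real_normed_vector \<Rightarrow>\<^sub>L 'b::real_normed_vector"
  assumes surj: "\<And>y. \<exists>x. M x = y" and low: "\<And>x. norm x \<le> C * norm (M x)"
  shows "\<exists>R. R o\<^sub>L M = id_blinfun \<and> M o\<^sub>L R = id_blinfun"
proof -
  obtain R where R: "\<And>y. M (R y) = y" using surj by metis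
  have inj: "x = x'" if "M x = M x'" for x x'
    using low[of "x - x'"] that by (simp add: blinfun.diff_right)
  have RM: "R (M x) = x" for x using inj[OF R] .
  have "bounded_linear R"
    by (rule bounded_linear_intro[where K = C])
      (auto intro!: inj simp: R blinfun.add_right blinfun.scaleR_right, metis R low mult.commute)
  then show ?thesis
    by (intro exI[of _ "Blinfun R"])
      (auto intro!: blinfun_eqI simp: bounded_linear_Blinfun_apply R RM)
qed

text \<open>A relation rather than an inverse function: invertibility is itself the property under
  study, being equivalent to non-resonance.\<close>

definition inverse_ops :: "('a::real_normed_vector \<Rightarrow>\<^sub>L 'a) \<Rightarrow> ('a \<Rightarrow>\<^sub>L 'a) \<Rightarrow> bool"
  where "inverse_ops M R \<longleftrightarrow> R o\<^sub>L M = id_blinfun \<and> M o\<^sub>L R = id_blinfun"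

lemma inverse_ops_apply:
  fixes M R :: "'a::real_normed_vector \<Rightarrow>\<^sub>L 'a"
  shows "inverse_ops M R \<Longrightarrow> R (M x) = x" "inverse_ops M R \<Longrightarrow> M (R x) = x"
  unfolding inverse_ops_def by (metis blinfun_apply_blinfun_compose blinfun_apply_id_blinfun id_apply)+

lemma inverse_opsI:
  fixes M R :: "'a::real_normed_vector \<Rightarrow>\<^sub>L 'a"
  shows "(\<And>x. R (M x) = x) \<Longrightarrow> (\<And>x. M (R x) = x) \<Longrightarrow> inverse_ops M R"
  unfolding inverse_ops_def by (auto intro!: blinfun_eqI)

lemma inverse_ops_unique: "inverse_ops M R \<Longrightarrow> inverse_ops M R' \<Longrightarrow> R = R'"
  by (rule blinfun_eqI) (metis inverse_ops_apply)

lemma inverse_ops_clinear: "inverse_ops M R \<Longrightarrow> clinear_op M \<Longrightarrow> clinear_op R"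
  unfolding clinear_op_def by (metis inverse_ops_apply)

lemma inverse_ops_commute:
  fixes B :: "'a::real_normed_vector \<Rightarrow>\<^sub>L 'a"
  shows "inverse_ops M R \<Longrightarrow> (\<And>x. B (M x) = M (B x)) \<Longrightarrow> B (R x) = R (B x)"
proof -
  assume M: "inverse_ops M R" and B: "\<And>x. B (M x) = M (B x)"
  have "B (R x) = R (M (B (R x)))" by (simp add: inverse_ops_apply(1)[OF M])
  also have "\<dots> = R (B x)" by (simp add: B[symmetric] inverse_ops_apply(2)[OF M])
  finally show ?thesis .
qed

text \<open>Solving \<open>x - B x = y\<close> amounts to finding the fixed point of the contraction
  \<open>x \<mapsto> y + B x\<close>; the triangle inequality gives the lower bound.\<close>

lemma neumann_inverse:
  fixes B :: "'a::banach \<Rightarrow>\<^sub>L 'a"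
  assumes B: "norm B < 1"
  shows "\<exists>R. inverse_ops (id_blinfun - B) R"
  unfolding inverse_ops_def
proof (rule bounded_inverse_exists)
  fix y
  have "\<exists>!x. y + B x = x"
  proof (rule banach_fix_type[where c = "norm B"])
    show "\<forall>x z. dist (y + B x) (y + B z) \<le> norm B * dist x z"
      by (simp add: dist_norm norm_blinfun flip: blinfun.diff_right)
  qed (use B in auto)
  then show "\<exists>x. (id_blinfun - B) x = y"
    by (metis add_diff_cancel_right' blinfun.diff_left blinfun_apply_id_blinfun id_apply)
next
  fix x
  have "norm x - norm B * norm x \<le> norm x - norm (B x)" using norm_blinfun[of B x] by simp
  also have "\<dots> \<le> norm ((id_blinfun - B) x)"
    by (simp add: blinfun.diff_left norm_triangle_ineq2)
  finally have "norm x * (1 - norm B) \<le> norm ((id_blinfun - B) x)" by (simp add: algebra_simps)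
  then show "norm x \<le> (1 / (1 - norm B)) * norm ((id_blinfun - B) x)"
    using B by (simp add: field_simps)
qed

text \<open>Factor \<open>M + B = M (1 + R B)\<close> and invert the second factor by the Neumann
  argument.\<close>

lemma inverse_ops_perturb:
  fixes M :: "'a::banach \<Rightarrow>\<^sub>L 'a"
  assumes R: "inverse_ops M R" and small: "norm R * norm B < 1"
  shows "\<exists>R'. inverse_ops (M + B) R'"
proof -
  have "norm (- (R o\<^sub>L B)) < 1" using small norm_blinfun_compose[of R B] by simp
  then obtain S where S: "inverse_ops (id_blinfun - (- (R o\<^sub>L B))) S" using neumann_inverse by blast
  have Sa: "S (x + R (B x)) = x" "S x + R (B (S x)) = x" for x
    using inverse_ops_apply[OF S, of x] by (simp_all add: blinfun.add_left)
  have "inverse_ops (M + B) (S o\<^sub>L R)"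
  proof (rule inverse_opsI)
    show "(S o\<^sub>L R) ((M + B) x) = x" for x
      using Sa(1)[of x] by (simp add: blinfun.add_left blinfun.add_right inverse_ops_apply[OF R])
    show "(M + B) ((S o\<^sub>L R) x) = x" for x
      using arg_cong[OF Sa(2)[of "R x"], of M]
      by (simp add: blinfun.add_left blinfun.add_right inverse_ops_apply[OF R])
  qed
  then show ?thesis by blast
qed

lemma adj_op_eqI:
  fixes T :: "'a::complex_hilbert \<Rightarrow>\<^sub>L 'b::complex_hilbert" and S :: "'b \<Rightarrow>\<^sub>L 'a"
  assumes "\<And>x y. cinner (T x) y = cinner x (S y)" shows "adj_op T = S"
  unfolding adj_op_def
proof (rule the_equality)
  show "S' = S" if "\<forall>x y. cinner (T x) y = cinner x (blinfun_apply S' y)" for S'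
    by (rule blinfun_eqI, rule cinner_extensional) (use that assms in metis)
qed (use assms in blast)

section \<open>Compact operators\<close>

text \<open>The form in which compactness is consumed by the subsequence arguments. It leaves
  complex linearity aside, so Riesz theory can be done over the reals.\<close>

definition seq_compact_op :: "('a::real_normed_vector \<Rightarrow>\<^sub>L 'b::real_normed_vector) \<Rightarrow> bool"
  where "seq_compact_op K \<longleftrightarrow> (\<forall>x::nat \<Rightarrow> 'a. bounded (range x) \<longrightarrow>
    (\<exists>\<sigma> l. strict_mono (\<sigma>::nat\<Rightarrow>nat) \<and> (\<lambda>n. K (x (\<sigma> n))) \<longlonglongrightarrow> l))"

lemma seq_compact_opE:
  fixes x :: "nat \<Rightarrow> 'a::real_normed_vector"
  assumes "seq_compact_op K" "bounded (range x)"
  obtains \<sigma> l where "strict_mono (\<sigma>::nat\<Rightarrow>nat)" "(\<lambda>n. K (x (\<sigma> n))) \<longlonglongrightarrow> l"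
  using assms unfolding seq_compact_op_def by blast

lemma compact_imp_seq_compact_op:
  assumes "compact_op K" shows "seq_compact_op K"
  unfolding seq_compact_op_def
proof (intro allI impI)
  fix x :: "nat \<Rightarrow> 'a" assume "bounded (range x)"
  then obtain C where C: "C > 0" "\<And>n. norm (x n) \<le> C" by (auto simp: bounded_pos)
  have "K ((1 / C) *\<^sub>R x n) \<in> closure (blinfun_apply K ` cball 0 1)" for n
    using C by (intro subsetD[OF closure_subset] imageI) (auto simp: field_simps)
  then obtain l \<sigma> where \<sigma>: "strict_mono (\<sigma>::nat\<Rightarrow>nat)" and l: "((\<lambda>n. K ((1 / C) *\<^sub>R x n)) \<circ> \<sigma>) \<longlonglongrightarrow> l"
    using assms unfolding compact_op_def compact_eq_seq_compact_metric seq_compact_def by metis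
  have "(\<lambda>n. C *\<^sub>R K ((1 / C) *\<^sub>R x (\<sigma> n))) \<longlonglongrightarrow> C *\<^sub>R l" using l by (intro tendsto_intros) (simp add: o_def)
  then show "\<exists>\<sigma> l. strict_mono (\<sigma>::nat\<Rightarrow>nat) \<and> (\<lambda>n. K (x (\<sigma> n))) \<longlonglongrightarrow> l"
    using C \<sigma> by (auto simp: blinfun.scaleR_right)
qed

text \<open>Total boundedness survives norm limits: a finite net for the image of the unit ball
  under a nearby compact operator is a coarser net for the image under \<open>K\<close>.\<close>

lemma compact_op_limit:
  assumes lin: "clinear_op K" and approx: "\<And>e. 0 < e \<Longrightarrow> \<exists>K'. compact_op K' \<and> norm (K - K') < e"
  shows "compact_op K"
proof -
  have "\<exists>k. finite k \<and> closure (blinfun_apply K ` cball 0 1) \<subseteq> (\<Union>x\<in>k. ball x e)" if e: "0 < e" for e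
  proof -
    obtain K' where K': "compact_op K'" "norm (K - K') < e / 4" using approx[of "e / 4"] e by auto
    then obtain k where k: "finite k" "closure (blinfun_apply K' ` cball 0 1) \<subseteq> (\<Union>x\<in>k. ball x (e / 4))"
      unfolding compact_op_def compact_eq_totally_bounded using e by (meson divide_pos_pos zero_less_numeral)
    \<comment> \<open>Closed balls of half the radius, so that the finite cover passes to the
      closure and then fits into open balls of radius \<open>e\<close>.\<close>
    have "blinfun_apply K ` cball 0 1 \<subseteq> (\<Union>x\<in>k. cball x (e / 2))"
    proof (rule image_subsetI)
      fix u :: 'a assume u: "u \<in> cball 0 1"
      then have "K' u \<in> closure (blinfun_apply K' ` cball 0 1)" by (meson closure_subset imageI subsetD)
      then obtain x where x: "x \<in> k" "dist x (K' u) < e / 4" using k by force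
      have "norm ((K - K') u) \<le> norm (K - K') * norm u" by (rule norm_blinfun)
      also have "\<dots> \<le> norm (K - K') * 1" using u by (intro mult_left_mono) auto
      finally have "dist (K' u) (K u) < e / 4"
        using K' by (simp add: dist_norm norm_minus_commute blinfun.diff_left)
      then have "dist x (K u) < e / 2" using dist_triangle[of x "K u" "K' u"] x by linarith
      then show "K u \<in> (\<Union>x\<in>k. cball x (e / 2))" using x by (auto intro: less_imp_le)
    qed
    then have "closure (blinfun_apply K ` cball 0 1) \<subseteq> (\<Union>x\<in>k. cball x (e / 2))"
      using k by (intro closure_minimal closed_UN) auto
    also have "\<dots> \<subseteq> (\<Union>x\<in>k. ball x e)" using e by (intro UN_mono) auto
    finally show ?thesis using k by blast
  qed
  then show ?thesis using lin by (auto simp: compact_op_def compact_eq_totally_bounded complete_eq_closed)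
qed

lemma seq_compact_op_compose_right: "seq_compact_op K \<Longrightarrow> seq_compact_op (K o\<^sub>L B)"
  unfolding seq_compact_op_def
proof (intro allI impI)
  fix x :: "nat \<Rightarrow> 'c"
  assume K: "\<forall>x::nat \<Rightarrow> 'a. bounded (range x) \<longrightarrow> (\<exists>\<sigma> l. strict_mono (\<sigma>::nat\<Rightarrow>nat) \<and> (\<lambda>n. blinfun_apply K (x (\<sigma> n))) \<longlonglongrightarrow> l)"
    and "bounded (range x)"
  then have "bounded (range (\<lambda>n. B (x n)))"
    using bounded_linear_image[OF _ blinfun.bounded_linear_right, of "range x" B] by (simp add: image_image)
  then show "\<exists>\<sigma> l. strict_mono (\<sigma>::nat\<Rightarrow>nat) \<and> (\<lambda>n. (K o\<^sub>L B) (x (\<sigma> n))) \<longlonglongrightarrow> l"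
    using K[rule_format, of "\<lambda>n. B (x n)"] by simp
qed

lemma seq_compact_op_compose_left:
  assumes "seq_compact_op K" shows "seq_compact_op (B o\<^sub>L K)"
  unfolding seq_compact_op_def
proof (intro allI impI)
  fix x :: "nat \<Rightarrow> 'a" assume "bounded (range x)"
  then obtain \<sigma> l where "strict_mono (\<sigma>::nat\<Rightarrow>nat)" "(\<lambda>n. K (x (\<sigma> n))) \<longlonglongrightarrow> l"
    by (rule seq_compact_opE[OF assms])
  then show "\<exists>\<sigma> l. strict_mono (\<sigma>::nat\<Rightarrow>nat) \<and> (\<lambda>n. (B o\<^sub>L K) (x (\<sigma> n))) \<longlonglongrightarrow> l"
    by (auto intro!: exI[of _ \<sigma>] exI[of _ "B l"] blinfun.tendsto)
qed

lemma seq_compact_op_scaleC: "seq_compact_op K \<Longrightarrow> seq_compact_op (scaleC_op c K)"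
proof -
  assume "seq_compact_op K"
  then have "seq_compact_op (scaleC_op c id_blinfun o\<^sub>L K)" by (rule seq_compact_op_compose_left)
  moreover have "scaleC_op c id_blinfun o\<^sub>L K = scaleC_op c K"
    by (rule blinfun_eqI) (simp add: scaleC_op_apply)
  ultimately show ?thesis by simp
qed

section \<open>Riesz theory\<close>

text \<open>Powers kept as bounded operators, so that norms, continuity and composition apply;
  \<open>op_power_apply\<close> links them to the iterates in \<open>Upsilon\<close>.\<close>

primrec op_power :: "('a::real_normed_vector \<Rightarrow>\<^sub>L 'a) \<Rightarrow> nat \<Rightarrow> 'a \<Rightarrow>\<^sub>L 'a"
  where "op_power N 0 = id_blinfun"
  | "op_power N (Suc n) = N o\<^sub>L op_power N n"

lemma op_power_apply: "op_power N n x = (blinfun_apply N ^^ n) x"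
  by (induction n) auto

lemma op_power_commute:
  assumes "\<And>x. blinfun_apply B (blinfun_apply N x) = N (B x)"
  shows "blinfun_apply B (op_power N n x) = op_power N n (B x)"
  by (induction n) (auto simp: assms)

lemma op_power_swap: "N (op_power N n x) = op_power N n (N x)"
  by (rule op_power_commute) simp

lemma op_power_add: "op_power N (m + n) x = op_power N m (op_power N n x)"
  by (induction m) auto

lemma op_power_clinear: "clinear_op N \<Longrightarrow> clinear_op (op_power N n)"
  by (induction n) (auto intro: clinear_op_intros)

text \<open>One stationary step freezes the kernel chain from there on: each further power is
  removed by applying the hypothesis to \<open>op_power N m x\<close>.\<close>

lemma op_power_kernel_stable:
  assumes "\<And>x. op_power N (Suc n) x = 0 \<Longrightarrow> op_power N n x = 0" "op_power N (m + n) x = 0"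
  shows "op_power N n x = 0"
  using assms(2)
proof (induction m)
  case (Suc m)
  have "op_power N (Suc n) (op_power N m x) = 0"
    using Suc.prems by (metis op_power_add add.commute add_Suc_right)
  then have "op_power N n (op_power N m x) = 0" by (rule assms(1))
  then show ?case using Suc.IH by (metis op_power_add add.commute)
qed simp

lemma op_power_range_stable:
  assumes "\<And>x. \<exists>y. op_power N n x = op_power N (Suc n) y"
  shows "\<exists>y. op_power N n x = op_power N (m + n) y"
proof (induction m)
  case (Suc m)
  then obtain y where y: "op_power N n x = op_power N (m + n) y" by blast
  obtain z where "op_power N n y = op_power N (Suc n) z" using assms by blast
  then have "op_power N n x = op_power N (Suc m + n) z"
    by (metis y op_power_add add_Suc_right add_Suc)
  then show ?case by blast
qed auto

text \<open>The contradiction shared by the ascent and the descent argument: a bounded sequence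
  whose images stay at mutual distance at least 1 has no subsequence with convergent images.\<close>

lemma seq_compact_op_not_separated:
  assumes K: "seq_compact_op K" and u: "\<And>j::nat. norm (u j) = 1"
    and sep: "\<And>i j. i < j \<Longrightarrow> 1 \<le> norm (K (u j) - K (u i))"
  shows False
proof -
  have "bounded (range u)" using u by (auto simp: bounded_iff)
  then obtain \<sigma> l where \<sigma>: "strict_mono (\<sigma>::nat\<Rightarrow>nat)" and l: "(\<lambda>n. K (u (\<sigma> n))) \<longlonglongrightarrow> l"
    by (rule seq_compact_opE[OF K])
  have "Cauchy (\<lambda>n. K (u (\<sigma> n)))" using l by (rule LIMSEQ_imp_Cauchy)
  then obtain M where "\<forall>m\<ge>M. \<forall>n\<ge>M. norm (K (u (\<sigma> m)) - K (u (\<sigma> n))) < 1"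
    using CauchyD zero_less_one by blast
  moreover have "\<sigma> M < \<sigma> (Suc M)" using \<sigma> by (simp add: strict_mono_Suc_iff)
  ultimately show False using sep[of "\<sigma> M" "\<sigma> (Suc M)"] by (meson le_SucI linorder_not_le order_refl)
qed

lemma norm_diff_ge_if_orthogonal:
  assumes "inner u w = 0" "norm u = 1" shows "1 \<le> norm (u - w)"
proof -
  have "(norm (u - w))\<^sup>2 = (norm u)\<^sup>2 + (norm w)\<^sup>2"
    using assms(1) by (simp add: power2_norm_eq_inner inner_diff_left inner_diff_right inner_commute)
  then have "1\<^sup>2 \<le> (norm (u - w))\<^sup>2" using assms by simp
  then show ?thesis by (rule power2_le_imp_le) simp
qed

locale compact_perturbation =
  fixes K N :: "'a::{real_inner,complete_space} \<Rightarrow>\<^sub>L 'a"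
  assumes K: "seq_compact_op K" and N_def: "N = id_blinfun - K"
begin

lemma N_apply: "N x = x - K x"
  by (simp add: N_def blinfun.diff_left)

text \<open>Since \<open>y = N y + K y\<close>, convergence of \<open>N y\<close> and, along a
  subsequence, of \<open>K y\<close> forces convergence of \<open>y\<close>. With
  \<open>y = N^n x\<close> this removes one power at a time.\<close>

lemma power_proper:
  assumes "bounded (range x)" "(\<lambda>k. op_power N n (x k)) \<longlonglongrightarrow> l"
  shows "\<exists>\<sigma> a. strict_mono (\<sigma>::nat\<Rightarrow>nat) \<and> (x \<circ> \<sigma>) \<longlonglongrightarrow> a"
  using assms
proof (induction n arbitrary: x l)
  case 0
  then show ?case by (intro exI[of _ id] exI[of _ l]) (simp add: strict_mono_def)
next
  case (Suc n)
  let ?y = "\<lambda>k. op_power N n (x k)"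
  have "bounded (range ?y)"
    using bounded_linear_image[OF Suc.prems(1) blinfun.bounded_linear_right] by (simp add: image_image)
  then obtain \<sigma> m where \<sigma>: "strict_mono (\<sigma>::nat\<Rightarrow>nat)" and m: "(\<lambda>k. K (?y (\<sigma> k))) \<longlonglongrightarrow> m"
    by (rule seq_compact_opE[OF K])
  have "(\<lambda>k. N (?y (\<sigma> k))) \<longlonglongrightarrow> l"
    using LIMSEQ_subseq_LIMSEQ[OF Suc.prems(2) \<sigma>] by (simp add: o_def)
  from tendsto_add[OF this m] have "(\<lambda>k. op_power N n ((x \<circ> \<sigma>) k)) \<longlonglongrightarrow> l + m"
    by (simp add: N_apply)
  moreover have "bounded (range (x \<circ> \<sigma>))" using Suc.prems(1) by (rule bounded_subset) auto
  ultimately have "\<exists>\<tau> a. strict_mono (\<tau>::nat\<Rightarrow>nat) \<and> ((x \<circ> \<sigma>) \<circ> \<tau>) \<longlonglongrightarrow> a"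
    by (rule Suc.IH[rotated])
  then obtain \<tau> a where "strict_mono (\<tau>::nat\<Rightarrow>nat)" "((x \<circ> \<sigma>) \<circ> \<tau>) \<longlonglongrightarrow> a" by blast
  moreover have "strict_mono (\<sigma> \<circ> \<tau>)" using \<sigma> calculation(1) by (rule strict_mono_o)
  ultimately show ?case by (intro exI[of _ "\<sigma> \<circ> \<tau>"] exI[of _ a]) (simp only: comp_assoc)
qed

lemma subspace_power_kernel: "subspace {x. op_power N n x = 0}"
  by (auto intro!: subspaceI simp: blinfun.add_right blinfun.scaleR_right)

lemma closed_power_kernel: "closed {x. op_power N n x = 0}"
  by (intro closed_Collect_eq continuous_intros)

lemma subspace_power_range: "subspace (range (op_power N n))"
  by (metis subspace_UNIV linear_subspace_image blinfun.bounded_linear_right bounded_linear.linear)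

lemma closed_power_range: "closed (range (op_power N n))"
proof -
  define G where "G = {(x, op_power N n x) | x. True}"
  have "closed (Range G)"
  proof (rule closed_range_if_sequentially_proper)
    show "subspace G" unfolding G_def
      by (rule subspaceI)
        (auto simp: zero_prod_def blinfun.add_right blinfun.scaleR_right intro: exI[of _ 0])
    have "G = {p. snd p = op_power N n (fst p)}" by (auto simp: G_def)
    then show "closed G" by (auto intro!: closed_Collect_eq continuous_intros)
  next
    fix x y l assume "\<And>k::nat. (x k, y k) \<in> G" "bounded (range x)" "y \<longlonglongrightarrow> l"
    moreover have "y = (\<lambda>k. op_power N n (x k))" using calculation(1) by (simp add: G_def fun_eq_iff)
    ultimately show "\<exists>\<sigma> a. strict_mono (\<sigma>::nat\<Rightarrow>nat) \<and> (x \<circ> \<sigma>) \<longlonglongrightarrow> a"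
      using power_proper[of x n l] by simp
  qed
  moreover have "Range G = range (op_power N n)" by (auto simp: G_def)
  ultimately show ?thesis by simp
qed

text \<open>If all kernels were distinct, pick unit vectors \<open>u n\<close> in the kernel of
  \<open>N^(n+1)\<close> orthogonal to that of \<open>N^n\<close>. For \<open>i < j\<close> the
  difference \<open>K (u j) - K (u i)\<close> is \<open>u j\<close> minus a vector of the kernel of
  \<open>N^j\<close>, hence has norm at least 1.\<close>

lemma finite_ascent: "\<exists>n. \<forall>x. op_power N (Suc n) x = 0 \<longrightarrow> op_power N n x = 0"
proof (rule ccontr)
  let ?Z = "\<lambda>n. {x. op_power N n x = 0}"
  assume "\<not> ?thesis"
  then have ne: "?Z n \<noteq> ?Z (Suc n)" for n by blast
  have sub: "?Z n \<subseteq> ?Z (Suc n)" for n by auto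
  have mono: "op_power N j x = 0" if "op_power N i x = 0" "i \<le> j" for i j x
    using that by (metis op_power_add blinfun.zero_right le_add_diff_inverse2)
  have "\<exists>u. op_power N (Suc n) u = 0 \<and> norm u = 1 \<and> (\<forall>s. op_power N n s = 0 \<longrightarrow> inner u s = 0)" for n
    by (rule orthogonal_unit_vector[OF subspace_power_kernel closed_power_kernel subspace_power_kernel
          sub[of n] ne[of n]]) blast
  then have "\<forall>n. \<exists>u. op_power N (Suc n) u = 0 \<and> norm u = 1 \<and> (\<forall>s. op_power N n s = 0 \<longrightarrow> inner u s = 0)"
    by blast
  from choice[OF this] obtain u where "\<forall>n. op_power N (Suc n) (u n) = 0 \<and> norm (u n) = 1
      \<and> (\<forall>s. op_power N n s = 0 \<longrightarrow> inner (u n) s = 0)" by blast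
  then have u: "\<And>n. op_power N (Suc n) (u n) = 0" "\<And>n. norm (u n) = 1"
    and uo: "\<And>n s. op_power N n s = 0 \<Longrightarrow> inner (u n) s = 0" by blast+
  show False
  proof (rule seq_compact_op_not_separated[OF K u(2)])
    fix i j :: nat assume ij: "i < j"
    define w where "w = N (u j) + u i - N (u i)"
    have "op_power N j (N (u j)) = 0" using u(1)[of j] by (simp add: op_power_swap)
    moreover have ui: "op_power N j (u i) = 0" using mono[OF u(1)] ij by simp
    moreover have "op_power N j (N (u i)) = 0" using ui by (metis op_power_swap blinfun.zero_right)
    ultimately have "op_power N j w = 0" by (simp add: w_def blinfun.add_right blinfun.diff_right)
    then have "1 \<le> norm (u j - w)" using norm_diff_ge_if_orthogonal uo u by blast
    also have "u j - w = K (u j) - K (u i)" by (simp add: w_def N_apply)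
    finally show "1 \<le> norm (K (u j) - K (u i))" .
  qed
qed

text \<open>The same argument for the ranges. Because they decrease, it is now the vector with the
  smaller index that is orthogonal to the correction term.\<close>

lemma finite_descent: "\<exists>n. \<forall>x. \<exists>y. op_power N n x = op_power N (Suc n) y"
proof (rule ccontr)
  let ?R = "\<lambda>n. range (op_power N n)"
  assume "\<not> ?thesis"
  then have ne: "?R (Suc n) \<noteq> ?R n" for n by (metis rangeE rangeI)
  have sub: "?R (Suc n) \<subseteq> ?R n" for n by (auto simp: op_power_swap)
  have mono: "op_power N j x \<in> ?R i" if "i \<le> j" for i j x
    using that by (metis op_power_add le_add_diff_inverse rangeI)
  have "\<exists>u. u \<in> ?R n \<and> norm u = 1 \<and> (\<forall>s. s \<in> ?R (Suc n) \<longrightarrow> inner u s = 0)" for n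
    by (rule orthogonal_unit_vector[OF subspace_power_range closed_power_range subspace_power_range
          sub[of n] ne[of n]]) blast
  then have "\<forall>n. \<exists>u. u \<in> ?R n \<and> norm u = 1 \<and> (\<forall>s. s \<in> ?R (Suc n) \<longrightarrow> inner u s = 0)"
    by blast
  from choice[OF this] obtain u where "\<forall>n. u n \<in> ?R n \<and> norm (u n) = 1
      \<and> (\<forall>s. s \<in> ?R (Suc n) \<longrightarrow> inner (u n) s = 0)" by blast
  then have u: "\<And>n. u n \<in> ?R n" "\<And>n. norm (u n) = 1"
    and uo: "\<And>n s. s \<in> ?R (Suc n) \<Longrightarrow> inner (u n) s = 0" by blast+
  show False
  proof (rule seq_compact_op_not_separated[OF K u(2)])
    fix i j :: nat assume ij: "i < j"
    define w where "w = N (u i) + u j - N (u j)"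
    have N_in: "N x \<in> ?R (Suc n)" if "x \<in> ?R n" for x n using that by auto
    have "u j \<in> ?R (Suc i)" using u(1)[of j] mono[of "Suc i" j] ij by (metis Suc_leI rangeE)
    moreover have "N (u j) \<in> ?R (Suc i)" using sub N_in calculation by blast
    moreover have "N (u i) \<in> ?R (Suc i)" using N_in u(1) by blast
    ultimately have "w \<in> ?R (Suc i)"
      unfolding w_def by (intro subspace_diff subspace_add subspace_power_range)
    then have "1 \<le> norm (u i - w)" using norm_diff_ge_if_orthogonal uo u by blast
    also have "u i - w = - (K (u j) - K (u i))" by (simp add: w_def N_apply)
    finally show "1 \<le> norm (K (u j) - K (u i))" by (metis norm_minus_cancel)
  qed
qed

text \<open>The hypothesis says that kernel and range of \<open>N^n\<close> meet only in 0. Without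
  a lower bound, unit vectors of the closed range with images tending to 0 would accumulate at a
  unit vector in that intersection.\<close>

lemma power_bounded_below:
  assumes inj: "\<And>x. op_power N n (op_power N n x) = 0 \<Longrightarrow> op_power N n x = 0"
  shows "\<exists>\<delta>>0. \<forall>y\<in>range (op_power N n). \<delta> * norm y \<le> norm (op_power N n y)"
proof (rule ccontr)
  let ?Q = "op_power N n"
  assume "\<not> ?thesis"
  then have "\<exists>y\<in>range ?Q. norm (?Q y) < 1 / real (Suc k) * norm y" for k
    by (metis not_le zero_less_divide_1_iff of_nat_0_less_iff zero_less_Suc)
  then obtain y where y: "\<And>k. y k \<in> range ?Q" "\<And>k. norm (?Q (y k)) < 1 / real (Suc k) * norm (y k)"
    by metis
  have pos: "norm (y k) > 0" for k
    using y(2)[of k] norm_ge_zero[of "?Q (y k)"] by (cases "y k = 0") auto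
  define u where "u k = (1 / norm (y k)) *\<^sub>R y k" for k
  have nu: "norm (u k) = 1" for k using pos[of k] by (simp add: u_def)
  have uR: "u k \<in> range ?Q" for k unfolding u_def by (intro subspace_scale subspace_power_range y)
  have "(\<lambda>k. ?Q (u k)) \<longlonglongrightarrow> 0"
  proof (rule Lim_null_comparison)
    show "\<forall>\<^sub>F k in sequentially. norm (?Q (u k)) \<le> 1 / real (Suc k)"
    proof (intro always_eventually allI)
      fix k
      have "norm (?Q (u k)) = norm (?Q (y k)) / norm (y k)" by (simp add: u_def blinfun.scaleR_right)
      also have "\<dots> \<le> 1 / real (Suc k)"
        using y(2)[of k] pos[of k] by (simp only: pos_divide_le_eq less_imp_le)
      finally show "norm (?Q (u k)) \<le> 1 / real (Suc k)" .
    qed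
    show "(\<lambda>k. 1 / real (Suc k)) \<longlonglongrightarrow> 0" by (rule LIMSEQ_Suc[OF lim_1_over_n])
  qed
  moreover have "bounded (range u)" using nu by (auto simp: bounded_iff)
  ultimately obtain \<sigma> a where \<sigma>: "strict_mono (\<sigma>::nat\<Rightarrow>nat)" and a: "(u \<circ> \<sigma>) \<longlonglongrightarrow> a"
    using power_proper by blast
  have "a \<in> range ?Q" using closed_sequentially[OF closed_power_range _ a] uR by simp
  moreover have "(\<lambda>k. ?Q ((u \<circ> \<sigma>) k)) \<longlonglongrightarrow> ?Q a" by (intro tendsto_intros a)
  then have "?Q a = 0"
    using LIMSEQ_subseq_LIMSEQ[OF \<open>(\<lambda>k. ?Q (u k)) \<longlonglongrightarrow> 0\<close> \<sigma>] LIMSEQ_unique by (fastforce simp: o_def)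
  ultimately have "a = 0" using inj by auto
  moreover have "norm a = 1" using tendsto_norm[OF a] nu by (simp add: LIMSEQ_const_iff)
  ultimately show False by simp
qed

text \<open>The Drazin inverse of \<open>N\<close>: \<open>S\<close> inverts \<open>N ^ n\<close> on its range and vanishes on its kernel, so
  \<open>id - N ^ n S\<close> is the Riesz projection of \<open>N\<close> at \<open>0\<close>.\<close>

theorem drazin_inverse:
  obtains n S where "n > 0"
    "\<And>x. op_power N n (blinfun_apply S (op_power N n x)) = op_power N n x"
    "\<And>x. S (op_power N n (S x)) = S x"
    "\<And>B x. (\<And>x. blinfun_apply B (N x) = N (B x)) \<Longrightarrow> B (S x) = S (B x)"
proof -
  obtain a where a: "\<And>x. op_power N (Suc a) x = 0 \<Longrightarrow> op_power N a x = 0" using finite_ascent by blast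
  obtain d where d: "\<And>x. \<exists>y. op_power N d x = op_power N (Suc d) y" using finite_descent by blast
  \<comment> \<open>Large enough for both chains to be stationary, and positive because the power
    \<open>n - 1\<close> is needed when \<open>N\<close> is inverted on the range.\<close>
  define n where "n = Suc (a + d)"
  let ?Q = "op_power N n"
  have inj: "?Q x = 0" if "?Q (?Q x) = 0" for x
  proof -
    have "n + n - a + a = n + n" "n = Suc d + a" by (simp_all add: n_def)
    moreover have "op_power N (n + n) x = 0" using that by (simp only: op_power_add)
    ultimately have "op_power N a x = 0" using op_power_kernel_stable[OF a, of "n + n - a" x] by metis
    then show ?thesis unfolding \<open>n = Suc d + a\<close> op_power_add by (simp only: blinfun.zero_right)
  qed
  have surj: "\<exists>y. ?Q x = ?Q (?Q (?Q y))" for x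
  proof -
    obtain y where "op_power N d x = op_power N (n + n + d) y"
      using op_power_range_stable[OF d] by blast
    then have "op_power N (Suc a) (op_power N d x) = op_power N (Suc a) (op_power N (n + n + d) y)" by simp
    then have "op_power N (Suc a + d) x = op_power N (Suc a + (n + n + d)) y"
      unfolding op_power_add[symmetric] .
    then have "?Q x = op_power N (n + (n + n)) y" by (simp add: n_def algebra_simps)
    then show ?thesis by (auto simp only: op_power_add)
  qed
  obtain \<delta> where \<delta>: "\<delta> > 0" "\<And>y. y \<in> range ?Q \<Longrightarrow> \<delta> * norm y \<le> norm (?Q y)"
    using power_bounded_below[OF inj] by blast
  have low: "\<delta> * (\<delta> * norm y) \<le> norm (?Q (?Q y))" if "y \<in> range ?Q" for y
    using order_trans[OF mult_left_mono[OF \<delta>(2)[OF that], of \<delta>] \<delta>(2)[of "?Q y"]] \<delta>(1) by simp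
  have uniq: "s = t" if "s \<in> range ?Q" "t \<in> range ?Q" "?Q (?Q s) = ?Q (?Q t)" for s t
  proof -
    have "s - t \<in> range ?Q" by (intro subspace_diff subspace_power_range that)
    then have "\<delta> * (\<delta> * norm (s - t)) \<le> 0" using low[of "s - t"] that by (simp add: blinfun.diff_right)
    then show ?thesis using \<delta>(1) by (simp add: mult_le_0_iff)
  qed
  \<comment> \<open>For this \<open>s\<close>, the vector \<open>?Q (s x)\<close> is the component
    of \<open>x\<close> in the range of \<open>?Q\<close> along its kernel, and \<open>s x\<close>
    is the preimage in the range of that component.\<close>
  have "\<exists>s. s \<in> range ?Q \<and> ?Q (?Q s) = ?Q x" for x using surj[of x] by (metis rangeI)
  then obtain s where sR: "\<And>x. s x \<in> range ?Q" and s: "\<And>x. ?Q (?Q (s x)) = ?Q x" by metis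
  have "bounded_linear s"
  proof (rule bounded_linear_intro[where K = "norm ?Q / (\<delta> * \<delta>)"])
    show "s (x + y) = s x + s y" for x y
      by (rule uniq) (auto intro!: sR subspace_add[OF subspace_power_range] simp: s blinfun.add_right)
    show "s (c *\<^sub>R x) = c *\<^sub>R s x" for c x
      by (rule uniq) (auto intro!: sR subspace_scale[OF subspace_power_range] simp: s blinfun.scaleR_right)
    show "norm (s x) \<le> norm x * (norm ?Q / (\<delta> * \<delta>))" for x
    proof -
      have "\<delta> * (\<delta> * norm (s x)) \<le> norm ?Q * norm x"
        using low[OF sR[of x]] norm_blinfun[of ?Q x] by (simp add: s)
      then show ?thesis using \<delta>(1) by (simp add: field_simps)
    qed
  qed
  then have S: "blinfun_apply (Blinfun s) = s" by (rule bounded_linear_Blinfun_apply)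
  \<comment> \<open>Uniqueness makes \<open>s\<close> commute with everything that commutes with
    \<open>N\<close>. The locale is real; applied to multiplication by a complex scalar, this later
    yields complex linearity.\<close>
  have comm: "B (s x) = s (B x)" if B: "\<And>x. blinfun_apply B (N x) = N (B x)" for B x
  proof (rule uniq)
    have BQ: "B (?Q y) = ?Q (B y)" for y using B by (rule op_power_commute)
    obtain y where y: "s x = ?Q y" using sR by blast
    show "B (s x) \<in> range ?Q" by (simp add: y BQ)
    show "?Q (?Q (B (s x))) = ?Q (?Q (s (B x)))" by (simp add: BQ[symmetric] s)
  qed (rule sR)
  have Qs: "?Q (s x) = s (?Q x)" for x by (rule comm) (simp add: op_power_swap)
  show ?thesis
  proof (rule that[of n "Blinfun s"])
    show "?Q (Blinfun s (?Q x)) = ?Q x" for x by (simp add: S s flip: Qs)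
    show "Blinfun s (?Q (Blinfun s x)) = Blinfun s x" for x
      unfolding S by (rule uniq) (simp_all add: sR s)
  qed (use comm in \<open>simp_all add: S n_def\<close>)
qed

end

section \<open>Square roots of non-negative operators\<close>

text \<open>Positivity is required on the subspace \<open>S\<close> only, because \<open>J\<close>
  inherits the sign of \<open>V\<close> just on the closure of \<open>F\<close> applied to
  \<open>\<D>\<close>.\<close>

lemma semidefinite_cauchy_schwarz:
  fixes b :: "'a::real_vector \<Rightarrow> 'a \<Rightarrow> real"
  assumes add: "\<And>x y z. x \<in> S \<Longrightarrow> y \<in> S \<Longrightarrow> z \<in> S \<Longrightarrow> b (x + y) z = b x z + b y z"
    and scale: "\<And>c x y. x \<in> S \<Longrightarrow> y \<in> S \<Longrightarrow> b (c *\<^sub>R x) y = c * b x y"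
    and sym: "\<And>x y. x \<in> S \<Longrightarrow> y \<in> S \<Longrightarrow> b x y = b y x"
    and nonneg: "\<And>x. x \<in> S \<Longrightarrow> 0 \<le> b x x"
    and S: "subspace S" and x: "x \<in> S" and y: "y \<in> S"
  shows "(b x y)\<^sup>2 \<le> b x x * b y y"
proof -
  have quad: "0 \<le> b x x + 2 * t * b x y + t\<^sup>2 * b y y" for t
  proof -
    have ty: "t *\<^sub>R y \<in> S" and xt: "x + t *\<^sub>R y \<in> S"
      using S x y by (simp_all add: subspace_add subspace_scale)
    have "b (x + t *\<^sub>R y) (x + t *\<^sub>R y) = b x (x + t *\<^sub>R y) + t * b y (x + t *\<^sub>R y)"
      by (simp add: add[OF x ty xt] scale[OF y xt])
    also have "\<dots> = (b x x + t * b x y) + t * (b x y + t * b y y)"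
      by (simp add: sym[OF x xt] sym[OF y xt] add[OF x ty x] add[OF x ty y] scale x y sym[OF y x])
    finally show ?thesis using nonneg[OF xt] by (simp add: power2_eq_square algebra_simps)
  qed
  show ?thesis
  proof (cases "b y y = 0")
    case True
    have "b x y = 0"
    proof (rule ccontr)
      assume "b x y \<noteq> 0"
      \<comment> \<open>In the degenerate case the quadratic is affine in \<open>t\<close>; this
        \<open>t\<close> gives it the value -1.\<close>
      then show False using quad[of "- (b x x + 1) / (2 * b x y)"] True by (simp add: field_simps)
    qed
    then show ?thesis using True by simp
  next
    case False
    then have "b y y > 0" using nonneg[OF y] by simp
    then show ?thesis using quad[of "- b x y / b y y"]
      by (simp add: field_simps power2_eq_square)
  qed
qed

lemma selfadjoint_op_sym: "selfadjoint_op T \<Longrightarrow> inner (T x) y = inner x (T y)"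
  by (simp add: selfadjoint_op_def inner_eq_Re_cinner)

lemma nonneg_op_inner: "nonneg_op T \<Longrightarrow> 0 \<le> inner (T x) x"
  by (simp add: nonneg_op_def inner_eq_Re_cinner)

text \<open>Cauchy-Schwarz for the form \<open><T x, y>\<close> at \<open>y = T x\<close>. In
  particular a vanishing quadratic form at \<open>x\<close> forces \<open>T x = 0\<close>.\<close>

lemma nonneg_op_norm_sq_le:
  assumes "nonneg_op T" shows "(norm (T x))\<^sup>2 \<le> norm T * inner (T x) x"
proof (cases "T x = 0")
  case False
  have sa: "selfadjoint_op T" using assms by (simp add: nonneg_op_def)
  have "(inner (T x) (T x))\<^sup>2 \<le> inner (T x) x * inner (T (T x)) (T x)"
    by (rule semidefinite_cauchy_schwarz[where b = "\<lambda>x y. inner (T x) y" and S = UNIV])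
      (auto simp: blinfun.add_right inner_add_left blinfun.scaleR_right nonneg_op_inner[OF assms],
        metis selfadjoint_op_sym[OF sa] inner_commute)
  also have "\<dots> \<le> inner (T x) x * (norm T * (norm (T x))\<^sup>2)"
  proof (rule mult_left_mono[OF _ nonneg_op_inner[OF assms]])
    have "inner (T (T x)) (T x) \<le> norm (T (T x)) * norm (T x)" by (rule norm_cauchy_schwarz)
    also have "\<dots> \<le> (norm T * norm (T x)) * norm (T x)" by (intro mult_right_mono norm_blinfun) simp
    finally show "inner (T (T x)) (T x) \<le> norm T * (norm (T x))\<^sup>2" by (simp add: power2_eq_square)
  qed
  finally have "(norm (T x))\<^sup>2 * (norm (T x))\<^sup>2 \<le> (norm T * inner (T x) x) * (norm (T x))\<^sup>2"
    by (simp add: power2_norm_eq_inner[symmetric] power2_eq_square[of "(norm (T x))\<^sup>2"] algebra_simps)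
  moreover have "(norm (T x))\<^sup>2 > 0" using False by simp
  ultimately show ?thesis by (rule mult_right_le_imp_le)
qed (simp add: assms nonneg_op_inner)

text \<open>The limit plays the role of \<open>1 - sqrt(1 - X)\<close>; with
  \<open>X = 1 - T\<close> its complement to the identity is a square root of
  \<open>T\<close>.\<close>

primrec sqrt_iteration :: "('a::real_normed_vector \<Rightarrow>\<^sub>L 'a) \<Rightarrow> nat \<Rightarrow> 'a \<Rightarrow>\<^sub>L 'a"
  where "sqrt_iteration X 0 = 0"
  | "sqrt_iteration X (Suc n) = (1/2) *\<^sub>R (X + (sqrt_iteration X n o\<^sub>L sqrt_iteration X n))"

primrec sqrt_majorant :: "nat \<Rightarrow> real"
  where "sqrt_majorant 0 = 0"
  | "sqrt_majorant (Suc n) = (1 + (sqrt_majorant n)\<^sup>2) / 2"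

lemma sqrt_majorant_bounds: "0 \<le> sqrt_majorant n" "sqrt_majorant n \<le> 1"
  by (induction n) (auto simp: power_le_one)

lemma sqrt_majorant_mono: "sqrt_majorant n \<le> sqrt_majorant (Suc n)"
proof -
  have "0 \<le> (1 - sqrt_majorant n)\<^sup>2" by simp
  then show ?thesis by (simp add: power2_eq_square algebra_simps)
qed

lemma sqrt_iteration_commute:
  assumes "\<And>x. blinfun_apply B (blinfun_apply X x) = X (B x)"
  shows "blinfun_apply B (sqrt_iteration X n x) = sqrt_iteration X n (B x)"
  by (induction n arbitrary: x) (auto simp: assms blinfun.bilinear_simps)

text \<open>The iteration \<open>Y \<mapsto> (X + Y\<^sup>2) / 2\<close> is dominated by its scalar counterpart with \<open>X\<close> replaced
  by \<open>1\<close>, hence converges to a solution of \<open>(1 - Y)\<^sup>2 = 1 - X\<close>.\<close>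

lemma norm_sqrt_iteration:
  assumes X: "norm X \<le> 1" shows "norm (sqrt_iteration X n) \<le> sqrt_majorant n"
proof (induction n)
  case (Suc n)
  let ?Y = "sqrt_iteration X n"
  have "norm (X + (?Y o\<^sub>L ?Y)) \<le> norm X + norm (?Y o\<^sub>L ?Y)" by (rule norm_triangle_ineq)
  also have "\<dots> \<le> 1 + norm ?Y * norm ?Y" using X norm_blinfun_compose[of ?Y ?Y] by linarith
  also have "\<dots> \<le> 1 + (sqrt_majorant n)\<^sup>2"
    using Suc sqrt_majorant_bounds(1)[of n] by (auto simp: power2_eq_square intro!: mult_mono)
  finally show ?case by simp
qed simp

text \<open>The iterates commute, so the difference of squares factors as
  \<open>(Z - Y) (Z + Y)\<close>. The scalar majorant obeys the same recursion with
  equality.\<close>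

lemma norm_sqrt_iteration_step:
  assumes X: "norm X \<le> 1"
  shows "norm (sqrt_iteration X (Suc n) - sqrt_iteration X n) \<le> sqrt_majorant (Suc n) - sqrt_majorant n"
proof (induction n)
  case 0
  then show ?case using X by simp
next
  case (Suc n)
  let ?Y = "sqrt_iteration X n" and ?Z = "sqrt_iteration X (Suc n)"
  have "?Y (X x) = X (?Y x)" for x by (rule sqrt_iteration_commute[symmetric]) simp
  then have comm: "?Y (?Z x) = ?Z (?Y x)" for x by (rule sqrt_iteration_commute)
  have "sqrt_iteration X (Suc (Suc n)) - ?Z = (1/2) *\<^sub>R ((?Z - ?Y) o\<^sub>L (?Z + ?Y))"
    by (rule blinfun_eqI)
      (simp del: sqrt_iteration.simps(2) add: sqrt_iteration.simps(2)[of X "Suc n"] comm blinfun.bilinear_simps,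
       subst sqrt_iteration.simps(2), simp add: blinfun.bilinear_simps algebra_simps)
  then have "norm (sqrt_iteration X (Suc (Suc n)) - ?Z) = (1/2) * norm ((?Z - ?Y) o\<^sub>L (?Z + ?Y))" by simp
  also have "\<dots> \<le> (1/2) * (norm (?Z - ?Y) * norm (?Z + ?Y))"
    using norm_blinfun_compose[of "?Z - ?Y" "?Z + ?Y"] by simp
  also have "\<dots> \<le> (1/2) * ((sqrt_majorant (Suc n) - sqrt_majorant n) * (sqrt_majorant (Suc n) + sqrt_majorant n))"
    using Suc norm_sqrt_iteration[OF X, of n] norm_sqrt_iteration[OF X, of "Suc n"]
      norm_triangle_ineq[of ?Z ?Y] sqrt_majorant_mono[of n]
    by (intro mult_left_mono mult_mono) (linarith | simp)+
  also have "\<dots> = sqrt_majorant (Suc (Suc n)) - sqrt_majorant (Suc n)"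
  proof -
    have "sqrt_majorant (Suc (Suc n)) = (1 + (sqrt_majorant (Suc n))\<^sup>2) / 2"
      and "sqrt_majorant (Suc n) = (1 + (sqrt_majorant n)\<^sup>2) / 2" by (rule sqrt_majorant.simps(2))+
    then show ?thesis by (simp only:) (simp add: power2_eq_square field_simps)
  qed
  finally show ?case .
qed

lemma Cauchy_sqrt_iteration:
  assumes X: "norm X \<le> 1" shows "Cauchy (sqrt_iteration X)"
proof (rule metric_CauchyI)
  have step: "norm (sqrt_iteration X (n + k) - sqrt_iteration X n) \<le> sqrt_majorant (n + k) - sqrt_majorant n" for n k
  proof (induction k)
    case (Suc k)
    have "norm (sqrt_iteration X (n + Suc k) - sqrt_iteration X n)
        \<le> norm (sqrt_iteration X (Suc (n + k)) - sqrt_iteration X (n + k)) + norm (sqrt_iteration X (n + k) - sqrt_iteration X n)"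
      by (metis add_Suc_right norm_triangle_ineq diff_add_cancel add_diff_eq)
    then show ?case using Suc norm_sqrt_iteration_step[OF X, of "n + k"] by simp
  qed simp
  have "incseq sqrt_majorant" using sqrt_majorant_mono by (intro incseq_SucI)
  then obtain L where "sqrt_majorant \<longlonglongrightarrow> L"
    using incseq_convergent[of sqrt_majorant 1] sqrt_majorant_bounds by metis
  then have C: "Cauchy sqrt_majorant" by (rule LIMSEQ_imp_Cauchy)
  fix e :: real assume e: "0 < e"
  then obtain M where M: "\<And>m n. m \<ge> M \<Longrightarrow> n \<ge> M \<Longrightarrow> dist (sqrt_majorant m) (sqrt_majorant n) < e"
    using metric_CauchyD[OF C e] by blast
  have *: "dist (sqrt_iteration X m) (sqrt_iteration X n) < e" if "n \<ge> M" "m \<ge> n" for m n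
    using step[of n "m - n"] M[of m n] that by (simp add: dist_norm)
  show "\<exists>M. \<forall>m\<ge>M. \<forall>n\<ge>M. dist (sqrt_iteration X m) (sqrt_iteration X n) < e"
    using * by (metis dist_commute nle_le)
qed

lemma selfadjoint_sqrt_iteration:
  "selfadjoint_op X \<Longrightarrow> selfadjoint_op (sqrt_iteration X n)"
  by (induction n)
    (auto simp: selfadjoint_op_def clinear_op_intros blinfun.add_left blinfun.scaleR_left
      cinner_scaleR_left cinner_scaleR_right cinner_add_left cinner_add_right)

lemma selfadjoint_op_limit:
  assumes "(f \<longlongrightarrow> T) F" "F \<noteq> bot" "\<forall>\<^sub>F y in F. selfadjoint_op (f y)"
  shows "selfadjoint_op T"
  unfolding selfadjoint_op_def
proof (intro conjI allI)
  show "clinear_op T" by (rule clinear_op_limit[OF assms(1,2)]) (use assms(3) in \<open>auto simp: selfadjoint_op_def elim: eventually_mono\<close>)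
  fix x y
  have "((\<lambda>n. cinner (f n x) y) \<longlongrightarrow> cinner (T x) y) F"
    by (intro tendsto_cinner blinfun.tendsto assms tendsto_const)
  moreover have "((\<lambda>n. cinner x (f n y)) \<longlongrightarrow> cinner x (T y)) F"
    by (intro tendsto_cinner blinfun.tendsto assms tendsto_const)
  then have "((\<lambda>n. cinner (f n x) y) \<longlongrightarrow> cinner x (T y)) F"
    by (rule Lim_transform_eventually) (use assms(3) in eventually_elim, simp add: selfadjoint_op_def)
  ultimately show "cinner (T x) y = cinner x (T y)" using assms(2) tendsto_unique by blast
qed

lemma contractive_sqrt_exists:
  fixes T :: "'a::complex_hilbert \<Rightarrow>\<^sub>L 'a"
  assumes T: "nonneg_op T" and "norm T \<le> 1"
  shows "\<exists>U. nonneg_op U \<and> U o\<^sub>L U = T"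
proof -
  define X where "X = id_blinfun - T"
  have saT: "selfadjoint_op T" using T by (simp add: nonneg_op_def)
  have saX: "selfadjoint_op X"
    using saT by (auto simp: X_def selfadjoint_op_def clinear_op_intros blinfun.diff_left cinner_diff_left cinner_diff_right)
  \<comment> \<open>With \<open>norm T \<le> 1\<close> one has
    \<open>(norm (T x))\<^sup>2 \<le> inner (T x) x\<close>, which absorbs the last term in the
    expansion of \<open>(norm (x - T x))\<^sup>2\<close>.\<close>
  have nX: "norm X \<le> 1"
  proof (rule norm_blinfun_bound)
    fix x
    have "norm T * inner (T x) x \<le> 1 * inner (T x) x"
      using assms nonneg_op_inner[OF T] by (intro mult_right_mono) auto
    then have "(norm (T x))\<^sup>2 \<le> inner (T x) x" using nonneg_op_norm_sq_le[OF T, of x] by simp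
    moreover have "(norm (X x))\<^sup>2 = (norm x)\<^sup>2 - 2 * inner (T x) x + (norm (T x))\<^sup>2"
      by (simp add: X_def blinfun.diff_left power2_norm_eq_inner inner_diff_left inner_diff_right inner_commute)
    ultimately have "(norm (X x))\<^sup>2 \<le> (norm x)\<^sup>2" using nonneg_op_inner[OF T, of x] by linarith
    then show "norm (X x) \<le> 1 * norm x" using power2_le_imp_le[OF _ norm_ge_zero] by auto
  qed simp
  obtain Y where Y: "sqrt_iteration X \<longlonglongrightarrow> Y"
    using Cauchy_convergent[OF Cauchy_sqrt_iteration[OF nX]] unfolding convergent_def by blast
  have saY: "selfadjoint_op Y"
    by (rule selfadjoint_op_limit[OF Y]) (simp_all add: selfadjoint_sqrt_iteration saX)
  have "norm Y \<le> 1"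
    by (rule LIMSEQ_le_const2[OF tendsto_norm[OF Y]])
      (meson norm_sqrt_iteration[OF nX] sqrt_majorant_bounds order_trans)
  have YY: "Y = (1/2) *\<^sub>R (X + (Y o\<^sub>L Y))"
  proof (rule LIMSEQ_unique[OF LIMSEQ_Suc[OF Y]])
    show "(\<lambda>n. sqrt_iteration X (Suc n)) \<longlonglongrightarrow> (1/2) *\<^sub>R (X + (Y o\<^sub>L Y))"
      unfolding sqrt_iteration.simps
      by (intro tendsto_intros bounded_bilinear.tendsto[OF bounded_bilinear_blinfun_compose] Y)
  qed
  define U where "U = id_blinfun - Y"
  have "(U o\<^sub>L U) x = T x" for x
  proof -
    have "2 *\<^sub>R Y x = X x + Y (Y x)"
      using arg_cong[OF YY, of "\<lambda>Z. 2 *\<^sub>R blinfun_apply Z x"] by (simp add: blinfun.bilinear_simps)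
    then have "Y (Y x) = 2 *\<^sub>R Y x - (x - T x)" by (simp add: X_def blinfun.diff_left algebra_simps)
    then show ?thesis by (simp add: U_def blinfun.bilinear_simps scaleR_2)
  qed
  moreover have "nonneg_op U"
    unfolding nonneg_op_def
  proof (intro conjI allI)
    show "selfadjoint_op U"
      using saY by (auto simp: U_def selfadjoint_op_def clinear_op_intros blinfun.diff_left cinner_diff_left cinner_diff_right)
    fix x
    \<comment> \<open>Non-negativity of \<open>1 - Y\<close> comes from
      \<open>norm Y \<le> 1\<close>, itself inherited from the majorant.\<close>
    have "inner (Y x) x \<le> norm (Y x) * norm x" by (rule norm_cauchy_schwarz)
    also have "\<dots> \<le> (norm Y * norm x) * norm x" by (intro mult_right_mono norm_blinfun) simp
    also have "\<dots> \<le> (1 * norm x) * norm x" by (intro mult_right_mono \<open>norm Y \<le> 1\<close>) simp_all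
    finally have "0 \<le> inner (U x) x"
      by (simp add: U_def blinfun.diff_left inner_diff_left power2_norm_eq_inner[symmetric] power2_eq_square)
    then show "0 \<le> Re (cinner (U x) x)" by (simp add: inner_eq_Re_cinner)
  qed
  ultimately show ?thesis by (meson blinfun_eqI)
qed

lemma sqrt_op:
  assumes T: "nonneg_op T"
  shows "nonneg_op (sqrt_op T)" "sqrt_op T o\<^sub>L sqrt_op T = T"
proof -
  \<comment> \<open>Adding 1 keeps the scaling factor positive when \<open>T = 0\<close>.\<close>
  define m where "m = norm T + 1"
  have m: "m > 0" by (simp add: m_def add_nonneg_pos)
  have scale: "nonneg_op (c *\<^sub>R S)" if "0 \<le> c" "nonneg_op S" for c and S :: "'a \<Rightarrow>\<^sub>L 'a"
    using that by (auto simp: nonneg_op_def selfadjoint_op_def clinear_op_scaleR blinfun.scaleR_left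
        cinner_scaleR_left cinner_scaleR_right)
  have "norm ((1 / m) *\<^sub>R T) \<le> 1" using m by (simp add: m_def)
  then obtain U where U: "nonneg_op U" "U o\<^sub>L U = (1 / m) *\<^sub>R T"
    using contractive_sqrt_exists[OF scale[OF _ T, of "1 / m"]] m by auto
  have "(sqrt m *\<^sub>R U) o\<^sub>L (sqrt m *\<^sub>R U) = T"
  proof (rule blinfun_eqI)
    fix x
    have "U (U x) = (1 / m) *\<^sub>R T x" using U(2) by (metis blinfun_apply_blinfun_compose blinfun.scaleR_left)
    then show "((sqrt m *\<^sub>R U) o\<^sub>L (sqrt m *\<^sub>R U)) x = T x"
      using m by (simp add: blinfun.bilinear_simps)
  qed
  moreover have "nonneg_op (sqrt m *\<^sub>R U)" using m U by (intro scale) auto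
  ultimately have "nonneg_op (sqrt_op T) \<and> sqrt_op T o\<^sub>L sqrt_op T = T"
    unfolding sqrt_op_def by (intro someI[where P = "\<lambda>S. nonneg_op S \<and> S o\<^sub>L S = T"] conjI)
  then show "nonneg_op (sqrt_op T)" "sqrt_op T o\<^sub>L sqrt_op T = T" by auto
qed

text \<open>The quadratic form of \<open>T\<close> at \<open>x\<close> is the squared norm of
  \<open>sqrt_op T x\<close>.\<close>

lemma sqrt_op_kernel:
  assumes T: "nonneg_op T" and "inner (T x) x = 0"
  shows "sqrt_op T x = 0"
proof -
  let ?S = "sqrt_op T"
  have "inner (?S x) (?S x) = inner (?S (?S x)) x"
    using sqrt_op(1)[OF T] by (simp add: nonneg_op_def selfadjoint_op_sym inner_commute)
  also have "?S (?S x) = T x" using sqrt_op(2)[OF T] by (metis blinfun_apply_blinfun_compose)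
  finally show ?thesis using assms(2) by simp
qed

section \<open>Operator-valued holomorphic functions\<close>

definition has_op_derivative ::
    "(complex \<Rightarrow> 'a::complex_hilbert \<Rightarrow>\<^sub>L 'b::complex_hilbert) \<Rightarrow> ('a \<Rightarrow>\<^sub>L 'b) \<Rightarrow> complex \<Rightarrow> bool"
  where "has_op_derivative f D z \<longleftrightarrow> (f has_derivative (\<lambda>h. scaleC_op h D)) (at z)"

lemma op_holomorphic_on_iff: "op_holomorphic_on f S \<longleftrightarrow> (\<forall>z\<in>S. \<exists>D. has_op_derivative f D z)"
  by (simp add: op_holomorphic_on_def has_op_derivative_def)

lemma has_op_derivative_const: "has_op_derivative (\<lambda>z. T) 0 z"
  by (simp add: has_op_derivative_def bounded_bilinear.zero_right[OF bounded_bilinear_scaleC_op])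

lemma has_op_derivative_add:
  "has_op_derivative f D z \<Longrightarrow> has_op_derivative g D' z \<Longrightarrow> has_op_derivative (\<lambda>z. f z + g z) (D + D') z"
  unfolding has_op_derivative_def bounded_bilinear.add_right[OF bounded_bilinear_scaleC_op]
  by (rule has_derivative_add)

lemma has_op_derivative_diff:
  "has_op_derivative f D z \<Longrightarrow> has_op_derivative g D' z \<Longrightarrow> has_op_derivative (\<lambda>z. f z - g z) (D - D') z"
  unfolding has_op_derivative_def bounded_bilinear.diff_right[OF bounded_bilinear_scaleC_op]
  by (rule has_derivative_diff)

lemma has_op_derivative_scaleC:
  assumes "(c has_field_derivative c') (at z)" "has_op_derivative f D z"
  shows "has_op_derivative (\<lambda>z. scaleC_op (c z) (f z)) (scaleC_op c' (f z) + scaleC_op (c z) D) z"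
proof -
  have "((\<lambda>z. scaleC_op (c z) (f z)) has_derivative
      (\<lambda>h. scaleC_op (c z) (scaleC_op h D) + scaleC_op (c' * h) (f z))) (at z)"
    using assms unfolding has_op_derivative_def has_field_derivative_def
    by (rule bounded_bilinear.FDERIV[OF bounded_bilinear_scaleC_op])
  also have "(\<lambda>h. scaleC_op (c z) (scaleC_op h D) + scaleC_op (c' * h) (f z))
      = (\<lambda>h. scaleC_op h (scaleC_op c' (f z) + scaleC_op (c z) D))"
    by (intro ext blinfun_eqI)
      (simp add: scaleC_op_apply blinfun.add_left scaleC_add_right scaleC_scaleC mult.commute)
  finally show ?thesis by (simp add: has_op_derivative_def)
qed

lemma has_op_derivative_compose_left:
  assumes "clinear_op T" "has_op_derivative f D z"
  shows "has_op_derivative (\<lambda>z. T o\<^sub>L f z) (T o\<^sub>L D) z"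
proof -
  have "((\<lambda>z. T o\<^sub>L f z) has_derivative (\<lambda>h. T o\<^sub>L scaleC_op h D)) (at z)"
    using assms(2) unfolding has_op_derivative_def
    by (rule bounded_linear.has_derivative[OF bounded_bilinear.bounded_linear_right[OF bounded_bilinear_blinfun_compose]])
  moreover have "T o\<^sub>L scaleC_op h D = scaleC_op h (T o\<^sub>L D)" for h
    by (rule blinfun_eqI) (simp add: scaleC_op_apply clinear_op_apply[OF assms(1)])
  ultimately show ?thesis by (simp add: has_op_derivative_def)
qed

lemma has_op_derivative_compose_right:
  assumes "has_op_derivative f D z"
  shows "has_op_derivative (\<lambda>z. f z o\<^sub>L T) (D o\<^sub>L T) z"
proof -
  have "((\<lambda>z. f z o\<^sub>L T) has_derivative (\<lambda>h. scaleC_op h D o\<^sub>L T)) (at z)"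
    using assms unfolding has_op_derivative_def
    by (rule bounded_linear.has_derivative[OF bounded_bilinear.bounded_linear_left[OF bounded_bilinear_blinfun_compose]])
  moreover have "scaleC_op h D o\<^sub>L T = scaleC_op h (D o\<^sub>L T)" for h
    by (rule blinfun_eqI) (simp add: scaleC_op_apply)
  ultimately show ?thesis by (simp add: has_op_derivative_def)
qed

lemma has_op_derivative_cinner:
  assumes "has_op_derivative f D z"
  shows "((\<lambda>z. cinner (f z x) y) has_field_derivative cinner (D x) y) (at z)"
proof -
  have "bounded_linear (\<lambda>T::'a \<Rightarrow>\<^sub>L 'b. cinner (T x) y)"
    by (rule bounded_linear_compose[OF bounded_bilinear.bounded_linear_left[OF bounded_bilinear_cinner]
          blinfun.bounded_linear_left])
  from bounded_linear.has_derivative[OF this assms[unfolded has_op_derivative_def]]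
  have "((\<lambda>z. cinner (f z x) y) has_derivative (\<lambda>h. cinner (scaleC_op h D x) y)) (at z)" .
  moreover have "(\<lambda>h. cinner (scaleC_op h D x) y) = (*) (cinner (D x) y)"
    by (rule ext) (simp add: scaleC_op_apply cinner_scaleC_left)
  ultimately show ?thesis by (simp add: has_field_derivative_def)
qed

lemma op_holomorphic_on_const: "op_holomorphic_on (\<lambda>z. T) S"
  unfolding op_holomorphic_on_iff using has_op_derivative_const by blast

lemma op_holomorphic_on_add:
  "op_holomorphic_on f S \<Longrightarrow> op_holomorphic_on g S \<Longrightarrow> op_holomorphic_on (\<lambda>z. f z + g z) S"
  unfolding op_holomorphic_on_iff using has_op_derivative_add by blast

lemma op_holomorphic_on_diff:
  "op_holomorphic_on f S \<Longrightarrow> op_holomorphic_on g S \<Longrightarrow> op_holomorphic_on (\<lambda>z. f z - g z) S"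
  unfolding op_holomorphic_on_iff using has_op_derivative_diff by blast

lemma op_holomorphic_on_scaleC:
  "(\<And>z. z \<in> S \<Longrightarrow> c field_differentiable (at z)) \<Longrightarrow> op_holomorphic_on f S \<Longrightarrow>
    op_holomorphic_on (\<lambda>z. scaleC_op (c z) (f z)) S"
  unfolding op_holomorphic_on_iff field_differentiable_def using has_op_derivative_scaleC by blast

lemma op_holomorphic_on_compose_left:
  "clinear_op T \<Longrightarrow> op_holomorphic_on f S \<Longrightarrow> op_holomorphic_on (\<lambda>z. T o\<^sub>L f z) S"
  unfolding op_holomorphic_on_iff using has_op_derivative_compose_left by blast

lemma op_holomorphic_on_compose_right:
  "op_holomorphic_on f S \<Longrightarrow> op_holomorphic_on (\<lambda>z. f z o\<^sub>L T) S"
  unfolding op_holomorphic_on_iff using has_op_derivative_compose_right by blast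

lemma op_holomorphic_on_subset: "op_holomorphic_on f S \<Longrightarrow> T \<subseteq> S \<Longrightarrow> op_holomorphic_on f T"
  unfolding op_holomorphic_on_iff by blast

text \<open>Matrix elements are the gate through which scalar complex analysis enters: both the
  identity theorem and Cauchy's theorem are applied to them.\<close>

lemma op_holomorphic_on_cinner:
  assumes "op_holomorphic_on f S"
  shows "(\<lambda>z. cinner (f z x) y) holomorphic_on S"
  unfolding holomorphic_on_def
proof
  fix z assume "z \<in> S"
  then obtain D where "has_op_derivative f D z" using assms unfolding op_holomorphic_on_iff by blast
  from has_op_derivative_cinner[OF this, of x y]
  show "(\<lambda>z. cinner (f z x) y) field_differentiable (at z within S)"
    using field_differentiable_at_within field_differentiable_def by blast
qed

lemma op_holomorphic_on_imp_continuous_on: "op_holomorphic_on f S \<Longrightarrow> continuous_on S f"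
  unfolding op_holomorphic_on_def
  by (meson continuous_at_imp_continuous_on has_derivative_continuous)

text \<open>Neumann perturbation gives the inverses on a small disc. The resolvent identity
  \<open>W w - W z = (z - w) W w A W z\<close> then yields the derivative
  \<open>- W z A W z\<close>, with the remainder \<open>(z - w) (W w - W z) A W z\<close>.\<close>

lemma op_holomorphic_inverse_pencil:
  fixes X A :: "'a::complex_hilbert \<Rightarrow>\<^sub>L 'a"
  assumes R: "inverse_ops X R" and X: "clinear_op X" and A: "clinear_op A"
  obtains \<epsilon> W where "\<epsilon> > 0" "\<And>z. z \<in> ball p \<epsilon> \<Longrightarrow> inverse_ops (X + scaleC_op (z - p) A) (W z)"
    "op_holomorphic_on W (ball p \<epsilon>)"
proof -
  define \<epsilon> where "\<epsilon> = 1 / (norm R * norm A + 1)"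
  have pos: "norm R * norm A + 1 > 0" by (simp add: add_nonneg_pos)
  have "\<exists>R'. inverse_ops (X + scaleC_op (z - p) A) R'" if "z \<in> ball p \<epsilon>" for z
  proof (rule inverse_ops_perturb[OF R])
    have "norm (z - p) < \<epsilon>" using that by (simp add: dist_norm norm_minus_commute)
    then have "norm (z - p) * (norm R * norm A + 1) < 1" using pos by (simp add: \<epsilon>_def field_simps)
    moreover have "norm R * norm (scaleC_op (z - p) A) \<le> norm (z - p) * (norm R * norm A + 1)"
      by (simp add: norm_scaleC_op algebra_simps)
    ultimately show "norm R * norm (scaleC_op (z - p) A) < 1" by linarith
  qed
  then obtain W where W: "\<And>z. z \<in> ball p \<epsilon> \<Longrightarrow> inverse_ops (X + scaleC_op (z - p) A) (W z)" by metis
  have lin: "clinear_op (W z)" if "z \<in> ball p \<epsilon>" for z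
    by (rule inverse_ops_clinear[OF W[OF that]]) (intro clinear_op_intros X A)
  have res: "W w - W z = scaleC_op (z - w) (W w o\<^sub>L A o\<^sub>L W z)" if w: "w \<in> ball p \<epsilon>" and z: "z \<in> ball p \<epsilon>" for w z
  proof (rule blinfun_eqI)
    fix x
    have "W w x - W z x = W w ((X + scaleC_op (z - p) A) (W z x)) - W w ((X + scaleC_op (w - p) A) (W z x))"
      by (simp only: inverse_ops_apply[OF W[OF w]] inverse_ops_apply[OF W[OF z]])
    also have "\<dots> = W w ((z - w) *\<^sub>C A (W z x))"
      by (simp add: blinfun.add_left scaleC_op_apply flip: blinfun.diff_right scaleC_diff_left)
    finally show "(W w - W z) x = scaleC_op (z - w) (W w o\<^sub>L A o\<^sub>L W z) x"
      by (simp add: blinfun.diff_left scaleC_op_apply clinear_op_apply[OF lin[OF w]])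
  qed
  have "has_op_derivative W (- (W z o\<^sub>L A o\<^sub>L W z)) z" if z: "z \<in> ball p \<epsilon>" for z
    unfolding has_op_derivative_def has_derivative_at_alt
  proof (intro conjI allI impI)
    let ?a = "norm A * norm (W z)"
    define C where "C = 2 * norm (W z) * ?a * ?a"
    have C: "C \<ge> 0" by (simp add: C_def)
    show "bounded_linear (\<lambda>h. scaleC_op h (- (W z o\<^sub>L A o\<^sub>L W z)))"
      by (rule bounded_bilinear.bounded_linear_left[OF bounded_bilinear_scaleC_op])
    fix e :: real assume e: "0 < e"
    obtain d0 where d0: "d0 > 0" "ball z d0 \<subseteq> ball p \<epsilon>" using z open_contains_ball open_ball by metis
    have pos: "2 * (?a + 1) > 0" "C + 1 > 0" using C by (simp_all add: add_nonneg_pos)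
    \<comment> \<open>\<open>d0\<close> keeps \<open>w\<close> inside the disc; the second bound
      gives \<open>norm (W w) \<le> 2 * norm (W z)\<close>; the third turns the quadratic remainder
      \<open>C * (norm (w - z))\<^sup>2\<close> into \<open>e * norm (w - z)\<close>.\<close>
    define d where "d = min d0 (min (1 / (2 * (?a + 1))) (e / (C + 1)))"
    have d: "d > 0" using d0 e pos by (simp add: d_def)
    have "norm (W w - W z - scaleC_op (w - z) (- (W z o\<^sub>L A o\<^sub>L W z))) \<le> e * norm (w - z)"
      if w: "norm (w - z) < d" for w
    proof -
      have "w \<in> ball z d0" using w by (simp add: d_def dist_norm norm_minus_commute)
      then have wb: "w \<in> ball p \<epsilon>" using d0 by blast
      have "norm (w - z) < 1 / (2 * (?a + 1))" using w by (simp add: d_def)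
      then have "norm (w - z) * (2 * (?a + 1)) < 1" using pos(1) by (simp add: pos_less_divide_eq)
      moreover have "norm (w - z) * (2 * (?a + 1)) = 2 * (norm (w - z) * ?a) + 2 * norm (w - z)"
        by (simp add: algebra_simps)
      ultimately have half: "norm (w - z) * ?a \<le> 1/2" using norm_ge_zero[of "w - z"] by linarith
      have "norm (w - z) < e / (C + 1)" using w by (simp add: d_def)
      then have "norm (w - z) * (C + 1) < e" using pos(2) by (simp add: pos_less_divide_eq)
      moreover have "norm (w - z) * (C + 1) = C * norm (w - z) + norm (w - z)" by (simp add: algebra_simps)
      ultimately have Ce: "C * norm (w - z) \<le> e" using norm_ge_zero[of "w - z"] by linarith
      have comp: "norm (W u o\<^sub>L A o\<^sub>L W z) \<le> norm (W u) * ?a" for u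
        using norm_blinfun_compose[of "W u o\<^sub>L A" "W z"]
          mult_right_mono[OF norm_blinfun_compose[of "W u" A], of "norm (W z)"] by (simp add: mult.assoc)
      have nd: "norm (W w - W z) \<le> norm (w - z) * (norm (W w) * ?a)"
        unfolding res[OF wb z] norm_scaleC_op using comp[of w] by (simp add: norm_minus_commute mult_left_mono)
      have "norm (w - z) * ?a * norm (W w) \<le> 1/2 * norm (W w)" by (rule mult_right_mono[OF half]) simp
      then have "norm (W w - W z) \<le> 1/2 * norm (W w)" using nd by (simp add: mult_ac)
      then have bd: "norm (W w) \<le> 2 * norm (W z)" using norm_triangle_ineq2[of "W w" "W z"] by linarith
      have eq: "W w - W z - scaleC_op (w - z) (- (W z o\<^sub>L A o\<^sub>L W z))
          = scaleC_op (z - w) ((W w - W z) o\<^sub>L A o\<^sub>L W z)"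
        by (subst res[OF wb z], rule blinfun_eqI) (simp add: scaleC_op_apply blinfun.bilinear_simps scaleC_diff_left scaleC_diff_right scaleC_minus_right)
      have "norm ((W w - W z) o\<^sub>L A o\<^sub>L W z) \<le> norm (W w - W z) * ?a"
        using norm_blinfun_compose[of "(W w - W z) o\<^sub>L A" "W z"]
          mult_right_mono[OF norm_blinfun_compose[of "W w - W z" A], of "norm (W z)"] by (simp add: mult.assoc)
      also have "\<dots> \<le> (norm (w - z) * ((2 * norm (W z)) * ?a)) * ?a"
        by (intro mult_right_mono order_trans[OF nd] mult_left_mono bd) simp_all
      also have "\<dots> = C * norm (w - z)" by (simp add: C_def)
      also have "\<dots> \<le> e" by (rule Ce)
      finally show ?thesis unfolding eq norm_scaleC_op
        by (metis mult.commute mult_left_mono norm_ge_zero norm_minus_commute)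
    qed
    then show "\<exists>d>0. \<forall>w. norm (w - z) < d \<longrightarrow>
        norm (W w - W z - scaleC_op (w - z) (- (W z o\<^sub>L A o\<^sub>L W z))) \<le> e * norm (w - z)"
      using d by blast
  qed
  then have "op_holomorphic_on W (ball p \<epsilon>)" unfolding op_holomorphic_on_iff by blast
  then show ?thesis using that[of \<epsilon> W] W pos by (simp add: \<epsilon>_def)
qed

text \<open>The identity theorem: after multiplication by a common power of \<open>z - r\<close> the
  matrix elements of the difference are holomorphic and vanish at real points accumulating at
  \<open>r\<close>.\<close>

lemma op_meromorphic_eq_near:
  fixes f g :: "complex \<Rightarrow> 'a::complex_hilbert \<Rightarrow>\<^sub>L 'b::complex_hilbert"
  assumes "op_meromorphic f" "op_meromorphic g"
    and eq: "\<forall>\<^sub>F t in at (r::real). f (of_real t) = g (of_real t)"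
  obtains \<epsilon> where "\<epsilon> > 0" "\<And>z. z \<in> ball (of_real r) \<epsilon> - {of_real r} \<Longrightarrow> f z = g z"
proof -
  let ?p = "complex_of_real r"
  obtain m F U where U: "open U" "?p \<in> U" and F: "op_holomorphic_on F U"
    and fF: "\<And>z. z \<in> U - {?p} \<Longrightarrow> scaleC_op ((z - ?p) ^ m) (f z) = F z"
    using assms(1) unfolding op_meromorphic_def by meson
  obtain n G U' where U': "open U'" "?p \<in> U'" and G: "op_holomorphic_on G U'"
    and gG: "\<And>z. z \<in> U' - {?p} \<Longrightarrow> scaleC_op ((z - ?p) ^ n) (g z) = G z"
    using assms(2) unfolding op_meromorphic_def by meson
  obtain \<epsilon> where \<epsilon>: "\<epsilon> > 0" "ball ?p \<epsilon> \<subseteq> U \<inter> U'"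
    using open_Int[OF U(1) U'(1)] U U' open_contains_ball by (metis IntI)
  obtain \<delta> where \<delta>: "\<delta> > 0" "\<And>t. t \<noteq> r \<Longrightarrow> dist t r < \<delta> \<Longrightarrow> f (of_real t) = g (of_real t)"
    using eq unfolding eventually_at by auto
  define h where "h z = scaleC_op ((z - ?p) ^ n) (F z) - scaleC_op ((z - ?p) ^ m) (G z)" for z
  have h: "op_holomorphic_on h (ball ?p \<epsilon>)"
    unfolding h_def
    by (intro op_holomorphic_on_diff op_holomorphic_on_scaleC op_holomorphic_on_subset[OF F]
        op_holomorphic_on_subset[OF G]) (use \<epsilon> in \<open>auto intro!: derivative_intros\<close>)
  have hfg: "h z = scaleC_op ((z - ?p) ^ (m + n)) (f z - g z)" if "z \<in> ball ?p \<epsilon> - {?p}" for z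
  proof -
    have "scaleC_op ((z - ?p) ^ m) (f z) = F z" "scaleC_op ((z - ?p) ^ n) (g z) = G z"
      using fF gG that \<epsilon> by auto
    then show ?thesis
      unfolding h_def
      by (intro blinfun_eqI)
        (auto simp: scaleC_op_apply blinfun.diff_left scaleC_diff_right scaleC_scaleC power_add mult.commute
          dest!: arg_cong[of _ _ "\<lambda>T. T"] simp flip: \<open>_ = F z\<close> \<open>_ = G z\<close>)
  qed
  define T where "T = complex_of_real ` (ball r (min \<epsilon> \<delta>) - {r})"
  have zero: "cinner (h z x) y = 0" if "z \<in> ball ?p \<epsilon>" for z x y
  proof (rule analytic_continuation[of "\<lambda>z. cinner (h z x) y" "ball ?p \<epsilon>" T ?p])
    show "(\<lambda>z. cinner (h z x) y) holomorphic_on ball ?p \<epsilon>" using h by (rule op_holomorphic_on_cinner)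
    show "T \<subseteq> ball ?p \<epsilon>" by (auto simp: T_def dist_of_real)
    show "?p islimpt T" unfolding islimpt_approachable
    proof (intro allI impI)
      fix e :: real assume "0 < e"
      define t where "t = r + min e (min \<epsilon> \<delta>) / 2"
      have "t \<in> ball r (min \<epsilon> \<delta>) - {r}" using \<open>0 < e\<close> \<epsilon> \<delta> by (auto simp: t_def dist_norm)
      then have "complex_of_real t \<in> T" unfolding T_def by (rule imageI)
      moreover have "dist (complex_of_real t) ?p < e" "complex_of_real t \<noteq> ?p"
        using \<open>0 < e\<close> \<epsilon> \<delta> by (auto simp: t_def dist_of_real dist_norm)
      ultimately show "\<exists>x'\<in>T. x' \<noteq> ?p \<and> dist x' ?p < e" by blast
    qed
    show "cinner (h z x) y = 0" if "z \<in> T" for z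
    proof -
      obtain t where "t \<in> ball r (min \<epsilon> \<delta>) - {r}" "z = of_real t"
        using \<open>z \<in> T\<close> unfolding T_def by blast
      then have t: "z = of_real t" "t \<noteq> r" "dist t r < \<epsilon>" "dist t r < \<delta>" by (auto simp: dist_commute)
      then have "z \<in> ball ?p \<epsilon> - {?p}" by (auto simp: dist_of_real dist_commute)
      then show ?thesis using hfg \<delta>(2)[OF t(2,4)] t(1) by (simp add: scaleC_op_apply)
    qed
  qed (use that \<epsilon> in auto)
  show ?thesis
  proof (rule that[OF \<epsilon>(1)])
    fix z assume z: "z \<in> ball ?p \<epsilon> - {?p}"
    have "h z x = 0" for x by (rule cinner_extensional) (metis zero z DiffD1 cinner_commute cinner_zero_right)
    then have "(z - ?p) ^ (m + n) *\<^sub>C (f z x - g z x) = 0" for x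
      using hfg[OF z] by (simp add: scaleC_op_apply blinfun.diff_left)
    then have "norm ((z - ?p) ^ (m + n)) * norm (f z x - g z x) = 0" for x
      by (metis norm_scaleC norm_zero)
    then show "f z = g z" using z by (intro blinfun_eqI) auto
  qed
qed

text \<open>Composition with \<open>Q\<close> removes the singularity at the centre, so Cauchy's
  theorem applies to each matrix element, and the bounded functional passes under the integral. The
  radii are unrelated: \<open>W\<close> is consulted only near \<open>p\<close>, \<open>f\<close>
  itself on the rest of the disc.\<close>

lemma circle_integral_eq_0_if_removable:
  fixes f :: "complex \<Rightarrow> 'a::complex_hilbert \<Rightarrow>\<^sub>L 'b::complex_hilbert" and Q :: "'b \<Rightarrow>\<^sub>L 'c::complex_hilbert"
  assumes \<rho>: "\<rho> > 0" and f: "op_holomorphic_on f (cball p \<rho> - {p})" and Q: "clinear_op Q"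
    and \<epsilon>: "\<epsilon> > 0" and W: "op_holomorphic_on W (ball p \<epsilon>)"
    and eq: "\<And>z. z \<in> ball p \<epsilon> - {p} \<Longrightarrow> Q o\<^sub>L f z = W z"
  shows "Q o\<^sub>L op_circle_integral f p \<rho> = 0"
proof (rule blinfun_eqI)
  fix x
  define F where "F t = scaleC_op (\<i> * of_real \<rho> * cis t) (f (p + of_real \<rho> * cis t))" for t
  have circ: "p + of_real \<rho> * cis t \<in> cball p \<rho> - {p}" for t
    using \<rho> by (auto simp: dist_norm norm_mult)
  have "continuous_on {0..2*pi} (\<lambda>t. f (p + of_real \<rho> * cis t))"
    by (rule continuous_on_compose2[OF op_holomorphic_on_imp_continuous_on[OF f]])
      (use circ in \<open>auto intro!: continuous_intros\<close>)
  then have "continuous_on {0..2*pi} F" unfolding F_def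
    by (intro bounded_bilinear.continuous_on[OF bounded_bilinear_scaleC_op] continuous_intros)
  then have int: "F integrable_on {0..2*pi}" by (rule integrable_continuous_interval)
  have "cinner (Q (op_circle_integral f p \<rho> x)) y = 0" for y
  proof -
    \<comment> \<open>The value at the centre is taken from \<open>W\<close>, since
      \<open>f p\<close> is arbitrary.\<close>
    define \<phi> where "\<phi> z = (if z = p then cinner (W p x) y else cinner (Q (f z x)) y)" for z
    have "\<phi> field_differentiable (at z)" if z: "z \<in> cball p \<rho>" for z
    proof (cases "z = p")
      case True
      have "p \<in> ball p \<epsilon>" using \<epsilon> by simp
      then obtain D where "has_op_derivative W D p" using W unfolding op_holomorphic_on_iff by blast
      from has_op_derivative_cinner[OF this]
      have deriv: "((\<lambda>z. cinner (W z x) y) has_field_derivative cinner (D x) y) (at p)" .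
      have "\<phi> z = cinner (W z x) y" if "z \<in> ball p \<epsilon>" for z
        using that eq[of z] by (auto simp: \<phi>_def simp flip: blinfun_apply_blinfun_compose)
      then have "(\<phi> has_field_derivative cinner (D x) y) (at p)"
        using \<epsilon> by (intro has_field_derivative_transform_within_open[OF deriv open_ball[of p \<epsilon>]]) simp_all
      then show ?thesis using True by (auto simp: field_differentiable_def)
    next
      case False
      then have "z \<in> cball p \<rho> - {p}" using z by simp
      then obtain D where "has_op_derivative f D z" using f unfolding op_holomorphic_on_iff by blast
      from has_op_derivative_cinner[OF has_op_derivative_compose_left[OF Q this]]
      have "((\<lambda>z. cinner (Q (f z x)) y) has_field_derivative cinner (Q (D x)) y) (at z)" by simp
      then have "(\<phi> has_field_derivative cinner (Q (D x)) y) (at z)"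
        by (rule has_field_derivative_transform_within_open[of _ _ _ "- {p}"]) (use False in \<open>auto simp: \<phi>_def\<close>)
      then show ?thesis by (auto simp: field_differentiable_def)
    qed
    then have hol: "\<phi> holomorphic_on cball p \<rho>"
      by (auto simp: holomorphic_on_def intro: field_differentiable_at_within)
    have "(\<phi> has_contour_integral 0) (circlepath p \<rho>)"
      by (rule Cauchy_theorem_convex_simple[OF hol]) (use \<rho> in \<open>auto simp: dist_norm norm_minus_commute\<close>)
    then have "((\<lambda>t. \<phi> (p + of_real \<rho> * cis t) * of_real \<rho> * \<i> * cis t) has_integral 0) {0..2*pi}"
      unfolding circlepath_def by (subst (asm) has_contour_integral_part_circlepath_iff) auto
    moreover have "\<phi> (p + of_real \<rho> * cis t) * of_real \<rho> * \<i> * cis t = cinner (Q (F t x)) y" for t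
      using circ[of t] by (simp add: \<phi>_def F_def scaleC_op_apply clinear_op_apply[OF Q] cinner_scaleC_left mult_ac)
    ultimately have "((\<lambda>t. cinner (Q (F t x)) y) has_integral 0) {0..2*pi}" by simp
    moreover have "bounded_linear (\<lambda>T. cinner (Q (blinfun_apply T x)) y)"
      by (intro bounded_linear_compose[OF bounded_bilinear.bounded_linear_left[OF bounded_bilinear_cinner]]
          bounded_linear_compose[OF blinfun.bounded_linear_right] blinfun.bounded_linear_left)
    from has_integral_linear[OF integrable_integral[OF int] this]
    have "((\<lambda>t. cinner (Q (F t x)) y) has_integral cinner (Q (integral {0..2*pi} F x)) y) {0..2*pi}"
      by (simp add: o_def)
    ultimately have "cinner (Q (integral {0..2*pi} F x)) y = 0" by (rule has_integral_unique[symmetric])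
    moreover have "op_circle_integral f p \<rho> = integral {0..2*pi} F"
      by (simp add: op_circle_integral_def F_def[abs_def])
    ultimately show ?thesis by simp
  qed
  then have "Q (op_circle_integral f p \<rho> x) = 0"
    using cinner_self[of "Q (op_circle_integral f p \<rho> x)"] by simp
  then show "(Q o\<^sub>L op_circle_integral f p \<rho>) x = blinfun_apply 0 x" by simp
qed

section \<open>Inverses of compact pencils\<close>

text \<open>On the algebraic kernel of \<open>N\<close> the pencil \<open>M = N + v A\<close> with \<open>c A = N - 1\<close> is inverted up to
  the factor \<open>v\<^sup>n\<close>: iterating \<open>v = (c + v) N - c M\<close> gives \<open>v\<^sup>n = (c + v)\<^sup>n N\<^sup>n - M Z\<^sub>n\<close>, where no
  division by \<open>c\<close> occurs.\<close>

primrec nilpotent_part :: "complex \<Rightarrow> ('a::complex_hilbert \<Rightarrow>\<^sub>L 'a) \<Rightarrow> nat \<Rightarrow> complex \<Rightarrow> 'a \<Rightarrow>\<^sub>L 'a"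
  where "nilpotent_part c N 0 v = 0"
  | "nilpotent_part c N (Suc n) v
      = scaleC_op v (nilpotent_part c N n v) + scaleC_op (c * (c + v) ^ n) (op_power N n)"

lemma nilpotent_part_commute:
  assumes "clinear_op B" "\<And>x. blinfun_apply B (blinfun_apply N x) = N (B x)"
  shows "blinfun_apply B (nilpotent_part c N n v x) = nilpotent_part c N n v (B x)"
  by (induction n arbitrary: x)
    (simp_all add: blinfun.bilinear_simps scaleC_op_apply clinear_op_apply[OF assms(1)] op_power_commute assms(2))

lemma nilpotent_part_holomorphic: "op_holomorphic_on (\<lambda>z. nilpotent_part c N n (z - p)) S"
  by (induction n)
    (auto intro!: op_holomorphic_on_const op_holomorphic_on_add op_holomorphic_on_scaleC derivative_intros)

lemma nilpotent_part_eq: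
  assumes N: "clinear_op N" and A: "clinear_op A" and cA: "\<And>x. c *\<^sub>C A x = N x - x"
    and M: "M = N + scaleC_op v A"
  shows "M (nilpotent_part c N n v x) = (c + v) ^ n *\<^sub>C op_power N n x - v ^ n *\<^sub>C x"
proof -
  have cM: "c *\<^sub>C M y = (c + v) *\<^sub>C N y - v *\<^sub>C y" for y
  proof -
    have "c *\<^sub>C M y = c *\<^sub>C N y + v *\<^sub>C (c *\<^sub>C A y)"
      by (simp add: M blinfun.add_left scaleC_op_apply scaleC_add_right scaleC_scaleC mult.commute)
    then show ?thesis by (simp add: cA scaleC_diff_right scaleC_add_left)
  qed
  have "clinear_op M" unfolding M by (intro clinear_op_intros N A)
  note Mlin = clinear_op_apply[OF this]
  show ?thesis
  proof (induction n arbitrary: x)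
    case (Suc n)
    let ?w = "(c + v) ^ n"
    have "M (nilpotent_part c N (Suc n) v x)
        = v *\<^sub>C M (nilpotent_part c N n v x) + ?w *\<^sub>C (c *\<^sub>C M (op_power N n x))"
      by (simp add: blinfun.bilinear_simps scaleC_op_apply Mlin scaleC_scaleC mult.commute)
    also have "\<dots> = ?w *\<^sub>C ((c + v) *\<^sub>C N (op_power N n x)) - v *\<^sub>C v ^ n *\<^sub>C x"
      by (simp add: Suc cM scaleC_diff_right scaleC_scaleC mult.commute)
    finally show ?case by (simp add: scaleC_scaleC mult.commute)
  qed (simp add: blinfun.bilinear_simps)
qed

locale compact_pencil =
  fixes A :: "'a::complex_hilbert \<Rightarrow>\<^sub>L 'a" and s :: complex
  assumes A: "seq_compact_op A" and A_clinear: "clinear_op A"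
begin

definition M :: "complex \<Rightarrow> 'a \<Rightarrow>\<^sub>L 'a"
  where "M z = id_blinfun + scaleC_op (z - s) A"

lemma M_clinear: "clinear_op (M z)"
  unfolding M_def by (intro clinear_op_intros A_clinear)

lemma M_apply: "M z x = x + (z - s) *\<^sub>C A x"
  by (simp add: M_def blinfun.add_left scaleC_op_apply)

lemma compact_perturbation_M: "compact_perturbation (scaleC_op (s - z) A) (M z)"
proof
  show "seq_compact_op (scaleC_op (s - z) A)"
    by (intro seq_compact_op_scaleC A)
  show "M z = id_blinfun - scaleC_op (s - z) A"
    by (rule blinfun_eqI) (simp add: M_apply blinfun.diff_left scaleC_op_apply scaleC_diff_left)
qed

text \<open>Here \<open>E\<close> is the Riesz projection of \<open>M p\<close> at the eigenvalue \<open>0\<close>, and \<open>W\<close> and \<open>Y\<close> are the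
  regular and the polar part of the inverse.\<close>

lemma local_inverse:
  obtains \<epsilon> :: real and n :: nat and E :: "'a \<Rightarrow>\<^sub>L 'a" and W R where "\<epsilon> > 0" "clinear_op E" "\<And>x. op_power (M p) n (E x) = 0"
    "op_holomorphic_on W (ball p \<epsilon>)"
    "\<And>z. z \<in> ball p \<epsilon> - {p} \<Longrightarrow> inverse_ops (M z) (R z)"
    "\<And>z. z \<in> ball p \<epsilon> - {p} \<Longrightarrow> \<exists>Y. R z = W z + (E o\<^sub>L Y)"
    "\<exists>G. op_holomorphic_on G (ball p \<epsilon>) \<and> (\<forall>z\<in>ball p \<epsilon> - {p}. scaleC_op ((z - p) ^ n) (R z) = G z)"
proof -
  define N where "N = M p"
  define c where "c = p - s"
  interpret cp: compact_perturbation "scaleC_op (s - p) A" N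
    unfolding N_def by (rule compact_perturbation_M)
  obtain n S where n: "n > 0" and QSQ: "\<And>x. op_power N n (blinfun_apply S (op_power N n x)) = op_power N n x"
    and SQS: "\<And>x. S (op_power N n (S x)) = S x"
    and S_comm0: "\<And>B x. (\<And>x. blinfun_apply B (N x) = N (B x)) \<Longrightarrow> B (S x) = S (B x)"
    by (rule cp.drazin_inverse) (rule that; blast)
  define Q where "Q = op_power N n"
  define P where "P = Q o\<^sub>L S"
  define E where "E = id_blinfun - P"
  \<comment> \<open>\<open>X\<close> coincides with \<open>N\<close> on the range of
    \<open>P\<close> and with the identity on the algebraic kernel, the range of \<open>E\<close>.
    Replacing \<open>N\<close> by 1 there makes \<open>X\<close> invertible.\<close>
  define X where "X = (N o\<^sub>L P) + E"
  \<comment> \<open>On the range of \<open>P\<close> the operator \<open>S\<close> inverts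
    \<open>N^n\<close>, so \<open>N^(n-1) S\<close> inverts \<open>N\<close>.\<close>
  define X' where "X' = (op_power N (n - 1) o\<^sub>L S) + E"
  have N_lin: "clinear_op N" unfolding N_def by (rule M_clinear)
  have N_apply: "N x = x + c *\<^sub>C A x" for x by (simp add: N_def M_apply c_def)
  have NA: "B (N x) = N (B x)" if "clinear_op B" "\<And>x. blinfun_apply B (A x) = A (B x)" for B x
    using clinear_op_apply[OF that(1)] that(2) by (simp add: N_apply blinfun.add_right)
  have Q_comm: "B (Q x) = Q (B x)" if "\<And>x. blinfun_apply B (N x) = N (B x)" for B x
    unfolding Q_def using that by (rule op_power_commute)
  have P_apply: "P x = Q (S x)" for x by (simp add: P_def)
  have E_apply: "E x = x - P x" for x by (simp add: E_def blinfun.diff_left)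
  have P_comm: "B (P x) = P (B x)" if "\<And>x. blinfun_apply B (N x) = N (B x)" for B x
    unfolding P_apply by (simp only: Q_comm[OF that] S_comm0[OF that])
  have E_comm: "B (E x) = E (B x)" if "\<And>x. blinfun_apply B (N x) = N (B x)" for B x
    by (simp only: E_apply blinfun.diff_right P_comm[OF that])
  have X_comm: "B (X x) = X (B x)" if "\<And>x. blinfun_apply B (N x) = N (B x)" for B x
    by (simp add: X_def blinfun.add_left blinfun.add_right P_comm[OF that] E_comm[OF that] that)
  have SN: "S (N x) = N (S x)" for x using S_comm0[of N x] by simp
  have SQ: "S (Q x) = Q (S x)" for x by (rule Q_comm) (rule SN)
  have PN: "P (N x) = N (P x)" for x using P_comm[of N x] by simp
  have EN: "E (N x) = N (E x)" for x using E_comm[of N x] by simp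
  have QP: "Q (P x) = Q x" for x using QSQ by (simp add: P_apply Q_def SQ[unfolded Q_def, symmetric])
  have SP: "S (P x) = S x" for x using SQS by (simp add: P_apply Q_def)
  have PP: "P (P x) = P x" for x unfolding P_apply[of "P x"] SP by (simp add: P_apply)
  have QE: "Q (E x) = 0" for x by (simp add: E_apply blinfun.diff_right QP)
  have PE: "P (E x) = 0" for x by (simp add: E_apply blinfun.diff_right PP)
  have EP: "E (P x) = 0" for x by (simp add: E_apply PP)
  have EE: "E (E x) = E x" for x by (subst E_apply) (simp add: PE)
  have S_lin: "clinear_op S"
    unfolding clinear_op_def
  proof (intro allI)
    fix a x
    \<comment> \<open>Multiplication by \<open>a\<close> commutes with \<open>N\<close>, hence with
      \<open>S\<close>; this recovers complex linearity from the real construction.\<close>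
    have "(scaleC_op a id_blinfun) (S x) = S ((scaleC_op a id_blinfun) x)"
      by (rule S_comm0) (simp add: scaleC_op_apply clinear_op_apply[OF N_lin])
    then show "S (a *\<^sub>C x) = a *\<^sub>C S x" by (simp add: scaleC_op_apply)
  qed
  have Q_lin: "clinear_op Q" unfolding Q_def by (rule op_power_clinear[OF N_lin])
  have P_lin: "clinear_op P" unfolding P_def by (intro clinear_op_intros Q_lin S_lin)
  have E_lin: "clinear_op E" unfolding E_def by (intro clinear_op_intros P_lin)
  have X_lin: "clinear_op X" unfolding X_def by (intro clinear_op_intros N_lin P_lin E_lin)
  have NQ: "N (op_power N (n - 1) x) = Q x" for x
  proof -
    have "op_power N (Suc (n - 1)) x = Q x" using n by (simp only: Suc_diff_1 Q_def)
    then show ?thesis by (simp only: op_power.simps blinfun_apply_blinfun_compose)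
  qed
  define Q' where "Q' = op_power N (n - 1)"
  have Q'_comm: "B (Q' x) = Q' (B x)" if "\<And>x. blinfun_apply B (N x) = N (B x)" for B x
    unfolding Q'_def using that by (rule op_power_commute)
  have PQ': "P (Q' x) = Q' (P x)" for x by (rule Q'_comm) (rule PN)
  have EQ': "E (Q' x) = Q' (E x)" for x by (rule Q'_comm) (rule EN)
  have NQ': "N (Q' x) = Q x" for x unfolding Q'_def by (rule NQ)
  have SE: "S (E x) = 0" for x by (simp add: E_apply blinfun.diff_right SP)
  have PS: "P (S x) = S (P x)" for x using S_comm0[of P x] PN by simp
  have ES: "E (S x) = 0" for x by (simp add: E_apply PS SP)
  have X_apply: "X x = N (P x) + E x" for x by (simp add: X_def blinfun.add_left)
  have X'_apply: "X' x = Q' (S x) + E x" for x by (simp add: X'_def blinfun.add_left Q'_def)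
  have Q'N: "Q' (N x) = Q x" for x using Q'_comm[of N x] by (simp add: NQ')
  have XX': "X (X' x) = x" for x
    by (simp add: X_apply X'_apply blinfun.add_right PE EE PQ' PS SP NQ' EQ' ES)
      (simp add: E_apply P_apply)
  have X'X: "X' (X x) = x" for x
    by (simp add: X_apply X'_apply blinfun.add_right SE EE SN Q'N SP EN EP)
      (simp add: E_apply P_apply)
  have inv: "inverse_ops X X'" by (rule inverse_opsI) (rule X'X XX')+
  obtain \<epsilon> W where \<epsilon>: "\<epsilon> > 0" and W: "\<And>z. z \<in> ball p \<epsilon> \<Longrightarrow> inverse_ops (X + scaleC_op (z - p) A) (W z)"
    and W_hol: "op_holomorphic_on W (ball p \<epsilon>)"
    by (rule op_holomorphic_inverse_pencil[OF inv X_lin A_clinear, where p = p]) blast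
  define Z where "Z z = nilpotent_part c N n (z - p)" for z
  \<comment> \<open>The second term comes from \<open>M Z = (c + v)^n Q - v^n\<close> with
    \<open>v = z - p\<close>: since \<open>E Q = 0\<close>, dividing by \<open>- v^n\<close> inverts
    \<open>M z\<close> on the range of \<open>E\<close>.\<close>
  define R where "R z = (P o\<^sub>L W z) - scaleC_op (1 / (z - p) ^ n) (E o\<^sub>L Z z)" for z
  have R_apply: "R z x = P (W z x) - (1 / (z - p) ^ n) *\<^sub>C E (Z z x)" for z x
    by (simp add: R_def blinfun.diff_left scaleC_op_apply)
  have Mz: "M z = N + scaleC_op (z - p) A" for z
    by (rule blinfun_eqI) (simp add: N_apply M_apply blinfun.add_left scaleC_op_apply c_def flip: scaleC_add_left add.assoc)
  have Mz_apply: "M z x = N x + (z - p) *\<^sub>C A x" for z x by (simp add: Mz blinfun.add_left scaleC_op_apply)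
  have AN: "A (N x) = N (A x)" for x by (rule NA) (simp_all add: A_clinear)
  have MN: "M z (N x) = N (M z x)" for z x
    by (simp add: Mz_apply blinfun.add_right clinear_op_apply[OF N_lin] AN)
  have MW: "M z (W z x) = W z (M z x)" if "z \<in> ball p \<epsilon>" for z x
  proof (rule inverse_ops_commute[OF W[OF that]])
    fix x
    have "A (M z x) = M z (A x)"
      by (simp add: Mz_apply blinfun.add_right AN clinear_op_apply[OF A_clinear])
    then show "M z ((X + scaleC_op (z - p) A) x) = (X + scaleC_op (z - p) A) (M z x)"
      using X_comm[of "M z" x] MN
      by (simp add: blinfun.add_left blinfun.add_right scaleC_op_apply clinear_op_apply[OF M_clinear])
  qed
  have MZ: "M z (Z z x) = Z z (M z x)" for z x
    unfolding Z_def by (rule nilpotent_part_commute[OF M_clinear MN])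
  have MP: "M z (P x) = P (M z x)" and ME: "M z (E x) = E (M z x)" for z x
    using MN P_comm E_comm by blast+
  have MR: "M z (R z x) = x" if z: "z \<in> ball p \<epsilon> - {p}" for z x
  proof -
    have zb: "z \<in> ball p \<epsilon>" using z by simp
    \<comment> \<open>The summand \<open>E\<close> by which \<open>X\<close> differs from
      \<open>N P\<close> is killed by \<open>P\<close>, so \<open>W z\<close> serves as the inverse
      of \<open>M z\<close> on the range of \<open>P\<close>.\<close>
    have "P (M z y) = P ((X + scaleC_op (z - p) A) y)" for y
      by (simp add: Mz_apply blinfun.add_left blinfun.add_right scaleC_op_apply X_apply PN PE PP)
    then have 1: "M z (P (W z x)) = P x" by (simp add: MP inverse_ops_apply(2)[OF W[OF zb]])
    have "M z (Z z x) = (c + (z - p)) ^ n *\<^sub>C Q x - (z - p) ^ n *\<^sub>C x"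
      unfolding Z_def Q_def by (rule nilpotent_part_eq[OF N_lin A_clinear _ Mz]) (simp add: N_apply)
    moreover have "E (Q x) = 0" using Q_comm[of E x] EN QE by simp
    ultimately have "M z (E (Z z x)) = - ((z - p) ^ n *\<^sub>C E x)"
      by (simp add: ME blinfun.diff_right clinear_op_apply[OF E_lin])
    then have "(1 / (z - p) ^ n) *\<^sub>C M z (E (Z z x)) = - E x"
      using z by (simp add: scaleC_minus_right scaleC_scaleC)
    then show ?thesis
      using 1 by (simp add: R_apply blinfun.diff_right clinear_op_apply[OF M_clinear]) (simp add: E_apply)
  qed
  have RM: "R z (M z x) = x" if z: "z \<in> ball p \<epsilon> - {p}" for z x
  proof -
    have "R z (M z x) = M z (R z x)"
      using z by (simp add: R_apply blinfun.diff_right clinear_op_apply[OF M_clinear] MP ME MZ MW)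
    then show ?thesis using MR[OF z] by simp
  qed
  show ?thesis
  proof (rule that[of \<epsilon> E n "\<lambda>z. P o\<^sub>L W z" R])
    show "op_power (M p) n (E x) = 0" for x using QE by (simp add: Q_def N_def)
    show "op_holomorphic_on (\<lambda>z. P o\<^sub>L W z) (ball p \<epsilon>)" by (rule op_holomorphic_on_compose_left[OF P_lin W_hol])
    show "inverse_ops (M z) (R z)" if "z \<in> ball p \<epsilon> - {p}" for z
      using RM[OF that] MR[OF that] by (rule inverse_opsI)
    show "\<exists>Y. R z = (P o\<^sub>L W z) + (E o\<^sub>L Y)" for z
      by (rule exI[of _ "scaleC_op (- (1 / (z - p) ^ n)) (Z z)"], rule blinfun_eqI)
        (simp add: R_apply blinfun.add_left scaleC_op_apply clinear_op_apply[OF E_lin] scaleC_minus_left blinfun.minus_right)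
    have "op_holomorphic_on (\<lambda>z. scaleC_op ((z - p) ^ n) (P o\<^sub>L W z) - (E o\<^sub>L Z z)) (ball p \<epsilon>)"
      unfolding Z_def
      by (intro op_holomorphic_on_diff op_holomorphic_on_scaleC op_holomorphic_on_compose_left P_lin E_lin
          W_hol nilpotent_part_holomorphic) (auto intro!: derivative_intros)
    moreover have "scaleC_op ((z - p) ^ n) (R z) = scaleC_op ((z - p) ^ n) (P o\<^sub>L W z) - (E o\<^sub>L Z z)"
      if "z \<in> ball p \<epsilon> - {p}" for z
      using that by (intro blinfun_eqI) (simp add: R_apply scaleC_op_apply blinfun.diff_left scaleC_diff_right scaleC_scaleC)
    ultimately show "\<exists>G. op_holomorphic_on G (ball p \<epsilon>) \<and>
        (\<forall>z\<in>ball p \<epsilon> - {p}. scaleC_op ((z - p) ^ n) (R z) = G z)" by blast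
  qed (use \<epsilon> E_lin in auto)
qed

text \<open>The candidate for the meromorphic continuation, \<open>(1 + (z - s) A)^-1 A\<close>.
  Where \<open>M z\<close> is not invertible its value is arbitrary, which is harmless because
  meromorphy ignores isolated points.\<close>

definition extension :: "complex \<Rightarrow> 'a \<Rightarrow>\<^sub>L 'a"
  where "extension z = (SOME R. inverse_ops (M z) R) o\<^sub>L A"

lemma extension_eq: "inverse_ops (M z) R \<Longrightarrow> extension z = R o\<^sub>L A"
  unfolding extension_def by (metis inverse_ops_unique someI)

lemma op_meromorphic_extension: "op_meromorphic extension"
  unfolding op_meromorphic_def
proof
  fix p
  obtain \<epsilon> n E W R where \<epsilon>: "\<epsilon> > 0" and R: "\<And>z. z \<in> ball p \<epsilon> - {p} \<Longrightarrow> inverse_ops (M z) (R z)"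
    and "\<exists>G. op_holomorphic_on G (ball p \<epsilon>) \<and> (\<forall>z\<in>ball p \<epsilon> - {p}. scaleC_op ((z - p) ^ n) (R z) = G z)"
    by (rule local_inverse[of p]) blast
  then obtain G where G: "op_holomorphic_on G (ball p \<epsilon>)"
    and RG: "\<And>z. z \<in> ball p \<epsilon> - {p} \<Longrightarrow> scaleC_op ((z - p) ^ n) (R z) = G z" by blast
  show "\<exists>n g U. open U \<and> p \<in> U \<and> op_holomorphic_on g U \<and>
      (\<forall>z\<in>U - {p}. scaleC_op ((z - p) ^ n) (extension z) = g z)"
  proof (intro exI conjI ballI)
    show "op_holomorphic_on (\<lambda>z. G z o\<^sub>L A) (ball p \<epsilon>)" by (rule op_holomorphic_on_compose_right[OF G])
    show "scaleC_op ((z - p) ^ n) (extension z) = G z o\<^sub>L A" if "z \<in> ball p \<epsilon> - {p}" for z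
      unfolding extension_eq[OF R[OF that]] RG[OF that, symmetric]
      by (rule blinfun_eqI) (simp add: scaleC_op_apply)
  qed (use \<epsilon> in auto)
qed

lemma invertible_near: "\<forall>\<^sub>F z in at p. \<exists>R. inverse_ops (M z) R"
proof -
  obtain \<epsilon> n E W R where "\<epsilon> > 0" "\<And>z. z \<in> ball p \<epsilon> - {p} \<Longrightarrow> inverse_ops (M z) (R z)"
    by (rule local_inverse[of p]) blast
  then show ?thesis unfolding eventually_at by (metis DiffI dist_commute mem_ball singletonD)
qed

text \<open>Near \<open>r\<close> the inverse is \<open>W z + E Y\<close> with \<open>E\<close>
  mapping into the algebraic kernel, so only the holomorphic \<open>Q W A\<close> survives.
  \<open>f\<close> is any meromorphic function with the right values at nearby real points, since
  the extension chosen by \<open>A_plus\<close> is known no better.\<close>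

lemma compose_circle_integral_eq_0:
  assumes mero: "op_meromorphic f" and eq: "\<forall>\<^sub>F t in at r. f (of_real t) = extension (of_real t)"
    and \<rho>: "\<rho> > 0" and f: "op_holomorphic_on f (cball (of_real r) \<rho> - {of_real r})"
    and Q: "clinear_op Q" and ker: "\<And>n x. op_power (M (of_real r)) n x = 0 \<Longrightarrow> Q x = 0"
  shows "Q o\<^sub>L op_circle_integral f (of_real r) \<rho> = 0"
proof -
  let ?p = "complex_of_real r"
  obtain \<delta> where \<delta>: "\<delta> > 0" "\<And>z. z \<in> ball ?p \<delta> - {?p} \<Longrightarrow> f z = extension z"
    using op_meromorphic_eq_near[OF mero op_meromorphic_extension eq] by blast
  show ?thesis
  proof (rule local_inverse[of ?p])
    fix \<epsilon> :: real and n E and W R :: "complex \<Rightarrow> 'a \<Rightarrow>\<^sub>L 'a"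
    assume \<epsilon>: "\<epsilon> > 0" and E: "\<And>x. op_power (M ?p) n (blinfun_apply E x) = 0"
      and W: "op_holomorphic_on W (ball ?p \<epsilon>)"
      and R: "\<And>z. z \<in> ball ?p \<epsilon> - {?p} \<Longrightarrow> inverse_ops (M z) (R z)"
      and RW: "\<And>z. z \<in> ball ?p \<epsilon> - {?p} \<Longrightarrow> \<exists>Y. R z = W z + (E o\<^sub>L Y)"
  show ?thesis
  proof (rule circle_integral_eq_0_if_removable[OF \<rho> f Q])
    show "0 < min \<epsilon> \<delta>" using \<epsilon> \<delta> by simp
    have "op_holomorphic_on W (ball ?p (min \<epsilon> \<delta>))" by (rule op_holomorphic_on_subset[OF W]) auto
    then show "op_holomorphic_on (\<lambda>z. (Q o\<^sub>L W z) o\<^sub>L A) (ball ?p (min \<epsilon> \<delta>))"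
      by (intro op_holomorphic_on_compose_right op_holomorphic_on_compose_left Q)
    fix z assume z: "z \<in> ball ?p (min \<epsilon> \<delta>) - {?p}"
    then obtain Y where Y: "R z = W z + (E o\<^sub>L Y)" using RW[of z] by auto
    have "f z = R z o\<^sub>L A" using \<delta>(2)[of z] extension_eq[OF R[of z]] z by auto
    then show "Q o\<^sub>L f z = (Q o\<^sub>L W z) o\<^sub>L A"
      by (intro blinfun_eqI) (simp add: Y blinfun.bilinear_simps ker[OF E])
  qed
  qed
qed

end

section \<open>Graphs of unbounded operators\<close>

lemma Cauchy_if_norm_diff_le:
  assumes "Cauchy y" and le: "\<And>m n. norm (x m - x n) \<le> C * norm (y m - y n)"
  shows "Cauchy x"
proof (rule CauchyI)
  fix e :: real assume "0 < e"
  then obtain M where M: "\<forall>m\<ge>M. \<forall>n\<ge>M. norm (y m - y n) < e / (\<bar>C\<bar> + 1)"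
    using CauchyD[OF assms(1), of "e / (\<bar>C\<bar> + 1)"] by auto
  have "norm (x m - x n) < e" if "m \<ge> M" "n \<ge> M" for m n
  proof -
    have "norm (x m - x n) \<le> (\<bar>C\<bar> + 1) * norm (y m - y n)"
      by (rule order_trans[OF le mult_right_mono]) auto
    also have "\<dots> < e" using M that by (simp add: pos_less_divide_eq mult.commute)
    finally show ?thesis .
  qed
  then show "\<exists>M. \<forall>m\<ge>M. \<forall>n\<ge>M. norm (x m - x n) < e" by blast
qed

lemma linear_graphD:
  assumes "linear_graph G"
  shows "subspace G" "single_valued G" "(x, y) \<in> G \<Longrightarrow> (c *\<^sub>C x, c *\<^sub>C y) \<in> G"
  using assms by (auto simp: linear_graph_def)

lemma linear_graph_unique: "linear_graph G \<Longrightarrow> (x, y) \<in> G \<Longrightarrow> (x, y') \<in> G \<Longrightarrow> y = y'"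
  unfolding linear_graph_def single_valued_def by blast

lemma linear_graph_add: "linear_graph G \<Longrightarrow> (x, y) \<in> G \<Longrightarrow> (x', y') \<in> G \<Longrightarrow> (x + x', y + y') \<in> G"
  using subspace_add[of G "(x, y)" "(x', y')"] by (simp add: linear_graph_def)

lemma linear_graph_diff: "linear_graph G \<Longrightarrow> (x, y) \<in> G \<Longrightarrow> (x', y') \<in> G \<Longrightarrow> (x - x', y - y') \<in> G"
  using subspace_diff[of G "(x, y)" "(x', y')"] by (simp add: linear_graph_def)

lemma linear_graph_scaleR: "linear_graph G \<Longrightarrow> (x, y) \<in> G \<Longrightarrow> (r *\<^sub>R x, r *\<^sub>R y) \<in> G"
  using subspace_scale[of G "(x, y)" r] by (simp add: linear_graph_def)

lemma adj_graphD: "(y, z) \<in> adj_graph G \<Longrightarrow> (x, w) \<in> G \<Longrightarrow> cinner w y = cinner x z"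
  by (auto simp: adj_graph_def)

lemma adj_graphI: "(\<And>x w. (x, w) \<in> G \<Longrightarrow> cinner w y = cinner x z) \<Longrightarrow> (y, z) \<in> adj_graph G"
  by (auto simp: adj_graph_def)

lemma linear_graph_adj_graph:
  assumes "closure (Domain G) = UNIV" shows "linear_graph (adj_graph G)"
  unfolding linear_graph_def
proof (intro conjI allI impI)
  show "subspace (adj_graph G)"
    by (rule subspaceI)
      (auto simp: zero_prod_def cinner_add_right cinner_scaleR_right adj_graph_def split: prod.splits)
  show "single_valued (adj_graph G)"
    by (rule single_valuedI, rule dense_cinner_extensional[OF assms]) (metis DomainE adj_graphD)
  show "(c *\<^sub>C x, c *\<^sub>C y) \<in> adj_graph G" if "(x, y) \<in> adj_graph G" for c x y
    using that by (auto simp: cinner_scaleC_right adj_graph_def)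
qed

lemma closed_adj_graph: "closed (adj_graph G)"
proof -
  have "adj_graph G = (\<Inter>q\<in>G. {p. cinner (snd q) (fst p) = cinner (fst q) (snd p)})"
    by (force simp: adj_graph_def)
  moreover have "closed \<dots>"
    by (intro closed_INT ballI closed_Collect_eq continuous_on_cinner continuous_intros)
  ultimately show ?thesis by simp
qed

text \<open>Project \<open>(0, u)\<close> onto the closed graph of \<open>F\<close>: orthogonality
  of the residual to the graph says that a pair belongs to the adjoint graph. Testing with
  \<open>\<i> *\<^sub>C x\<close> upgrades real orthogonality to complex.\<close>

lemma dense_Domain_adj_graph:
  assumes lin: "linear_graph F" and cl: "closed F" and dense: "closure (Domain F) = UNIV"
  shows "closure (Domain (adj_graph F)) = UNIV"
proof (rule dense_if_trivial_complement)
  have lin': "linear_graph (adj_graph F)" by (rule linear_graph_adj_graph[OF dense])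
  show "subspace (Domain (adj_graph F))"
    by (rule subspaceI)
      (auto intro: subspace_0[OF linear_graphD(1)[OF lin'], unfolded zero_prod_def, THEN DomainI]
        linear_graph_add[OF lin', THEN DomainI] linear_graph_scaleR[OF lin', THEN DomainI])
  fix u assume u: "\<And>s. s \<in> Domain (adj_graph F) \<Longrightarrow> inner u s = 0"
  obtain p q where pq: "(p, q) \<in> F" and orth: "\<And>s. s \<in> F \<Longrightarrow> inner ((0, u) - (p, q)) s = 0"
    using orthogonal_projection_exists[OF linear_graphD(1)[OF lin] cl, of "(0, u)"] by (metis surj_pair)
  have re: "inner (u - q) w = inner p x" if "(x, w) \<in> F" for x w
    using orth[OF that] by (simp add: inner_prod_def)
  have "(u - q, p) \<in> adj_graph F"
  proof (rule adj_graphI)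
    fix x w assume xw: "(x, w) \<in> F"
    have "cinner (u - q) w = cinner p x"
      using re[OF xw] re[OF linear_graphD(3)[OF lin xw, of \<i>]] by (simp add: cinner_eq_inner)
    then show "cinner w (u - q) = cinner x p" by (metis cinner_commute)
  qed
  then have "inner u (u - q) = 0" by (intro u) auto
  moreover have "inner (u - q) q = inner p p" by (rule re[OF pq])
  ultimately have "inner (u - q) (u - q) = - inner p p" by (simp add: inner_diff_right inner_commute)
  then have "inner (u - q) (u - q) = 0 \<and> inner p p = 0"
    by (metis inner_ge_zero neg_le_0_iff_le antisym neg_equal_0_iff_equal)
  then have "u = q" "p = 0" by auto
  then have "(0, u) \<in> F" using pq by simp
  moreover have "(0, 0) \<in> F" using subspace_0[OF linear_graphD(1)[OF lin]] by (simp add: zero_prod_def)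
  ultimately show "u = 0" using linear_graph_unique[OF lin] by blast
qed

lemma selfadjoint_graph_sym:
  "selfadjoint_graph H \<Longrightarrow> (x, a) \<in> H \<Longrightarrow> (y, b) \<in> H \<Longrightarrow> cinner a y = cinner x b"
  unfolding selfadjoint_graph_def by (metis adj_graphD)

lemma closed_selfadjoint_graph: "selfadjoint_graph H \<Longrightarrow> closed H"
  unfolding selfadjoint_graph_def by (metis closed_adj_graph)

lemma shift_graph_iff: "(x, f) \<in> shift_graph H z \<longleftrightarrow> (x, f + z *\<^sub>C x) \<in> H"
  unfolding shift_graph_def by force

lemma linear_graph_shift_graph:
  assumes "linear_graph H" shows "linear_graph (shift_graph H z)"
  unfolding linear_graph_def
proof (intro conjI allI impI)
  show "subspace (shift_graph H z)"
  proof (rule subspaceI)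
    show "0 \<in> shift_graph H z"
      using subspace_0[OF linear_graphD(1)[OF assms]] by (simp add: shift_graph_iff zero_prod_def)
    show "p + q \<in> shift_graph H z" if "p \<in> shift_graph H z" "q \<in> shift_graph H z" for p q
      using linear_graph_add[OF assms] that
      by (cases p; cases q) (force simp: shift_graph_iff scaleC_add_right algebra_simps)
    show "c *\<^sub>R p \<in> shift_graph H z" if "p \<in> shift_graph H z" for c p
      using linear_graph_scaleR[OF assms, of "fst p" "snd p + z *\<^sub>C fst p" c] that
      by (cases p) (simp add: shift_graph_iff scaleR_scaleC scaleC_add_right scaleC_scaleC mult.commute)
  qed
  show "single_valued (shift_graph H z)"
    by (rule single_valuedI) (metis shift_graph_iff linear_graph_unique[OF assms] add_right_imp_eq)
  show "(c *\<^sub>C x, c *\<^sub>C y) \<in> shift_graph H z" if "(x, y) \<in> shift_graph H z" for c x y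
    using linear_graphD(3)[OF assms, of x "y + z *\<^sub>C x" c] that
    by (simp add: shift_graph_iff scaleC_add_right scaleC_scaleC mult.commute)
qed

lemma closed_shift_graph:
  assumes "closed H" shows "closed (shift_graph H z)"
proof -
  have "shift_graph H z = (\<lambda>p. (fst p, snd p + z *\<^sub>C fst p)) -` H"
    by (auto simp: shift_graph_iff)
  moreover have "closed ((\<lambda>p. (fst p, snd p + z *\<^sub>C fst p)) -` H)"
    by (intro closed_vimage assms continuous_intros bounded_linear.continuous_on[OF bounded_linear_scaleC_right])
  ultimately show ?thesis by simp
qed

section \<open>Resolvents of self-adjoint operators off the real axis\<close>

lemma selfadjoint_graph_cinner_real:
  assumes "selfadjoint_graph H" "(x, a) \<in> H" shows "Im (cinner x a) = 0"
proof -
  have "cnj (cinner x a) = cinner x a"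
    using selfadjoint_graph_sym[OF assms(1,2,2)] by (metis cinner_commute)
  then show ?thesis by (simp add: complex_eq_iff)
qed

text \<open>\<open>cinner x (H x)\<close> is real, so the imaginary part of
  \<open>cinner x f\<close> is \<open>Im z * (norm x)\<^sup>2\<close>; Cauchy-Schwarz bounds
  it.\<close>

lemma selfadjoint_graph_shift_bound:
  assumes "selfadjoint_graph H" "(x, f) \<in> shift_graph H z"
  shows "\<bar>Im z\<bar> * norm x \<le> norm f"
proof (cases "x = 0")
  case False
  have "cinner x (f + z *\<^sub>C x) = cinner x f + cnj z * of_real ((norm x)\<^sup>2)"
    by (simp add: cinner_add_right cinner_scaleC_right cinner_self)
  then have "0 = Im (cinner x f) - Im z * (norm x)\<^sup>2"
    using selfadjoint_graph_cinner_real[OF assms(1) assms(2)[unfolded shift_graph_iff]]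
    by (simp flip: of_real_power)
  then have "\<bar>Im z\<bar> * (norm x)\<^sup>2 = \<bar>Im (cinner x f)\<bar>" by (simp add: abs_mult)
  also have "\<dots> \<le> norm x * norm f" using abs_Im_le_cmod norm_cinner_le order_trans by blast
  finally have "(\<bar>Im z\<bar> * norm x) * norm x \<le> norm f * norm x" by (simp add: power2_eq_square mult_ac)
  then show ?thesis using False by simp
qed simp

lemma subspace_Range: "linear_graph G \<Longrightarrow> subspace (Range G)"
proof -
  assume "linear_graph G"
  moreover have "Range G = snd ` G" by force
  ultimately show ?thesis
    using linear_subspace_image[OF bounded_linear.linear[OF bounded_linear_snd] linear_graphD(1)] by simp
qed

text \<open>This is where self-adjointness counts beyond symmetry: membership in the adjoint graph
  is turned into membership in \<open>H\<close>. Real orthogonality suffices because the range is a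
  complex subspace.\<close>

lemma orthogonal_to_Range_shift_graph:
  assumes H: "selfadjoint_graph H" and u: "\<And>s. s \<in> Range (shift_graph H z) \<Longrightarrow> inner u s = 0"
  shows "(u, 0) \<in> shift_graph H (cnj z)"
proof -
  let ?G = "shift_graph H z"
  have linG: "linear_graph ?G" using H by (intro linear_graph_shift_graph) (simp add: selfadjoint_graph_def)
  have cu: "cinner u f = 0" if "(x, f) \<in> ?G" for x f
    using u[of f] u[of "\<i> *\<^sub>C f"] linear_graphD(3)[OF linG that, of \<i>] that
    by (auto simp: cinner_eq_inner zero_complex.code)
  have "(u, cnj z *\<^sub>C u) \<in> adj_graph H"
  proof (rule adj_graphI)
    fix x w assume "(x, w) \<in> H"
    then have "(x, w - z *\<^sub>C x) \<in> ?G" by (simp add: shift_graph_iff)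
    then have "cinner (w - z *\<^sub>C x) u = 0" using cu by (metis cinner_commute complex_cnj_zero)
    then show "cinner w u = cinner x (cnj z *\<^sub>C u)"
      by (simp add: cinner_diff_left cinner_scaleC_left cinner_scaleC_right)
  qed
  then show ?thesis using H by (simp add: shift_graph_iff selfadjoint_graph_def)
qed

text \<open>The lower bound makes the range closed, and the same bound at \<open>cnj z\<close> makes
  its orthogonal complement trivial.\<close>

lemma range_shift_selfadjoint_graph:
  assumes H: "selfadjoint_graph H" and z: "Im z \<noteq> 0"
  shows "Range (shift_graph H z) = UNIV"
proof -
  let ?G = "shift_graph H z"
  have lin: "linear_graph H" using H by (simp add: selfadjoint_graph_def)
  have linG: "linear_graph ?G" by (rule linear_graph_shift_graph[OF lin])
  have "closed (Range ?G)"
  proof (rule closed_range_if_sequentially_proper[OF linear_graphD(1)[OF linG]])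
    show "closed ?G" by (intro closed_shift_graph closed_selfadjoint_graph H)
    fix x y l assume xy: "\<And>n::nat. (x n, y n) \<in> ?G" and yl: "y \<longlonglongrightarrow> l"
    have "norm (x m - x n) \<le> norm (y m - y n) / \<bar>Im z\<bar>" for m n
      using selfadjoint_graph_shift_bound[OF H linear_graph_diff[OF linG xy[of m] xy[of n]]] z
      by (simp add: field_simps)
    then have "Cauchy x"
      by (intro Cauchy_if_norm_diff_le[OF LIMSEQ_imp_Cauchy[OF yl], of _ "1 / \<bar>Im z\<bar>"]) simp
    then obtain a where "x \<longlonglongrightarrow> a" using Cauchy_convergent convergent_def by blast
    then show "\<exists>\<sigma> a. strict_mono (\<sigma>::nat\<Rightarrow>nat) \<and> (x \<circ> \<sigma>) \<longlonglongrightarrow> a"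
      by (intro exI[of _ id] exI[of _ a]) (simp add: strict_mono_def)
  qed
  moreover have "closure (Range ?G) = UNIV"
  proof (rule dense_if_trivial_complement)
    show "subspace (Range ?G)" by (rule subspace_Range[OF linG])
    fix u assume "\<And>s. s \<in> Range ?G \<Longrightarrow> inner u s = 0"
    then have "(u, 0) \<in> shift_graph H (cnj z)" by (rule orthogonal_to_Range_shift_graph[OF H])
    from selfadjoint_graph_shift_bound[OF H this] show "u = 0" using z by (simp add: mult_le_0_iff)
  qed
  ultimately show ?thesis by simp
qed

lemma resolvent_exists:
  assumes H: "selfadjoint_graph H" and z: "Im z \<noteq> 0"
  shows "\<exists>R. clinear_op R \<and> (\<forall>x f. (x, f) \<in> shift_graph H z \<longleftrightarrow> x = blinfun_apply R f)"
proof -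
  let ?G = "shift_graph H z"
  have linG: "linear_graph ?G" using H by (intro linear_graph_shift_graph) (simp add: selfadjoint_graph_def)
  have uniq: "x = x'" if "(x, f) \<in> ?G" "(x', f) \<in> ?G" for x x' f
    using selfadjoint_graph_shift_bound[OF H linear_graph_diff[OF linG that]] z
    by (simp add: mult_le_0_iff)
  have "\<exists>x. (x, f) \<in> ?G" for f using range_shift_selfadjoint_graph[OF assms] by blast
  then obtain R where R: "\<And>f. (R f, f) \<in> ?G" by metis
  have "bounded_linear R"
  proof (rule bounded_linear_intro[where K = "1 / \<bar>Im z\<bar>"])
    show "R (f + g) = R f + R g" for f g by (rule uniq[OF R linear_graph_add[OF linG R R]])
    show "R (c *\<^sub>R f) = c *\<^sub>R R f" for c f by (rule uniq[OF R linear_graph_scaleR[OF linG R]])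
    show "norm (R f) \<le> norm f * (1 / \<bar>Im z\<bar>)" for f
      using selfadjoint_graph_shift_bound[OF H R[of f]] z by (simp add: field_simps)
  qed
  then have app: "blinfun_apply (Blinfun R) = R" by (rule bounded_linear_Blinfun_apply)
  show ?thesis
  proof (intro exI[of _ "Blinfun R"] conjI allI)
    show "clinear_op (Blinfun R)" unfolding clinear_op_def app
      by (intro allI uniq[OF R linear_graphD(3)[OF linG R]])
    show "(x, f) \<in> ?G \<longleftrightarrow> x = blinfun_apply (Blinfun R) f" for x f
      unfolding app using uniq[OF _ R[of f], of x] R[of f] by auto
  qed
qed

definition resolvent_op :: "('a::complex_hilbert \<times> 'a) set \<Rightarrow> complex \<Rightarrow> 'a \<Rightarrow>\<^sub>L 'a"
  where "resolvent_op H z = (SOME R. clinear_op R \<and> (\<forall>x f. (x, f) \<in> shift_graph H z \<longleftrightarrow> x = blinfun_apply R f))"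

lemma resolvent_op:
  assumes "selfadjoint_graph H" "Im z \<noteq> 0"
  shows resolvent_op_clinear: "clinear_op (resolvent_op H z)"
    and resolvent_op_iff: "(x, f) \<in> shift_graph H z \<longleftrightarrow> x = resolvent_op H z f"
proof -
  have "clinear_op (resolvent_op H z) \<and>
      (\<forall>x f. (x, f) \<in> shift_graph H z \<longleftrightarrow> x = blinfun_apply (resolvent_op H z) f)"
    unfolding resolvent_op_def by (rule someI_ex[OF resolvent_exists[OF assms]])
  then show "clinear_op (resolvent_op H z)" "(x, f) \<in> shift_graph H z \<longleftrightarrow> x = resolvent_op H z f"
    by blast+
qed

lemma resolvent_op_graph:
  assumes "selfadjoint_graph H" "Im z \<noteq> 0"
  shows "(resolvent_op H z f, f + z *\<^sub>C resolvent_op H z f) \<in> H"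
  using resolvent_op_iff[OF assms] by (simp add: shift_graph_iff[symmetric])

lemma resolvent_op_adjoint:
  assumes H: "selfadjoint_graph H" and z: "Im z \<noteq> 0"
  shows "cinner (resolvent_op H z f) g = cinner f (resolvent_op H (cnj z) g)"
proof -
  have z': "Im (cnj z) \<noteq> 0" using z by simp
  let ?x = "resolvent_op H z f" and ?y = "resolvent_op H (cnj z) g"
  have "cinner (f + z *\<^sub>C ?x) ?y = cinner ?x (g + cnj z *\<^sub>C ?y)"
    by (rule selfadjoint_graph_sym[OF H resolvent_op_graph[OF H z] resolvent_op_graph[OF H z']])
  then show ?thesis
    by (simp add: cinner_add_left cinner_add_right cinner_scaleC_left cinner_scaleC_right)
qed

section \<open>Adjoint pairs of bounded operators\<close>

text \<open>A relation in place of \<open>adj_op\<close>, which is a definite description: here an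
  adjoint is always exhibited explicitly, as the sandwiched resolvent at the conjugate point or its
  limit.\<close>

definition adjoint_ops :: "('a::complex_hilbert \<Rightarrow>\<^sub>L 'a) \<Rightarrow> ('a \<Rightarrow>\<^sub>L 'a) \<Rightarrow> bool"
  where "adjoint_ops T S \<longleftrightarrow> (\<forall>x y. cinner (T x) y = cinner x (S y))"

lemma adjoint_ops_diff:
  "adjoint_ops T S \<Longrightarrow> adjoint_ops T' S' \<Longrightarrow> adjoint_ops (T - T') (S - S')"
  by (simp add: adjoint_ops_def blinfun.diff_left cinner_diff_left cinner_diff_right)

lemma adjoint_ops_norm_le:
  assumes "adjoint_ops T S" shows "norm S \<le> norm T"
proof (rule norm_blinfun_bound)
  fix y
  show "norm (S y) \<le> norm T * norm y"
  proof (cases "S y = 0")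
    case False
    have "(norm (S y))\<^sup>2 = inner (T (S y)) y"
      using assms by (simp add: adjoint_ops_def inner_eq_Re_cinner cinner_self)
    also have "\<dots> \<le> norm (T (S y)) * norm y" by (rule norm_cauchy_schwarz)
    also have "\<dots> \<le> (norm T * norm (S y)) * norm y" by (intro mult_right_mono norm_blinfun) simp
    finally have "norm (S y) * norm (S y) \<le> (norm T * norm y) * norm (S y)"
      by (simp add: power2_eq_square mult_ac)
    then show ?thesis using False by simp
  qed simp
qed simp

text \<open>Adjoints of differences are bounded in norm by the differences themselves, so norm
  convergence is transferred to the adjoints.\<close>

lemma adjoint_ops_tendsto:
  assumes adj: "\<And>y. y > 0 \<Longrightarrow> adjoint_ops (T y) (S y)" and T: "(T \<longlongrightarrow> L) (at_right (0::real))"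
  obtains L' where "(S \<longlongrightarrow> L') (at_right 0)" "adjoint_ops L L'"
proof -
  define u :: "nat \<Rightarrow> real" where "u n = inverse (real (Suc n))" for n
  have u: "u n > 0" for n by (simp add: u_def)
  have "filterlim u (at_right 0) sequentially"
    unfolding filterlim_at using LIMSEQ_inverse_real_of_nat u by (auto simp: u_def[abs_def])
  then have Tu: "(\<lambda>n. T (u n)) \<longlonglongrightarrow> L" using T by (rule filterlim_compose[rotated])
  have le: "norm (S y - S y') \<le> norm (T y - T y')" if "y > 0" "y' > 0" for y y'
    by (intro adjoint_ops_norm_le adjoint_ops_diff adj that)
  have "Cauchy (\<lambda>n. S (u n))"
    using LIMSEQ_imp_Cauchy[OF Tu] le[OF u u] unfolding Cauchy_iff by (meson le_less_trans)
  \<comment> \<open>Completeness supplies the limit along the sequence \<open>u\<close>; the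
    estimate \<open>le'\<close> then extends the convergence to the whole filter.\<close>
  then obtain L' where L': "(\<lambda>n. S (u n)) \<longlonglongrightarrow> L'" using Cauchy_convergent convergent_def by blast
  have le': "norm (S y - L') \<le> norm (T y - L)" if "y > 0" for y
    by (rule LIMSEQ_le[OF tendsto_norm[OF tendsto_diff[OF tendsto_const L']]
          tendsto_norm[OF tendsto_diff[OF tendsto_const Tu]]]) (use le[OF that u] in blast)
  have "((\<lambda>y. norm (T y - L)) \<longlongrightarrow> 0) (at_right 0)"
    using tendsto_norm[OF tendsto_diff[OF T tendsto_const[of L]]] by simp
  then have "((\<lambda>y. S y - L') \<longlongrightarrow> 0) (at_right 0)"
    by (rule Lim_null_comparison[rotated])
      (use le' in \<open>auto simp: eventually_at_right_less intro: eventually_mono[OF eventually_at_right_less]\<close>)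
  then have S: "(S \<longlongrightarrow> L') (at_right 0)" by (simp add: LIM_zero_iff)
  have "cinner (L x) y = cinner x (L' y)" for x y
  proof (rule LIMSEQ_unique)
    show "(\<lambda>n. cinner (T (u n) x) y) \<longlonglongrightarrow> cinner (L x) y"
      by (intro tendsto_cinner blinfun.tendsto Tu tendsto_const)
    have "(\<lambda>n. cinner x (S (u n) y)) \<longlonglongrightarrow> cinner x (L' y)"
      by (intro tendsto_cinner blinfun.tendsto L' tendsto_const)
    then show "(\<lambda>n. cinner (T (u n) x) y) \<longlonglongrightarrow> cinner x (L' y)"
      using adj[OF u] by (simp add: adjoint_ops_def)
  qed
  then show ?thesis using that S by (simp add: adjoint_ops_def)
qed

lemma Im_op_adjoint:
  assumes adj: "adjoint_ops T S" and T: "clinear_op T"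
  shows "selfadjoint_op (Im_op T)" "inner (Im_op T x) x = Im (cinner (T x) x)"
    "Im_op T x = (1 / (2 * \<i>)) *\<^sub>C (T x - S x)"
proof -
  have TS: "cinner (T x) y = cinner x (S y)" for x y using adj by (simp add: adjoint_ops_def)
  have ST: "cinner (S x) y = cinner x (T y)" for x y using TS by (metis cinner_commute)
  have adj_eq: "adj_op T = S" by (rule adj_op_eqI) (rule TS)
  show app: "Im_op T x = (1 / (2 * \<i>)) *\<^sub>C (T x - S x)" for x
    by (simp add: Im_op_def adj_eq scaleC_op_apply blinfun.diff_left)
  have S: "clinear_op S"
    unfolding clinear_op_def
    by (intro allI, rule cinner_extensional) (simp add: TS[symmetric] cinner_scaleC_right)
  have "clinear_op (Im_op T)" unfolding Im_op_def adj_eq by (intro clinear_op_intros T S)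
  then show "selfadjoint_op (Im_op T)"
    by (auto simp: selfadjoint_op_def app cinner_scaleC_left cinner_scaleC_right cinner_diff_left
        cinner_diff_right TS ST right_diff_distrib)
  have "cinner (S x) x = cnj (cinner (T x) x)" by (metis ST cinner_commute)
  then have "cinner (Im_op T x) x = (1 / (2 * \<i>)) * (cinner (T x) x - cnj (cinner (T x) x))"
    by (simp only: app cinner_scaleC_left cinner_diff_left)
  also have "\<dots> = of_real (Im (cinner (T x) x))"
    by (simp add: complex_eq_iff complex_diff_cnj)
  finally show "inner (Im_op T x) x = Im (cinner (T x) x)"
    using inner_eq_Re_cinner[of "Im_op T x" x] by simp
qed

section \<open>The sandwiched resolvent\<close>

lemma sandwich_graph_iff:
  "(x, v) \<in> sandwich_graph F J \<longleftrightarrow> (\<exists>w. (x, w) \<in> F \<and> (J w, v) \<in> adj_graph F)"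
  by (auto simp: sandwich_graph_def op_graph_def)

lemma op_eq_on_dense:
  fixes S T :: "'a::real_normed_vector \<Rightarrow>\<^sub>L 'b::real_normed_vector"
  assumes "closure D = UNIV" "\<And>x. x \<in> D \<Longrightarrow> S x = T x" shows "S = T"
  by (rule blinfun_eqI, rule dense_closed_induct[where P = "\<lambda>x. S x = T x", OF assms(1)])
    (auto intro!: closed_Collect_eq continuous_intros assms(2))

context rigged_affine_space
begin

lemma adj_F_linear: "linear_graph (adj_graph F)"
  by (rule linear_graph_adj_graph[OF F_dense])

lemma adj_F_dense: "closure (Domain (adj_graph F)) = UNIV"
  by (rule dense_Domain_adj_graph[OF F_linear F_closed F_dense])

lemma sandwich_subset_perturbation: "sandwich_graph F J \<subseteq> perturbation F J"
  unfolding perturbation_def by (rule closure_subset)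

lemma perturbation_unique: "J \<in> \<J> \<Longrightarrow> (x, v) \<in> perturbation F J \<Longrightarrow> (x, v') \<in> perturbation F J \<Longrightarrow> v = v'"
  using V_selfadjoint[of J] linear_graph_unique unfolding selfadjoint_graph_def by blast

lemma sandwich_exists:
  assumes "J \<in> \<J>" "x \<in> \<D>" obtains v where "(x, v) \<in> sandwich_graph F J"
  using domain_V[OF assms(1)] assms(2) by blast

text \<open>\<open>perturbation F J\<close> is a closure, but on \<open>\<D>\<close> the product is
  already defined, and single-valuedness forces both to agree there. Every later computation may
  therefore use the factorisation through \<open>F\<close>.\<close>

lemma add_graph_iff:
  assumes "J \<in> \<J>" "Domain H = \<D>"
  shows "(x, b) \<in> add_graph H s (perturbation F J) \<longleftrightarrow>
    (\<exists>a v. (x, a) \<in> H \<and> (x, v) \<in> sandwich_graph F J \<and> b = a + s *\<^sub>R v)"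
proof
  assume "(x, b) \<in> add_graph H s (perturbation F J)"
  then obtain a v where av: "(x, a) \<in> H" "(x, v) \<in> perturbation F J" "b = a + s *\<^sub>R v"
    by (auto simp: add_graph_def)
  obtain v' where v': "(x, v') \<in> sandwich_graph F J"
    using sandwich_exists[OF assms(1), of x] av(1) assms(2) by blast
  then have "v = v'" using perturbation_unique[OF assms(1) av(2)] sandwich_subset_perturbation by blast
  then show "\<exists>a v. (x, a) \<in> H \<and> (x, v) \<in> sandwich_graph F J \<and> b = a + s *\<^sub>R v" using av v' by blast
next
  assume "\<exists>a v. (x, a) \<in> H \<and> (x, v) \<in> sandwich_graph F J \<and> b = a + s *\<^sub>R v"
  then show "(x, b) \<in> add_graph H s (perturbation F J)"
    using sandwich_subset_perturbation unfolding add_graph_def by blast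
qed

lemma sandwich_linear_combination:
  assumes "(x, v) \<in> sandwich_graph F J" "(x, v') \<in> sandwich_graph F J'"
  shows "(x, v + s *\<^sub>R v') \<in> sandwich_graph F (J + s *\<^sub>R J')"
proof -
  obtain w w' where w: "(x, w) \<in> F" "(J w, v) \<in> adj_graph F" "(x, w') \<in> F" "(J' w', v') \<in> adj_graph F"
    using assms by (auto simp: sandwich_graph_iff)
  have "w' = w" using linear_graph_unique[OF F_linear] w by blast
  then have "(J w + s *\<^sub>R J' w, v + s *\<^sub>R v') \<in> adj_graph F"
    using linear_graph_add[OF adj_F_linear w(2) linear_graph_scaleR[OF adj_F_linear w(4), of s]] by simp
  then show ?thesis using w(1) by (auto simp: sandwich_graph_iff blinfun.add_left blinfun.scaleR_left)
qed

text \<open>The product with \<open>J = 0\<close> lives on the domain of \<open>F\<close> only; its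
  closure is the everywhere defined zero operator. Hence the base point of the affine space belongs
  to the space.\<close>

lemma perturbation_zero: "perturbation F 0 = UNIV \<times> {0}"
proof -
  have 0: "(0, z) \<in> adj_graph F \<longleftrightarrow> z = 0" for z
  proof
    show zero: "(0, z) \<in> adj_graph F" if "z = 0" for z using that by (auto intro: adj_graphI)
    show "z = 0" if "(0, z) \<in> adj_graph F"
      using linear_graph_unique[OF adj_F_linear that zero] by simp
  qed
  have "sandwich_graph F 0 = Domain F \<times> {0}"
    by (auto simp: sandwich_graph_iff 0)
  then show ?thesis by (simp add: perturbation_def closure_Times F_dense)
qed

text \<open>The two graphs are compared on \<open>\<D>\<close>, where each perturbation is given by
  its product and products with a common \<open>F\<close> add up. The base point \<open>B\<close>
  has domain \<open>\<D>\<close> as the member with \<open>J = 0\<close>.\<close>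

lemma add_graph_in_affine:
  assumes H: "H \<in> \<A>" and J: "J \<in> \<J>" shows "add_graph H s (perturbation F J) \<in> \<A>"
proof -
  obtain B where B: "\<A> = {add_graph B 1 (perturbation F J) | J. J \<in> \<J>}" using affine by blast
  have "add_graph B 1 (perturbation F 0) = B" by (force simp: add_graph_def perturbation_zero)
  then have "B \<in> \<A>" using B subspace_0[OF J_subspace] by blast
  then have DB: "Domain B = \<D>" by (rule common_domain)
  obtain J0 where J0: "J0 \<in> \<J>" "H = add_graph B 1 (perturbation F J0)" using B H by blast
  have J1: "J0 + s *\<^sub>R J \<in> \<J>" using J_subspace J J0 by (simp add: subspace_add subspace_scale)
  have "(x, b) \<in> add_graph H s (perturbation F J) \<longleftrightarrow> (x, b) \<in> add_graph B 1 (perturbation F (J0 + s *\<^sub>R J))" for x b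
  proof
    assume "(x, b) \<in> add_graph H s (perturbation F J)"
    then obtain a v0 v where "(x, a) \<in> B" "(x, v0) \<in> sandwich_graph F J0" "(x, v) \<in> sandwich_graph F J"
      "b = (a + 1 *\<^sub>R v0) + s *\<^sub>R v"
      unfolding add_graph_iff[OF J common_domain[OF H]] unfolding J0(2) add_graph_iff[OF J0(1) DB] by blast
    then show "(x, b) \<in> add_graph B 1 (perturbation F (J0 + s *\<^sub>R J))"
      unfolding add_graph_iff[OF J1 DB] using sandwich_linear_combination[of x v0 J0 v J s]
      by (intro exI[of _ a] exI[of _ "v0 + s *\<^sub>R v"]) simp
  next
    assume "(x, b) \<in> add_graph B 1 (perturbation F (J0 + s *\<^sub>R J))"
    then obtain a v' where av: "(x, a) \<in> B" "(x, v') \<in> sandwich_graph F (J0 + s *\<^sub>R J)" "b = a + v'"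
      unfolding add_graph_iff[OF J1 DB] by auto
    have "x \<in> \<D>" using av DB by blast
    then obtain v0 v where v: "(x, v0) \<in> sandwich_graph F J0" "(x, v) \<in> sandwich_graph F J"
      using sandwich_exists J J0(1) by metis
    have "v' = v0 + s *\<^sub>R v"
      using sandwich_linear_combination[OF v] av(2) sandwich_subset_perturbation
      by (intro perturbation_unique[OF J1, of x]) auto
    then have "b = (a + 1 *\<^sub>R v0) + s *\<^sub>R v" using av by simp
    then show "(x, b) \<in> add_graph H s (perturbation F J)"
      unfolding add_graph_iff[OF J common_domain[OF H]] unfolding J0(2) add_graph_iff[OF J0(1) DB]
      using av v by blast
  qed
  then have "add_graph H s (perturbation F J) = add_graph B 1 (perturbation F (J0 + s *\<^sub>R J))" by auto
  then show ?thesis using B J1 by blast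
qed

text \<open>The resolvent maps into \<open>\<D>\<close>, which lies in the domain of
  \<open>F\<close>, so the sandwiched resolvent is defined on the whole dense domain of the adjoint
  of \<open>F\<close>. Its bounded extension is unique and \<open>THE\<close> is meaningful.\<close>

lemma T_op_exists:
  assumes H: "H \<in> \<A>" and z: "Im z \<noteq> 0"
  shows T_op_compact: "compact_op (T_op F z H)"
    and T_op_graph: "(y, f) \<in> adj_graph F \<Longrightarrow> (resolvent_op H z f, T_op F z H y) \<in> F"
proof -
  note sa = H_selfadjoint[OF H]
  let ?S = "sandwiched_resolvent_graph F H z"
  have S_iff: "(y, k) \<in> ?S \<longleftrightarrow> (\<exists>f. (y, f) \<in> adj_graph F \<and> (resolvent_op H z f, k) \<in> F)" for y k
    by (auto simp: sandwiched_resolvent_graph_def relcomp_unfold resolvent_op_iff[OF sa z])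
  have ex: "\<exists>k. (resolvent_op H z f, k) \<in> F" for f
    using resolvent_op_graph[OF sa z, of f] common_domain[OF H] domain_F by blast
  have dom: "Domain ?S = Domain (adj_graph F)" by (auto simp: Domain_iff S_iff) (meson ex)
  obtain T where T: "compact_op T" "?S \<subseteq> op_graph T" using T_compact[OF H z] by blast
  have "T_op F z H = T"
    unfolding T_op_def
  proof (rule the_equality)
    show "clinear_op T \<and> ?S \<subseteq> op_graph T" using T by (simp add: compact_op_def)
    fix T' assume T': "clinear_op T' \<and> ?S \<subseteq> op_graph T'"
    show "T' = T"
    proof (rule op_eq_on_dense[OF adj_F_dense])
      fix y assume "y \<in> Domain (adj_graph F)"
      then obtain k where "(y, k) \<in> ?S" using dom by blast
      then show "T' y = T y" using T T' by (auto simp: op_graph_def)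
    qed
  qed
  then show "compact_op (T_op F z H)" using T by simp
  show "(resolvent_op H z f, T_op F z H y) \<in> F" if "(y, f) \<in> adj_graph F"
  proof -
    obtain k where k: "(resolvent_op H z f, k) \<in> F" using ex by blast
    then have "(y, k) \<in> ?S" using S_iff that by blast
    then have "k = T_op F z H y" using T \<open>T_op F z H = T\<close> by (auto simp: op_graph_def)
    then show ?thesis using k by simp
  qed
qed

lemma T_op_clinear: "H \<in> \<A> \<Longrightarrow> Im z \<noteq> 0 \<Longrightarrow> clinear_op (T_op F z H)"
  using T_op_compact by (simp add: compact_op_def)

lemma T_op_adjoint:
  assumes H: "H \<in> \<A>" and z: "Im z \<noteq> 0"
  shows "adjoint_ops (T_op F z H) (T_op F (cnj z) H)"
proof -
  have z': "Im (cnj z) \<noteq> 0" using z by simp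
  let ?T = "T_op F z H" and ?T' = "T_op F (cnj z) H"
  have base: "cinner (?T x) y = cinner x (?T' y)" if x: "(x, f) \<in> adj_graph F" and y: "(y, g) \<in> adj_graph F" for x y f g
  proof -
    have "cinner (?T x) y = cinner (resolvent_op H z f) g"
      by (rule adj_graphD[OF y T_op_graph[OF H z x]])
    also have "\<dots> = cinner f (resolvent_op H (cnj z) g)"
      by (rule resolvent_op_adjoint[OF H_selfadjoint[OF H] z])
    also have "\<dots> = cinner x (?T' y)"
      using adj_graphD[OF x T_op_graph[OF H z' y]] by (metis cinner_commute)
    finally show ?thesis .
  qed
  have step: "cinner (?T x) y = cinner x (?T' y)" if "(x, f) \<in> adj_graph F" for x y f
    by (rule dense_closed_induct[where P = "\<lambda>y. cinner (?T x) y = cinner x (?T' y)", OF adj_F_dense])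
      (auto intro!: closed_Collect_eq continuous_on_cinner continuous_intros dest: base[OF that])
  have "cinner (?T x) y = cinner x (?T' y)" for x y
    by (rule dense_closed_induct[where P = "\<lambda>x. cinner (?T x) y = cinner x (?T' y)", OF adj_F_dense])
      (auto intro!: closed_Collect_eq continuous_on_cinner continuous_intros dest: step)
  then show ?thesis by (simp add: adjoint_ops_def)
qed

lemma Im_cinner_T_op:
  assumes H: "H \<in> \<A>" and z: "Im z \<noteq> 0" and x: "(x, f) \<in> adj_graph F"
  shows "Im (cinner (T_op F z H x) x) = Im z * (norm (resolvent_op H z f))\<^sup>2"
proof -
  let ?u = "resolvent_op H z f"
  have "cinner (T_op F z H x) x = cinner ?u f" by (rule adj_graphD[OF x T_op_graph[OF H z x]])
  also have "\<dots> = cinner ?u (f + z *\<^sub>C ?u) - cnj z * of_real ((norm ?u)\<^sup>2)"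
    by (simp add: cinner_add_right cinner_scaleC_right cinner_self)
  finally show ?thesis
    using selfadjoint_graph_cinner_real[OF H_selfadjoint[OF H] resolvent_op_graph[OF H_selfadjoint[OF H] z, of f]]
    by (simp flip: of_real_power)
qed

text \<open>The closure of \<open>F\<close> applied to \<open>\<D>\<close> matters because the sign
  of \<open>V\<close> controls \<open>J\<close> there.\<close>

lemma T_op_range: "H \<in> \<A> \<Longrightarrow> Im z \<noteq> 0 \<Longrightarrow> T_op F z H y \<in> closure (F `` \<D>)"
proof -
  assume H: "H \<in> \<A>" and z: "Im z \<noteq> 0"
  have "closed {y. T_op F z H y \<in> closure (F `` \<D>)}"
    using closed_vimage[OF closed_closure, of "T_op F z H"]
    by (simp add: vimage_def linear_continuous_on blinfun.bounded_linear_right)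
  moreover have "T_op F z H y \<in> closure (F `` \<D>)" if y: "y \<in> Domain (adj_graph F)" for y
  proof -
    obtain f where "(y, f) \<in> adj_graph F" using y by blast
    moreover have "resolvent_op H z f \<in> \<D>"
      using DomainI[OF resolvent_op_graph[OF H_selfadjoint[OF H] z, of f]] common_domain[OF H] by simp
    ultimately have "T_op F z H y \<in> F `` \<D>" using T_op_graph[OF H z] by (blast intro: ImageI)
    then show ?thesis by (rule subsetD[OF closure_subset])
  qed
  ultimately show ?thesis by (rule dense_closed_induct[OF adj_F_dense])
qed

text \<open>With \<open>x = (H_s - z)^-1 f\<close> one has
  \<open>(H_t - z) x = f + (t - s) V x\<close>, and \<open>V x\<close> is the adjoint of
  \<open>F\<close> applied to \<open>J (T s y)\<close>. Applying \<open>F\<close> to the resolvent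
  at \<open>t\<close> of this equation gives the identity on a dense set.\<close>

lemma T_op_resolvent_identity:
  assumes H: "H \<in> \<A>" and J: "J \<in> \<J>" and z: "Im z \<noteq> 0"
  defines "T \<equiv> \<lambda>s. T_op F z (add_graph H s (perturbation F J))"
  shows "T t y + (t - s) *\<^sub>R T t (J (T s y)) = T s y"
proof -
  define Hs where "Hs s = add_graph H s (perturbation F J)" for s
  have HsA: "Hs s \<in> \<A>" for s unfolding Hs_def by (rule add_graph_in_affine[OF H J])
  note sa = H_selfadjoint[OF HsA]
  have Hs_iff: "(x, b) \<in> Hs s \<longleftrightarrow> (\<exists>a v. (x, a) \<in> H \<and> (x, v) \<in> sandwich_graph F J \<and> b = a + s *\<^sub>R v)" for x b s
    unfolding Hs_def by (rule add_graph_iff[OF J common_domain[OF H]])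
  have T: "T s = T_op F z (Hs s)" for s by (simp add: T_def Hs_def)
  have base: "T t y + (t - s) *\<^sub>R T t (J (T s y)) = T s y" if y: "(y, f) \<in> adj_graph F" for y f
  proof -
    let ?x = "resolvent_op (Hs s) z f"
    obtain a v where av: "(?x, a) \<in> H" "(?x, v) \<in> sandwich_graph F J" "f + z *\<^sub>C ?x = a + s *\<^sub>R v"
      using resolvent_op_graph[OF sa z, of s f] unfolding Hs_iff by blast
    have xw: "(?x, T s y) \<in> F" unfolding T by (rule T_op_graph[OF HsA z y])
    obtain w where w: "(?x, w) \<in> F" "(J w, v) \<in> adj_graph F" using av(2) by (auto simp: sandwich_graph_iff)
    have "w = T s y" by (rule linear_graph_unique[OF F_linear w(1) xw])
    then have Jv: "(J (T s y), v) \<in> adj_graph F" using w by simp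
    have "(?x, a + t *\<^sub>R v) \<in> Hs t" unfolding Hs_iff using av by blast
    moreover have "a + t *\<^sub>R v = (f + (t - s) *\<^sub>R v) + z *\<^sub>C ?x"
      using av(3) by (simp add: algebra_simps)
    ultimately have "(?x, f + (t - s) *\<^sub>R v) \<in> shift_graph (Hs t) z" by (simp add: shift_graph_iff)
    then have x: "?x = resolvent_op (Hs t) z f + (t - s) *\<^sub>R resolvent_op (Hs t) z v"
      by (simp add: resolvent_op_iff[OF sa z] blinfun.add_right blinfun.scaleR_right)
    have "(?x, T t y + (t - s) *\<^sub>R T t (J (T s y))) \<in> F"
      unfolding x T[of t]
      by (intro linear_graph_add[OF F_linear] linear_graph_scaleR[OF F_linear] T_op_graph[OF HsA z] y Jv)
    then show ?thesis using linear_graph_unique[OF F_linear _ xw] by blast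
  qed
  have "T t + (t - s) *\<^sub>R (T t o\<^sub>L (J o\<^sub>L T s)) = T s"
    by (rule op_eq_on_dense[OF adj_F_dense]) (auto simp: blinfun.add_left blinfun.scaleR_left base)
  from arg_cong[OF this, of "\<lambda>S. S y"] show ?thesis by (simp add: blinfun.add_left blinfun.scaleR_left)
qed

section \<open>Boundary values on the real axis\<close>

lemma T_plus_tendsto:
  assumes "H \<in> \<A>" "lam \<in> Lambda_set F H"
  shows "((\<lambda>y. T_op F (Complex lam y) H) \<longlongrightarrow> T_plus F lam H) (at_right 0)"
  using assms(2) tendsto_Lim[OF trivial_limit_at_right_real] unfolding Lambda_set_def T_plus_def by blast

text \<open>The operators below the axis are the adjoints of those above it, so one limit entails
  the other.\<close>

lemma Lambda_setI:
  assumes H: "H \<in> \<A>" and L: "((\<lambda>y. T_op F (Complex lam y) H) \<longlongrightarrow> L) (at_right 0)"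
  shows "lam \<in> Lambda_set F H"
proof -
  have "adjoint_ops (T_op F (Complex lam y) H) (T_op F (Complex lam (- y)) H)" if "y > 0" for y
    using T_op_adjoint[OF H, of "Complex lam y"] that by (simp add: complex_cnj)
  then obtain L' where "((\<lambda>y. T_op F (Complex lam (- y)) H) \<longlongrightarrow> L') (at_right 0)"
    using adjoint_ops_tendsto[OF _ L] by metis
  then show ?thesis using L by (auto simp: Lambda_set_def)
qed

context
  fixes H lam assumes H: "H \<in> \<A>" and lam: "lam \<in> Lambda_set F H"
begin

lemma T_plus_compact: "compact_op (T_plus F lam H)"
proof (rule compact_op_limit)
  have ev: "\<forall>\<^sub>F y in at_right (0::real). y > 0" by (rule eventually_at_right_less)
  show "clinear_op (T_plus F lam H)"
    by (rule clinear_op_limit[OF T_plus_tendsto[OF H lam]])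
      (use ev in \<open>auto elim!: eventually_mono intro: T_op_clinear[OF H]\<close>)
  fix e :: real assume "e > 0"
  have "\<forall>\<^sub>F y in at_right 0. dist (T_op F (Complex lam y) H) (T_plus F lam H) < e"
    using T_plus_tendsto[OF H lam] \<open>e > 0\<close> by (rule tendstoD)
  then have "\<forall>\<^sub>F y in at_right 0. dist (T_op F (Complex lam y) H) (T_plus F lam H) < e \<and> y > 0"
    using ev by (rule eventually_conj)
  then obtain y :: real where "y > 0" "dist (T_op F (Complex lam y) H) (T_plus F lam H) < e"
    using eventually_happens[OF _] trivial_limit_at_right_real by (metis (mono_tags, lifting) eventually_happens')
  then show "\<exists>K'. compact_op K' \<and> norm (T_plus F lam H - K') < e"
    by (intro exI[of _ "T_op F (Complex lam y) H"]) (simp add: T_op_compact[OF H] dist_norm norm_minus_commute)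
qed

lemma T_plus_adjoint:
  obtains S where "((\<lambda>y. T_op F (Complex lam (- y)) H) \<longlongrightarrow> S) (at_right 0)" "adjoint_ops (T_plus F lam H) S"
proof -
  have "adjoint_ops (T_op F (Complex lam y) H) (T_op F (Complex lam (- y)) H)" if "y > 0" for y
    using T_op_adjoint[OF H, of "Complex lam y"] that by (simp add: complex_cnj)
  then show ?thesis using adjoint_ops_tendsto[OF _ T_plus_tendsto[OF H lam]] that by metis
qed

lemma T_plus_clinear: "clinear_op (T_plus F lam H)"
  using T_plus_compact by (simp add: compact_op_def)

lemma tendsto_Im_cinner_T_plus:
  "((\<lambda>y. Im (cinner (T_op F (Complex lam y) H x) x)) \<longlongrightarrow> Im (cinner (T_plus F lam H x) x)) (at_right 0)"
  by (intro tendsto_Im tendsto_cinner blinfun.tendsto T_plus_tendsto[OF H lam] tendsto_const)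

lemma Im_cinner_T_plus_nonneg: "0 \<le> Im (cinner (T_plus F lam H x) x)"
proof -
  have "closed {x. 0 \<le> Im (cinner (T_plus F lam H x) x)}"
    by (intro closed_Collect_le continuous_on_Im continuous_on_cinner continuous_intros)
  moreover have "0 \<le> Im (cinner (T_plus F lam H x) x)" if Dx: "x \<in> Domain (adj_graph F)" for x
  proof (rule tendsto_lowerbound[OF tendsto_Im_cinner_T_plus])
    obtain f where x: "(x, f) \<in> adj_graph F" using Dx by blast
    show "\<forall>\<^sub>F y in at_right 0. 0 \<le> Im (cinner (T_op F (Complex lam y) H x) x)"
      by (rule eventually_mono[OF eventually_at_right_less[of 0]]) (simp add: Im_cinner_T_op[OF H _ x])
  qed simp
  ultimately show ?thesis by (rule dense_closed_induct[OF adj_F_dense])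
qed

lemma nonneg_Im_T_plus: "nonneg_op (Im_op (T_plus F lam H))"
proof -
  obtain S where "adjoint_ops (T_plus F lam H) S" by (rule T_plus_adjoint)
  from Im_op_adjoint[OF this T_plus_clinear] Im_cinner_T_plus_nonneg show ?thesis
    by (simp add: nonneg_op_def inner_eq_Re_cinner[symmetric])
qed

lemma inner_Im_T_plus: "inner (Im_op (T_plus F lam H) x) x = Im (cinner (T_plus F lam H x) x)"
proof -
  obtain S where "adjoint_ops (T_plus F lam H) S" by (rule T_plus_adjoint)
  from Im_op_adjoint(2)[OF this T_plus_clinear] show ?thesis .
qed

lemma T_plus_range: "T_plus F lam H x \<in> closure (F `` \<D>)"
proof (rule Lim_in_closed_set[OF closed_closure])
  show "((\<lambda>y. T_op F (Complex lam y) H x) \<longlongrightarrow> T_plus F lam H x) (at_right 0)"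
    by (intro blinfun.tendsto T_plus_tendsto[OF H lam] tendsto_const)
  show "\<forall>\<^sub>F y in at_right 0. T_op F (Complex lam y) H x \<in> closure (F `` \<D>)"
    by (rule eventually_mono[OF eventually_at_right_less[of 0]]) (simp add: T_op_range[OF H])
qed simp

text \<open>The adjoint of \<open>T_plus\<close> is the boundary value from below, so its range lies
  in the same closure; whatever is orthogonal to that range is annihilated.\<close>

lemma T_plus_kernel:
  assumes "\<And>w. w \<in> F `` \<D> \<Longrightarrow> inner u w = 0" shows "T_plus F lam H u = 0"
proof -
  obtain S where S: "((\<lambda>y. T_op F (Complex lam (- y)) H) \<longlongrightarrow> S) (at_right 0)"
    and adj: "adjoint_ops (T_plus F lam H) S" by (rule T_plus_adjoint)
  have "S x \<in> closure (F `` \<D>)" for x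
  proof (rule Lim_in_closed_set[OF closed_closure])
    show "((\<lambda>y. T_op F (Complex lam (- y)) H x) \<longlongrightarrow> S x) (at_right 0)"
      by (intro blinfun.tendsto S tendsto_const)
    show "\<forall>\<^sub>F y in at_right 0. T_op F (Complex lam (- y)) H x \<in> closure (F `` \<D>)"
      by (rule eventually_mono[OF eventually_at_right_less[of 0]]) (simp add: T_op_range[OF H])
  qed simp
  moreover have "closure (F `` \<D>) \<subseteq> {w. inner u w = 0}"
    by (intro closure_minimal closed_Collect_eq continuous_intros) (use assms in auto)
  ultimately have "inner u (S x) = 0" for x by blast
  then have "inner (T_plus F lam H u) x = 0" for x
    using adj by (simp add: adjoint_ops_def inner_eq_Re_cinner)
  from this[of "T_plus F lam H u"] show ?thesis by simp
qed

end

end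

section \<open>Stability of the semi-Fredholm property\<close>

text \<open>Bolzano-Weierstrass by induction on the spanning set: the coefficient of the new vector
  \<open>b\<close> is bounded by pairing with a unit vector orthogonal to the old span. That the
  limit stays in the span is part of the claim because the induction step needs the old span to be
  closed.\<close>

lemma bounded_seq_in_finite_span:
  fixes B :: "'a::{real_inner,complete_space} set" and x :: "nat \<Rightarrow> 'a"
  assumes "finite B" "bounded (range x)" "\<And>n. x n \<in> span B"
  shows "\<exists>\<sigma> a. strict_mono (\<sigma>::nat\<Rightarrow>nat) \<and> (x \<circ> \<sigma>) \<longlonglongrightarrow> a \<and> a \<in> span B"
  using assms
proof (induction B arbitrary: x rule: finite_induct)
  case empty
  then have "x = (\<lambda>n. 0)" by auto
  then show ?case by (intro exI[of _ id] exI[of _ 0]) (simp add: strict_mono_def)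
next
  case (insert b B)
  show ?case
  proof (cases "b \<in> span B")
    case True
    then show ?thesis using insert by (simp add: span_redundant)
  next
    case False
    have "closed (span B)"
      unfolding closed_sequential_limits
    proof (intro allI impI, elim conjE)
      fix y l assume y: "\<forall>n. y n \<in> span B" "y \<longlonglongrightarrow> l"
      then obtain \<sigma> a where "strict_mono (\<sigma>::nat\<Rightarrow>nat)" "(y \<circ> \<sigma>) \<longlonglongrightarrow> a" "a \<in> span B"
        using insert.IH[OF convergent_imp_bounded[OF y(2)]] by blast
      then show "l \<in> span B" using LIMSEQ_unique LIMSEQ_subseq_LIMSEQ[OF y(2)] by blast
    qed
    moreover have "span B \<subseteq> span (insert b B)" by (rule span_mono) auto
    moreover have "span B \<noteq> span (insert b B)" using False span_base[of b "insert b B"] by auto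
    ultimately obtain u where u: "u \<in> span (insert b B)" "norm u = 1" "\<And>s. s \<in> span B \<Longrightarrow> inner u s = 0"
      using orthogonal_unit_vector[OF subspace_span _ subspace_span] by metis
    have bu: "inner u b \<noteq> 0"
    proof
      assume "inner u b = 0"
      obtain k where "u - k *\<^sub>R b \<in> span B" using u(1) by (auto simp: span_insert)
      then have "inner u (u - k *\<^sub>R b) = 0" by (rule u(3))
      then have "inner u u = 0" using \<open>inner u b = 0\<close> by (simp add: inner_diff_right)
      then show False using u(2) by simp
    qed
    have "\<exists>k. x n - k *\<^sub>R b \<in> span B" for n using insert.prems(2) by (auto simp: span_insert)
    then obtain k where k: "\<And>n. x n - k n *\<^sub>R b \<in> span B" by metis
    obtain C where C: "\<And>n. norm (x n) \<le> C" using insert.prems(1) by (auto simp: bounded_iff)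
    have "\<bar>k n\<bar> \<le> C / \<bar>inner u b\<bar>" for n
    proof -
      have "inner u (x n) = k n * inner u b" using u(3)[OF k[of n]] by (simp add: inner_diff_right)
      moreover have "\<bar>inner u (x n)\<bar> \<le> C" using Cauchy_Schwarz_ineq2[of u "x n"] C[of n] u(2) by simp
      ultimately show ?thesis using bu by (simp add: abs_mult pos_le_divide_eq)
    qed
    then have "bounded (range k)" by (auto simp: bounded_iff)
    then obtain \<sigma> l where \<sigma>: "strict_mono (\<sigma>::nat\<Rightarrow>nat)" and l: "(k \<circ> \<sigma>) \<longlonglongrightarrow> l"
      using bounded_imp_convergent_subsequence by blast
    define z where "z n = x (\<sigma> n) - k (\<sigma> n) *\<^sub>R b" for n
    have "bounded (range (x \<circ> \<sigma>))" using insert.prems(1) by (rule bounded_subset) auto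
    moreover have "bounded (range (\<lambda>n. (k \<circ> \<sigma>) n *\<^sub>R b))"
      by (rule convergent_imp_bounded[OF tendsto_scaleR[OF l tendsto_const]])
    ultimately have "bounded (range z)"
      using bounded_minus_comp[of "x \<circ> \<sigma>" UNIV "\<lambda>n. (k \<circ> \<sigma>) n *\<^sub>R b"] by (simp add: z_def[abs_def])
    moreover have "z n \<in> span B" for n using k by (simp add: z_def)
    ultimately obtain \<tau> a where \<tau>: "strict_mono (\<tau>::nat\<Rightarrow>nat)" "(z \<circ> \<tau>) \<longlonglongrightarrow> a" "a \<in> span B"
      using insert.IH by metis
    have "(\<lambda>n. (z \<circ> \<tau>) n + ((k \<circ> \<sigma>) \<circ> \<tau>) n *\<^sub>R b) \<longlonglongrightarrow> a + l *\<^sub>R b"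
      by (intro tendsto_intros \<tau> LIMSEQ_subseq_LIMSEQ[OF l \<tau>(1)])
    moreover have "(\<lambda>n. (z \<circ> \<tau>) n + ((k \<circ> \<sigma>) \<circ> \<tau>) n *\<^sub>R b) = x \<circ> (\<sigma> \<circ> \<tau>)"
      by (rule ext) (simp add: z_def)
    moreover have "a + l *\<^sub>R b \<in> span (insert b B)"
      using \<tau>(3) by (auto simp: span_insert intro!: exI[of _ l])
    ultimately show ?thesis using strict_mono_o[OF \<sigma> \<tau>(1)] by metis
  qed
qed

text \<open>Properness on bounded sets: the sequential counterpart of closed range with
  finite-dimensional kernel. In this form a relatively compact perturbation costs only one more
  subsequence.\<close>

definition semi_Fredholm :: "('a::real_normed_vector \<times> 'b::real_normed_vector) set \<Rightarrow> bool"
  where "semi_Fredholm G \<longleftrightarrow> (\<forall>x y l. (\<forall>n::nat. (x n, y n) \<in> G) \<longrightarrow> bounded (range x) \<longrightarrow> y \<longlonglongrightarrow> l \<longrightarrow>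
    (\<exists>\<sigma> a. strict_mono (\<sigma>::nat\<Rightarrow>nat) \<and> (x \<circ> \<sigma>) \<longlonglongrightarrow> a))"

context
  fixes H :: "('h::complex_hilbert \<times> 'h) set" and lam :: real
  assumes H: "selfadjoint_graph H"
begin

private abbreviation (input) "G \<equiv> shift_graph H (of_real lam)"

lemma shift_real_linear: "linear_graph G"
  using H by (intro linear_graph_shift_graph) (simp add: selfadjoint_graph_def)

lemma shift_real_sym:
  assumes "(x, a) \<in> G" "(y, b) \<in> G" shows "cinner a y = cinner x b"
proof -
  have "cinner (a + of_real lam *\<^sub>C x) y = cinner x (b + of_real lam *\<^sub>C y)"
    using assms by (intro selfadjoint_graph_sym[OF H]) (simp_all add: shift_graph_iff)
  then show ?thesis by (simp add: cinner_add_left cinner_add_right cinner_scaleC_left cinner_scaleC_right)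
qed

lemma range_orthogonal_kernel: "(x, a) \<in> G \<Longrightarrow> (y, 0) \<in> G \<Longrightarrow> cinner a y = 0"
  using shift_real_sym by fastforce

lemma orthogonal_to_range_imp_kernel:
  "(\<And>s. s \<in> Range G \<Longrightarrow> inner u s = 0) \<Longrightarrow> (u, 0) \<in> G"
  using orthogonal_to_Range_shift_graph[OF H, of "of_real lam" u] by simp

text \<open>Normalise a violating sequence so that the images have norm 1. By symmetry, pairing
  \<open>f n\<close> with \<open>w = (H - lam) g\<close> equals pairing the unit images with
  \<open>g\<close>, so the \<open>f n\<close> are weakly bounded on the closed range, hence
  bounded.\<close>

lemma bounded_below_off_kernel:
  assumes cl: "closed (Range G)"
  shows "\<exists>C. \<forall>q y. (q, y) \<in> G \<longrightarrow> (\<forall>k. (k, 0) \<in> G \<longrightarrow> inner q k = 0) \<longrightarrow> norm q \<le> C * norm y"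
proof (rule ccontr)
  assume "\<not> ?thesis"
  then have "\<forall>n::nat. \<exists>q y. (q, y) \<in> G \<and> (\<forall>k. (k, 0) \<in> G \<longrightarrow> inner q k = 0) \<and> real n * norm y < norm q"
    by (meson not_le)
  then obtain q y where qy: "\<And>n. (q n, y n) \<in> G" and qK: "\<And>n k. (k, 0) \<in> G \<Longrightarrow> inner (q n) k = 0"
    and lt: "\<And>n::nat. real n * norm (y n) < norm (q n)" by metis
  have ypos: "norm (y n) > 0" for n
  proof -
    have "y n \<noteq> 0"
    proof
      assume "y n = 0"
      then have "(q n, 0) \<in> G" using qy[of n] by simp
      then have "inner (q n) (q n) = 0" by (rule qK)
      moreover have "norm (q n) > 0"
        using lt[of n] by (rule le_less_trans[rotated]) simp
      ultimately show False by simp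
    qed
    then show ?thesis by simp
  qed
  define f where "f n = (1 / norm (y n)) *\<^sub>R q n" for n
  have fG: "(f n, (1 / norm (y n)) *\<^sub>R y n) \<in> G" for n
    unfolding f_def by (rule linear_graph_scaleR[OF shift_real_linear qy])
  \<comment> \<open>The orthogonal complement of the closed range is contained in the kernel, to
    which \<open>f n\<close> is orthogonal.\<close>
  have fR: "f n \<in> Range G" for n
  proof -
    obtain a where a: "a \<in> Range G" "\<And>s. s \<in> Range G \<Longrightarrow> inner (f n - a) s = 0"
      using orthogonal_projection_exists[OF subspace_Range[OF shift_real_linear] cl, of "f n"] by metis
    have K: "(f n - a, 0) \<in> G" by (rule orthogonal_to_range_imp_kernel) (rule a)
    have "inner (f n) (f n - a) = 0" using qK[OF K, of n] by (simp add: f_def)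
    moreover have "inner (f n - a) a = 0" by (rule a(2)[OF a(1)])
    ultimately have "inner (f n - a) (f n - a) = 0" by (simp add: inner_diff_left inner_diff_right inner_commute)
    then show ?thesis using a(1) by simp
  qed
  have "\<exists>C. \<forall>n. norm (f n) \<le> C"
  proof (rule weakly_bounded_imp_bounded[OF subspace_Range[OF shift_real_linear] cl fR])
    fix w assume "w \<in> Range G"
    then obtain g where g: "(g, w) \<in> G" by blast
    have "\<bar>inner (f n) w\<bar> \<le> norm g" for n
    proof -
      have "inner (f n) w = inner ((1 / norm (y n)) *\<^sub>R y n) g"
        using shift_real_sym[OF fG[of n] g] by (simp add: inner_eq_Re_cinner)
      also have "\<bar>\<dots>\<bar> \<le> norm ((1 / norm (y n)) *\<^sub>R y n) * norm g" by (rule Cauchy_Schwarz_ineq2)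
      also have "\<dots> = norm g" using ypos[of n] by simp
      finally show ?thesis .
    qed
    then show "\<exists>C. \<forall>n. \<bar>inner (f n) w\<bar> \<le> C" by blast
  qed
  then obtain C where C: "\<And>n. norm (f n) \<le> C" by blast
  obtain n :: nat where "real n > C" using reals_Archimedean2 by blast
  moreover have "real n < norm (f n)" using lt[of n] ypos[of n] by (simp add: f_def pos_less_divide_eq)
  ultimately show False using C[of n] by linarith
qed

text \<open>Off the kernel the lower bound turns convergent images into convergent preimages; the
  kernel components are bounded in a finite-dimensional space.\<close>

lemma semi_Fredholm_shift:
  assumes fred: "fredholm_graph G" shows "semi_Fredholm G"
  unfolding semi_Fredholm_def
proof (intro allI impI)
  fix x y l assume xy: "\<forall>n::nat. (x n, y n) \<in> G" and bx: "bounded (range x)" and yl: "y \<longlonglongrightarrow> l"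
  define K where "K = {x. (x, 0) \<in> G}"
  have cl: "closed (Range G)" and fin: "finite_dim K" using fred by (simp_all add: fredholm_graph_def K_def)
  have "closed G" by (intro closed_shift_graph closed_selfadjoint_graph H)
  then have subK: "subspace K" and clK: "closed K"
    unfolding K_def by (rule kernel_of_closed_graph[OF linear_graphD(1)[OF shift_real_linear]])+
  have "\<exists>p\<in>K. \<forall>s\<in>K. inner (x n - p) s = 0" for n
    using orthogonal_projection_exists[OF subK clK, of "x n"] by metis
  then obtain p where p: "\<And>n. p n \<in> K" and po: "\<And>n s. s \<in> K \<Longrightarrow> inner (x n - p n) s = 0" by metis
  define q where "q n = x n - p n" for n
  have qG: "(q n, y n) \<in> G" for n
    using linear_graph_diff[OF shift_real_linear, of "x n" "y n" "p n" 0] xy p[of n] by (simp add: K_def q_def)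
  obtain C where C: "\<And>q y. (q, y) \<in> G \<Longrightarrow> (\<And>k. (k, 0) \<in> G \<Longrightarrow> inner q k = 0) \<Longrightarrow> norm q \<le> C * norm y"
    using bounded_below_off_kernel[OF cl] by metis
  have "norm (q m - q n) \<le> C * norm (y m - y n)" for m n
    using po by (intro C linear_graph_diff[OF shift_real_linear qG qG]) (simp add: K_def q_def inner_diff_left)
  then have "Cauchy q" by (rule Cauchy_if_norm_diff_le[OF LIMSEQ_imp_Cauchy[OF yl]])
  then obtain b where b: "q \<longlonglongrightarrow> b" using Cauchy_convergent convergent_def by blast
  obtain B where B: "finite B" "K \<subseteq> span B" using fin by (auto simp: finite_dim_def)
  have "p = (\<lambda>n. x n - q n)" by (simp add: q_def)
  then have "bounded (range p)"
    using bounded_minus_comp[OF bx convergent_imp_bounded[OF b]] by simp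
  then obtain \<sigma> a where \<sigma>: "strict_mono (\<sigma>::nat\<Rightarrow>nat)" "(p \<circ> \<sigma>) \<longlonglongrightarrow> a"
    using bounded_seq_in_finite_span[OF B(1), of p] p B(2) by blast
  have "(\<lambda>n. (p \<circ> \<sigma>) n + (q \<circ> \<sigma>) n) \<longlonglongrightarrow> a + b"
    by (intro tendsto_add \<sigma> LIMSEQ_subseq_LIMSEQ[OF b \<sigma>(1)])
  moreover have "(\<lambda>n. (p \<circ> \<sigma>) n + (q \<circ> \<sigma>) n) = x \<circ> \<sigma>" by (rule ext) (simp add: q_def)
  ultimately show "\<exists>\<sigma> a. strict_mono (\<sigma>::nat\<Rightarrow>nat) \<and> (x \<circ> \<sigma>) \<longlonglongrightarrow> a" using \<sigma>(1) by metis
qed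

lemma closed_Range_if_semi_Fredholm:
  assumes "semi_Fredholm G" shows "closed (Range G)"
proof (rule closed_range_if_sequentially_proper[OF linear_graphD(1)[OF shift_real_linear]])
  show "closed G" by (intro closed_shift_graph closed_selfadjoint_graph H)
qed (use assms in \<open>unfold semi_Fredholm_def, blast\<close>)

text \<open>Near a real point with closed range the resolvent is \<open>- (z - \<lambda>)\<^sup>-\<^sup>1\<close> on the kernel and bounded on
  the range.\<close>

lemma resolvent_growth:
  assumes cl: "closed (Range G)"
  obtains f0 :: 'h and C where "\<forall>y>0. (norm f0)\<^sup>2 / y \<le> y * (norm (resolvent_op H (Complex lam y) f))\<^sup>2"
    "f0 = 0 \<longrightarrow> (\<forall>y>0. norm (resolvent_op H (Complex lam y) f) \<le> C)"
proof -
  obtain f1 where f1: "f1 \<in> Range G" "\<And>s. s \<in> Range G \<Longrightarrow> inner (f - f1) s = 0"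
    using orthogonal_projection_exists[OF subspace_Range[OF shift_real_linear] cl, of f] by metis
  define f0 where "f0 = f - f1"
  have f0: "(f0, 0) \<in> G" unfolding f0_def by (rule orthogonal_to_range_imp_kernel) (rule f1)
  obtain g where g: "(g, f1) \<in> G" using f1(1) by blast
  have z: "Complex lam y = of_real lam + \<i> * of_real y" for y by (simp add: complex_eq_iff)
  have shift: "(x, w - (\<i> * of_real y) *\<^sub>C x) \<in> shift_graph H (Complex lam y)" if "(x, w) \<in> G" for x w y
    using that by (simp add: shift_graph_iff z scaleC_add_left add.assoc)
  have low: "(norm f0)\<^sup>2 / y \<le> y * (norm (resolvent_op H (Complex lam y) f))\<^sup>2" if y: "y > 0" for y
  proof (cases "f0 = 0")
    case False
    let ?R = "resolvent_op H (Complex lam y)"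
    have im: "Im (Complex lam y) \<noteq> 0" "Im (cnj (Complex lam y)) \<noteq> 0" using y by simp_all
    \<comment> \<open>On the kernel the resolvent at the conjugate point acts as division by
      \<open>\<i> * y\<close>. Moving it across the inner product isolates the component
      \<open>f0\<close> of \<open>f\<close>.\<close>
    have "(f0, 0 - (\<i> * of_real (- y)) *\<^sub>C f0) \<in> shift_graph H (cnj (Complex lam y))"
      using shift[OF f0, of "- y"] by (simp add: complex_cnj)
    then have eq: "f0 = resolvent_op H (cnj (Complex lam y)) ((\<i> * of_real y) *\<^sub>C f0)"
      by (simp add: resolvent_op_iff[OF H im(2)] scaleC_minus_left)
    have "cinner f1 f0 = 0" by (rule range_orthogonal_kernel[OF g f0])
    then have ff: "cinner f f0 = of_real ((norm f0)\<^sup>2)"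
      using cinner_add_left[of f0 f1 f0] by (simp add: cinner_self f0_def)
    have "cinner (?R f) ((\<i> * of_real y) *\<^sub>C f0) = cinner f f0"
      using resolvent_op_adjoint[OF H im(1), of f "(\<i> * of_real y) *\<^sub>C f0"] eq by simp
    then have "norm (cinner (?R f) ((\<i> * of_real y) *\<^sub>C f0)) = (norm f0)\<^sup>2" by (simp add: ff norm_power)
    then have "(norm f0)\<^sup>2 \<le> norm (?R f) * (y * norm f0)"
      using norm_cinner_le[of "?R f" "(\<i> * of_real y) *\<^sub>C f0"] y by (simp add: norm_scaleC norm_mult)
    then have "norm f0 * norm f0 \<le> (y * norm (?R f)) * norm f0" by (simp add: power2_eq_square mult_ac)
    then have "norm f0 \<le> y * norm (?R f)" using False by simp
    then have "(norm f0)\<^sup>2 \<le> (y * norm (?R f))\<^sup>2" by (intro power_mono) auto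
    then show ?thesis using y by (simp add: pos_divide_le_eq power2_eq_square mult_ac)
  qed (use y in simp)
  have "norm (resolvent_op H (Complex lam y) f) \<le> 2 * norm g" if "f0 = 0" "y > 0" for y
  proof -
    let ?R = "resolvent_op H (Complex lam y)"
    have im: "Im (Complex lam y) \<noteq> 0" using \<open>y > 0\<close> by simp
    have "f1 = f" using \<open>f0 = 0\<close> by (simp add: f0_def)
    \<comment> \<open>Since \<open>(H - z) g = f - \<i> y g\<close>, the resolvent of
      \<open>f\<close> is \<open>g + \<i> y R g\<close>. The general bound
      \<open>y * norm (R g) \<le> norm g\<close> explains the constant
      \<open>2 * norm g\<close>.\<close>
    then have "g = ?R (f - (\<i> * of_real y) *\<^sub>C g)"
      using shift[OF g, of y] by (simp add: resolvent_op_iff[OF H im])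
    then have "?R f = g + (\<i> * of_real y) *\<^sub>C ?R g"
      by (simp add: blinfun.diff_right clinear_op_apply[OF resolvent_op_clinear[OF H im]] algebra_simps)
    then have "norm (?R f) \<le> norm g + y * norm (?R g)"
      using norm_triangle_ineq[of g "(\<i> * of_real y) *\<^sub>C ?R g"] \<open>y > 0\<close> by (simp add: norm_scaleC norm_mult)
    moreover have "(?R g, g) \<in> shift_graph H (Complex lam y)" by (simp add: resolvent_op_iff[OF H im])
    then have "y * norm (?R g) \<le> norm g"
      using selfadjoint_graph_shift_bound[OF H] \<open>y > 0\<close> by fastforce
    ultimately show ?thesis by linarith
  qed
  with low show ?thesis using that[of f0 "2 * norm g"] by blast
qed

end

context rigged_affine_space
begin

text \<open>Relative compactness is applied with respect to the perturbed operator: bounded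
  \<open>x n\<close> and convergent \<open>y n\<close> make \<open>f n = (H_s - z) (x n)\<close>
  bounded, so \<open>v n = K (f n)\<close> converges along a subsequence, and subtracting
  \<open>s *\<^sub>R v n\<close> leads back to \<open>H\<close>.\<close>

lemma semi_Fredholm_perturbation:
  assumes H: "H \<in> \<A>" and J: "J \<in> \<J>" and G: "semi_Fredholm (shift_graph H (of_real lam))"
  shows "semi_Fredholm (shift_graph (add_graph H s (perturbation F J)) (of_real lam))"
  unfolding semi_Fredholm_def
proof (intro allI impI)
  let ?H = "add_graph H s (perturbation F J)"
  fix x y l assume xy: "\<forall>n::nat. (x n, y n) \<in> shift_graph ?H (of_real lam)"
    and bx: "bounded (range x)" and yl: "y \<longlonglongrightarrow> l"
  have HA: "?H \<in> \<A>" by (rule add_graph_in_affine[OF H J])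
  have "\<exists>a v. (x n, a) \<in> H \<and> (x n, v) \<in> sandwich_graph F J \<and> y n + of_real lam *\<^sub>C x n = a + s *\<^sub>R v" for n
    using xy by (simp add: shift_graph_iff add_graph_iff[OF J common_domain[OF H]])
  then obtain a v where av: "\<And>n. (x n, a n) \<in> H" "\<And>n. (x n, v n) \<in> sandwich_graph F J"
    "\<And>n. y n + of_real lam *\<^sub>C x n = a n + s *\<^sub>R v n" by metis
  obtain z K where K: "compact_op K" and Kg: "op_graph K = (shift_graph ?H z)\<inverse> O perturbation F J"
    using relcompact[OF J HA] unfolding relatively_compact_def by blast
  define f where "f n = y n + of_real lam *\<^sub>C x n - z *\<^sub>C x n" for n
  have Kf: "v n = K (f n)" for n
  proof -
    have "(x n, f n) \<in> shift_graph ?H z" using xy by (simp add: shift_graph_iff f_def)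
    moreover have "(x n, v n) \<in> perturbation F J" using av(2) sandwich_subset_perturbation by blast
    ultimately have "(f n, v n) \<in> op_graph K" unfolding Kg by blast
    then show ?thesis by (simp add: op_graph_def)
  qed
  have bsc: "bounded (range (\<lambda>n. c *\<^sub>C x n))" for c
    using bounded_linear_image[OF bx bounded_linear_scaleC_right[of c]] by (simp add: image_image)
  have "bounded (range f)" unfolding f_def
    by (intro bounded_minus_comp bounded_plus_comp bsc convergent_imp_bounded[OF yl])
  then obtain \<sigma> m where \<sigma>: "strict_mono (\<sigma>::nat\<Rightarrow>nat)" and m: "(\<lambda>n. K (f (\<sigma> n))) \<longlonglongrightarrow> m"
    by (rule seq_compact_opE[OF compact_imp_seq_compact_op[OF K]])
  have "(\<lambda>n. y (\<sigma> n) - s *\<^sub>R v (\<sigma> n)) \<longlonglongrightarrow> l - s *\<^sub>R m"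
    using LIMSEQ_subseq_LIMSEQ[OF yl \<sigma>] m by (intro tendsto_intros) (simp_all add: Kf o_def)
  moreover have "(x (\<sigma> n), y (\<sigma> n) - s *\<^sub>R v (\<sigma> n)) \<in> shift_graph H (of_real lam)" for n
    using av(1)[of "\<sigma> n"] av(3)[of "\<sigma> n"] by (simp add: shift_graph_iff algebra_simps)
  moreover have "bounded (range (\<lambda>n. x (\<sigma> n)))" using bx by (rule bounded_subset) auto
  ultimately obtain \<tau> b where \<tau>: "strict_mono (\<tau>::nat\<Rightarrow>nat)" "((\<lambda>n. x (\<sigma> n)) \<circ> \<tau>) \<longlonglongrightarrow> b"
    using G unfolding semi_Fredholm_def by meson
  have "(x \<circ> (\<sigma> \<circ> \<tau>)) \<longlonglongrightarrow> b" using \<tau>(2) by (simp add: o_def)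
  then show "\<exists>\<sigma> a. strict_mono (\<sigma>::nat\<Rightarrow>nat) \<and> (x \<circ> \<sigma>) \<longlonglongrightarrow> a" using strict_mono_o[OF \<sigma> \<tau>(1)] by blast
qed

lemma Im_T_plus_eq_0:
  assumes H: "H \<in> \<A>" and lam: "lam \<in> Lambda_set F H" and cl: "closed (Range (shift_graph H (of_real lam)))"
  shows "Im (cinner (T_plus F lam H x) x) = 0"
proof -
  have base: "Im (cinner (T_plus F lam H x) x) = 0" if Dx: "x \<in> Domain (adj_graph F)" for x
  proof -
    obtain f where x: "(x, f) \<in> adj_graph F" using Dx by blast
    let ?R = "\<lambda>y. resolvent_op H (Complex lam y) f"
    let ?L = "Im (cinner (T_plus F lam H x) x)"
    have ev: "\<forall>\<^sub>F y in at_right (0::real). y > 0" by (rule eventually_at_right_less)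
    have "\<forall>\<^sub>F y in at_right 0. Im (cinner (T_op F (Complex lam y) H x) x) = y * (norm (?R y))\<^sup>2"
      by (rule eventually_mono[OF ev]) (simp add: Im_cinner_T_op[OF H _ x])
    then have lim: "((\<lambda>y. y * (norm (?R y))\<^sup>2) \<longlongrightarrow> ?L) (at_right 0)"
      by (rule Lim_transform_eventually[OF tendsto_Im_cinner_T_plus[OF H lam]])
    obtain f0 :: 'h and C where low: "\<forall>y>0. (norm f0)\<^sup>2 / y \<le> y * (norm (?R y))\<^sup>2"
      and up: "f0 = 0 \<longrightarrow> (\<forall>y>0. norm (?R y) \<le> C)"
      by (rule resolvent_growth[OF H_selfadjoint[OF H] cl, where f = f]) blast
    have y0: "((\<lambda>y. y) \<longlongrightarrow> 0) (at_right (0::real))" by (rule tendsto_ident_at)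
    \<comment> \<open>Multiplying the lower bound by \<open>y\<close> compares the constant with
      \<open>y\<close> times a convergent quantity.\<close>
    have "(norm f0)\<^sup>2 \<le> 0"
    proof (rule tendsto_lowerbound)
      show "((\<lambda>y. y * (y * (norm (?R y))\<^sup>2)) \<longlongrightarrow> 0) (at_right 0)"
        using tendsto_mult[OF y0 lim] by simp
      show "\<forall>\<^sub>F y in at_right 0. (norm f0)\<^sup>2 \<le> y * (y * (norm (?R y))\<^sup>2)"
        by (rule eventually_mono[OF ev]) (use low in \<open>simp add: pos_divide_le_eq mult.commute\<close>)
    qed simp
    then have "f0 = 0" by simp
    have "?L \<le> 0"
    proof (rule tendsto_le[OF _ _ lim])
      show "((\<lambda>y. y * C\<^sup>2) \<longlongrightarrow> 0) (at_right (0::real))" using tendsto_mult[OF y0 tendsto_const[of "C\<^sup>2"]] by simp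
      show "\<forall>\<^sub>F y in at_right 0. y * (norm (?R y))\<^sup>2 \<le> y * C\<^sup>2"
        by (rule eventually_mono[OF ev])
          (use up \<open>f0 = 0\<close> in \<open>auto intro!: mult_left_mono power_mono\<close>)
    qed simp
    then show ?thesis using Im_cinner_T_plus_nonneg[OF H lam, of x] by linarith
  qed
  have "closed {x. Im (cinner (T_plus F lam H x) x) = 0}"
    by (intro closed_Collect_eq continuous_on_Im continuous_on_cinner continuous_intros)
  then show ?thesis using base by (rule dense_closed_induct[OF adj_F_dense])
qed

end

section \<open>Resonance points\<close>

text \<open>Guarantees that the radius picked by \<open>SOME\<close> in \<open>P_plus\<close> has
  the intended property.\<close>

lemma op_meromorphic_punctured_disc:
  assumes "op_meromorphic f"
  shows "\<exists>\<rho>>0. op_holomorphic_on f (cball p \<rho> - {p})"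
proof -
  obtain n g U where U: "open U" "p \<in> U" and g: "op_holomorphic_on g U"
    and fg: "\<And>z. z \<in> U - {p} \<Longrightarrow> scaleC_op ((z - p) ^ n) (f z) = g z"
    using assms unfolding op_meromorphic_def by meson
  obtain \<rho> where \<rho>: "\<rho> > 0" "cball p \<rho> \<subseteq> U" using U open_contains_cball by blast
  have f: "f z = scaleC_op (inverse ((z - p) ^ n)) (g z)" if "z \<in> U - {p}" for z
    unfolding fg[OF that, symmetric] using that
    by (intro blinfun_eqI) (simp add: scaleC_op_apply scaleC_scaleC)
  have "op_holomorphic_on (\<lambda>z. scaleC_op (inverse ((z - p) ^ n)) (g z)) (U - {p})"
    by (intro op_holomorphic_on_scaleC op_holomorphic_on_subset[OF g])
      (auto intro!: field_differentiable_inverse field_differentiable_power derivative_intros)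
  then have "op_holomorphic_on f (U - {p})"
    unfolding op_holomorphic_on_def
  proof (intro ballI)
    fix z assume *: "\<forall>z\<in>U - {p}. \<exists>D. ((\<lambda>z. scaleC_op (inverse ((z - p) ^ n)) (g z)) has_derivative (\<lambda>h. scaleC_op h D)) (at z)"
      and z: "z \<in> U - {p}"
    then obtain D where "((\<lambda>z. scaleC_op (inverse ((z - p) ^ n)) (g z)) has_derivative (\<lambda>h. scaleC_op h D)) (at z)"
      by blast
    then have "(f has_derivative (\<lambda>h. scaleC_op h D)) (at z)"
      by (rule has_derivative_transform_within_open[OF _ open_delete[OF U(1)] z]) (simp add: f)
    then show "\<exists>D. (f has_derivative (\<lambda>h. scaleC_op h D)) (at z)" by blast
  qed
  then have "op_holomorphic_on f (cball p \<rho> - {p})" by (rule op_holomorphic_on_subset) (use \<rho> in auto)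
  then show ?thesis using \<rho> by blast
qed

context rigged_affine_space
begin

section \<open>Resonances along a fixed line of operators\<close>

context
  fixes H0 J and lam s :: real
  assumes H0: "H0 \<in> \<A>" and J: "J \<in> \<J>"
    and s: "non_resonant F lam H0 (perturbation F J) s"
begin

private abbreviation (input) "Hr t \<equiv> add_graph H0 t (perturbation F J)"
private abbreviation (input) "Tr t \<equiv> T_plus F lam (add_graph H0 t (perturbation F J))"
private abbreviation (input) "nonres \<equiv> non_resonant F lam H0 (perturbation F J)"

lemma perturbed_in_affine: "Hr t \<in> \<A>"
  by (rule add_graph_in_affine[OF H0 J])

lemma J_clinear: "clinear_op J" and J_sym: "cinner (J x) y = cinner x (J y)"
  using J_selfadjoint[OF J] by (simp_all add: selfadjoint_op_def)

lemma nonres_Lambda: "nonres t \<longleftrightarrow> lam \<in> Lambda_set F (Hr t)"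
  by (simp add: non_resonant_def)

lemma T_plus_resolvent_identity:
  assumes "nonres t" "nonres u"
  shows "Tr t y + (t - u) *\<^sub>R Tr t (J (Tr u y)) = Tr u y"
proof (rule tendsto_unique[OF trivial_limit_at_right_real])
  note lim = T_plus_tendsto[OF perturbed_in_affine]
  note assms = assms[unfolded nonres_Lambda]
  let ?T = "\<lambda>t y. T_op F (Complex lam y) (Hr t)"
  show "((\<lambda>v. ?T t v y + (t - u) *\<^sub>R ?T t v (J (?T u v y))) \<longlongrightarrow> Tr t y + (t - u) *\<^sub>R Tr t (J (Tr u y))) (at_right 0)"
    by (intro tendsto_intros lim assms)
  have "((\<lambda>v. ?T u v y) \<longlongrightarrow> Tr u y) (at_right 0)" by (intro tendsto_intros lim assms)
  then show "((\<lambda>v. ?T t v y + (t - u) *\<^sub>R ?T t v (J (?T u v y))) \<longlongrightarrow> Tr u y) (at_right 0)"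
    by (rule Lim_transform_eventually, intro eventually_mono[OF eventually_at_right_less[of 0]])
      (simp add: T_op_resolvent_identity[OF H0 J])
qed

text \<open>The resolvent identity read in both orders of \<open>s\<close> and \<open>t\<close>
  gives \<open>(t - s) T_t J T_s J = (t - s) T_s J T_t J = T_s J - T_t J\<close>; each product of
  the two operators then telescopes to the identity.\<close>

lemma nonres_imp_inverse:
  assumes "nonres t"
  shows "inverse_ops (id_blinfun + (t - s) *\<^sub>R (Tr s o\<^sub>L J)) (id_blinfun - (t - s) *\<^sub>R (Tr t o\<^sub>L J))"
    "(id_blinfun - (t - s) *\<^sub>R (Tr t o\<^sub>L J)) o\<^sub>L (Tr s o\<^sub>L J) = Tr t o\<^sub>L J"
proof -
  have ts: "Tr t (J x) + (t - s) *\<^sub>R Tr t (J (Tr s (J x))) = Tr s (J x)" for x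
    by (rule T_plus_resolvent_identity[OF assms s])
  have "Tr s (J x) + (s - t) *\<^sub>R Tr s (J (Tr t (J x))) = Tr t (J x)" for x
    by (rule T_plus_resolvent_identity[OF s assms])
  moreover have "(s - t) *\<^sub>R v = - ((t - s) *\<^sub>R v)" for v :: 'k by (simp add: algebra_simps)
  ultimately have st: "(t - s) *\<^sub>R Tr s (J (Tr t (J x))) = Tr s (J x) - Tr t (J x)" for x
    by (simp add: algebra_simps)
  have ts': "(t - s) *\<^sub>R Tr t (J (Tr s (J x))) = Tr s (J x) - Tr t (J x)" for x
    using ts[of x] by (simp add: algebra_simps)
  show "inverse_ops (id_blinfun + (t - s) *\<^sub>R (Tr s o\<^sub>L J)) (id_blinfun - (t - s) *\<^sub>R (Tr t o\<^sub>L J))"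
  proof (rule inverse_opsI)
    fix x
    have "(t - s) *\<^sub>R (t - s) *\<^sub>R Tr t (J (Tr s (J x))) = (t - s) *\<^sub>R (Tr s (J x) - Tr t (J x))" by (simp only: ts')
    then show "(id_blinfun - (t - s) *\<^sub>R (Tr t o\<^sub>L J)) ((id_blinfun + (t - s) *\<^sub>R (Tr s o\<^sub>L J)) x) = x"
      by (simp add: blinfun.add_left blinfun.diff_left blinfun.scaleR_left blinfun.add_right
          blinfun.scaleR_right scaleR_add_right scaleR_diff_right del: scaleR_scaleR scaleR_left_diff_distrib)
    have "(t - s) *\<^sub>R (t - s) *\<^sub>R Tr s (J (Tr t (J x))) = (t - s) *\<^sub>R (Tr s (J x) - Tr t (J x))" by (simp only: st)
    then show "(id_blinfun + (t - s) *\<^sub>R (Tr s o\<^sub>L J)) ((id_blinfun - (t - s) *\<^sub>R (Tr t o\<^sub>L J)) x) = x"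
      by (simp add: blinfun.add_left blinfun.diff_left blinfun.scaleR_left blinfun.diff_right
          blinfun.scaleR_right scaleR_add_right scaleR_diff_right del: scaleR_scaleR scaleR_left_diff_distrib)
  qed
  show "(id_blinfun - (t - s) *\<^sub>R (Tr t o\<^sub>L J)) o\<^sub>L (Tr s o\<^sub>L J) = Tr t o\<^sub>L J"
    by (rule blinfun_eqI) (simp add: blinfun.diff_left blinfun.scaleR_left ts')
qed

text \<open>Applying the limiting inverse \<open>R\<close> to the identity at height
  \<open>y\<close> gives \<open>T_t = R T_s + E y T_t\<close> with
  \<open>E y \<rightarrow> 0\<close>. Once \<open>norm (E y) < 1/2\<close> this bounds
  \<open>T_t\<close> by \<open>2 * b\<close>, and then forces the limit \<open>R T_s\<close>; no
  inverse at positive height is needed.\<close>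

lemma inverse_imp_nonres:
  assumes R: "inverse_ops (id_blinfun + (t - s) *\<^sub>R (Tr s o\<^sub>L J)) R"
  shows "nonres t"
  unfolding nonres_Lambda
proof (rule Lambda_setI[OF perturbed_in_affine])
  let ?c = "t - s"
  define T where "T u y = T_op F (Complex lam y) (Hr u)" for u y
  have lim: "(T s \<longlongrightarrow> Tr s) (at_right 0)"
    unfolding T_def[abs_def] by (rule T_plus_tendsto[OF perturbed_in_affine]) (use s in \<open>simp add: nonres_Lambda\<close>)
  \<comment> \<open>The error of using the inverse at the boundary in place of the one at height
    \<open>y\<close>.\<close>
  define E where "E y = (?c *\<^sub>R (R o\<^sub>L (Tr s - T s y))) o\<^sub>L J" for y
  have eq: "T t y = (R o\<^sub>L T s y) + (E y o\<^sub>L T t y)" if "y > 0" for y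
  proof (rule blinfun_eqI)
    fix x
    have "T s y x + (s - t) *\<^sub>R T s y (J (T t y x)) = T t y x"
      unfolding T_def by (rule T_op_resolvent_identity[OF H0 J]) (use that in simp)
    then have "T s y x = T t y x + ?c *\<^sub>R T s y (J (T t y x))"
      by (simp add: algebra_simps)
    then have "R (T s y x) = R (T t y x) + ?c *\<^sub>R R (T s y (J (T t y x)))"
      by (simp add: blinfun.add_right blinfun.scaleR_right)
    moreover have "R (T t y x) + ?c *\<^sub>R R (Tr s (J (T t y x))) = T t y x"
      using inverse_ops_apply(1)[OF R, of "T t y x"]
      by (simp add: blinfun.add_left blinfun.scaleR_left blinfun.add_right blinfun.scaleR_right)
    ultimately show "T t y x = ((R o\<^sub>L T s y) + (E y o\<^sub>L T t y)) x"
      by (simp add: E_def blinfun.add_left blinfun.scaleR_left blinfun.diff_left blinfun.diff_right scaleR_diff_right)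
  qed
  note comp = bounded_bilinear.tendsto[OF bounded_bilinear_blinfun_compose]
  have RT: "((\<lambda>y. R o\<^sub>L T s y) \<longlongrightarrow> R o\<^sub>L Tr s) (at_right 0)" by (intro comp tendsto_const lim)
  have "(E \<longlongrightarrow> (?c *\<^sub>R (R o\<^sub>L (Tr s - Tr s))) o\<^sub>L J) (at_right 0)"
    unfolding E_def[abs_def] by (intro comp tendsto_scaleR tendsto_diff tendsto_const lim)
  then have "(E \<longlongrightarrow> 0) (at_right 0)" by simp
  then have E0: "((\<lambda>y. norm (E y)) \<longlongrightarrow> 0) (at_right 0)" using tendsto_norm_zero by blast
  define b where "b = norm (R o\<^sub>L Tr s) + 1"
  have "\<forall>\<^sub>F y in at_right 0. norm (E y) < 1/2" using E0 by (rule order_tendstoD) simp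
  moreover have "\<forall>\<^sub>F y in at_right 0. norm (R o\<^sub>L T s y) < b"
    using tendsto_norm[OF RT] by (rule order_tendstoD) (simp add: b_def)
  ultimately have "\<forall>\<^sub>F y in at_right 0. norm (T t y - (R o\<^sub>L Tr s)) \<le> norm ((R o\<^sub>L T s y) - (R o\<^sub>L Tr s)) + norm (E y) * (2 * b)"
    using eventually_at_right_less[of "0::real"]
  proof eventually_elim
    case (elim y)
    have EC: "norm (E y o\<^sub>L T t y) \<le> norm (E y) * norm (T t y)" by (rule norm_blinfun_compose)
    have "norm (E y) * norm (T t y) \<le> (1/2) * norm (T t y)" using elim by (intro mult_right_mono) auto
    moreover have "norm (T t y) \<le> norm (R o\<^sub>L T s y) + norm (E y o\<^sub>L T t y)"
      using norm_triangle_ineq[of "R o\<^sub>L T s y" "E y o\<^sub>L T t y"] eq[OF \<open>0 < y\<close>] by simp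
    ultimately have "norm (T t y) \<le> 2 * b" using EC elim by linarith
    then have "norm (E y o\<^sub>L T t y) \<le> norm (E y) * (2 * b)"
      using EC mult_left_mono[of "norm (T t y)" "2 * b" "norm (E y)"] by simp
    moreover have "norm (T t y - (R o\<^sub>L Tr s)) = norm (((R o\<^sub>L T s y) - (R o\<^sub>L Tr s)) + (E y o\<^sub>L T t y))"
      by (subst eq[OF \<open>0 < y\<close>]) (simp add: algebra_simps)
    ultimately show ?case
      using norm_triangle_ineq[of "(R o\<^sub>L T s y) - (R o\<^sub>L Tr s)" "E y o\<^sub>L T t y"] by linarith
  qed
  moreover have "((\<lambda>y. norm ((R o\<^sub>L T s y) - (R o\<^sub>L Tr s)) + norm (E y) * (2 * b)) \<longlongrightarrow> 0) (at_right 0)"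
    using tendsto_add[OF tendsto_norm[OF tendsto_diff[OF RT tendsto_const[of "R o\<^sub>L Tr s"]]] tendsto_mult[OF E0 tendsto_const[of "2 * b"]]]
    by simp
  ultimately have "((\<lambda>y. T t y - (R o\<^sub>L Tr s)) \<longlongrightarrow> 0) (at_right 0)" by (rule Lim_null_comparison)
  then have "((\<lambda>y. T t y) \<longlongrightarrow> R o\<^sub>L Tr s) (at_right 0)" by (simp add: LIM_zero_iff)
  then show "((\<lambda>y. T_op F (Complex lam y) (Hr t)) \<longlongrightarrow> R o\<^sub>L Tr s) (at_right 0)"
    by (simp add: T_def)
qed

interpretation pencil: compact_pencil "Tr s o\<^sub>L J" "of_real s"
proof
  have c: "compact_op (Tr s)" using T_plus_compact[OF perturbed_in_affine] s by (simp add: nonres_Lambda)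
  then show "seq_compact_op (Tr s o\<^sub>L J)"
    by (intro seq_compact_op_compose_right compact_imp_seq_compact_op)
  show "clinear_op (Tr s o\<^sub>L J)" using c by (intro clinear_op_compose J_clinear) (simp add: compact_op_def)
qed

lemma pencil_M: "pencil.M (of_real t) = id_blinfun + (t - s) *\<^sub>R (Tr s o\<^sub>L J)"
  by (simp add: pencil.M_def scaleC_op_of_real flip: of_real_diff)

lemma nonres_extension: "nonres t \<Longrightarrow> pencil.extension (of_real t) = Tr t o\<^sub>L J"
  by (simp only: nonres_imp_inverse(2)
      pencil.extension_eq[of "of_real t", unfolded pencil_M, OF nonres_imp_inverse(1)])

text \<open>\<open>pencil.extension\<close> witnesses that the choice in \<open>A_plus\<close> is
  not vacuous; beyond these two properties the chosen function is unknown.\<close>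

lemma A_plus: "op_meromorphic (A_plus F lam H0 J)"
  "nonres t \<Longrightarrow> A_plus F lam H0 J (of_real t) = Tr t o\<^sub>L J"
proof -
  have "\<exists>A. op_meromorphic A \<and> (\<forall>t. nonres t \<longrightarrow> A (of_real t) = Tr t o\<^sub>L J)"
    using pencil.op_meromorphic_extension nonres_extension by blast
  from someI_ex[OF this]
  show "op_meromorphic (A_plus F lam H0 J)" "nonres t \<Longrightarrow> A_plus F lam H0 J (of_real t) = Tr t o\<^sub>L J"
    unfolding A_plus_def by blast+
qed

text \<open>The common reduction: a bounded operator that kills the algebraic kernel of
  \<open>N\<close> kills the residue.\<close>

lemma compose_P_plus_eq_0:
  assumes Q: "clinear_op Q"
    and ker: "\<And>n x. op_power (id_blinfun + (r - s) *\<^sub>R (Tr s o\<^sub>L J)) n x = 0 \<Longrightarrow> Q x = 0"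
  shows "Q o\<^sub>L P_plus F lam H0 J r = 0"
proof -
  let ?A = "A_plus F lam H0 J" and ?c = "complex_of_real r"
  define \<rho> where "\<rho> = (SOME \<rho>. 0 < \<rho> \<and> op_holomorphic_on ?A (cball ?c \<rho> - {?c}))"
  have \<rho>: "0 < \<rho>" "op_holomorphic_on ?A (cball ?c \<rho> - {?c})"
    using someI_ex[OF op_meromorphic_punctured_disc[OF A_plus(1), of ?c]] unfolding \<rho>_def by blast+
  \<comment> \<open>Restricts invertibility on a punctured complex neighbourhood to real points:
    those near \<open>r\<close> are non-resonant, and there the chosen function and the pencil
    extension agree.\<close>
  have "filterlim complex_of_real (at ?c) (at r)"
    unfolding filterlim_at by (auto simp: eventually_at_filter intro!: tendsto_eq_intros)
  from filterlim_iff[THEN iffD1, OF this, rule_format, OF pencil.invertible_near[of ?c]]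
  have "\<forall>\<^sub>F t in at r. \<exists>R. inverse_ops (pencil.M (of_real t)) R" .
  then have "\<forall>\<^sub>F t in at r. ?A (of_real t) = pencil.extension (of_real t)"
    by (rule eventually_mono) (auto simp: pencil_M A_plus(2) nonres_extension dest!: inverse_imp_nonres)
  from pencil.compose_circle_integral_eq_0[OF A_plus(1) this \<rho> Q ker]
  have 0: "Q o\<^sub>L op_circle_integral ?A ?c \<rho> = 0" by (simp add: pencil_M)
  have "P_plus F lam H0 J r = scaleC_op (1 / (2 * of_real pi * \<i>)) (op_circle_integral ?A ?c \<rho>)"
    by (simp add: P_plus_def Let_def \<rho>_def)
  moreover have "Q o\<^sub>L scaleC_op a X = scaleC_op a (Q o\<^sub>L X)" for a and X :: "'k \<Rightarrow>\<^sub>L 'k"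
    by (rule blinfun_eqI) (simp add: scaleC_op_apply clinear_op_apply[OF Q])
  ultimately show ?thesis by (simp only: 0 bounded_bilinear.zero_right[OF bounded_bilinear_scaleC_op])
qed

text \<open>Makes the \<open>LEAST\<close> in \<open>resonance_order\<close> range over a nonempty
  set. The order has to be positive, hence the passage from the ascent \<open>n\<close> to
  \<open>Suc n\<close>.\<close>

lemma kernel_chain_stabilizes:
  "\<exists>k>0. \<forall>u. op_power (id_blinfun + (r - s) *\<^sub>R (Tr s o\<^sub>L J)) (Suc k) u = 0
    \<longrightarrow> op_power (id_blinfun + (r - s) *\<^sub>R (Tr s o\<^sub>L J)) k u = 0"
proof -
  interpret cp: compact_perturbation "scaleC_op (of_real s - of_real r) (Tr s o\<^sub>L J)" "pencil.M (of_real r)"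
    by (rule pencil.compact_perturbation_M)
  obtain n where n: "\<And>u. op_power (pencil.M (of_real r)) (Suc n) u = 0 \<Longrightarrow> op_power (pencil.M (of_real r)) n u = 0"
    using cp.finite_ascent by blast
  have "op_power (pencil.M (of_real r)) (Suc n) u = 0" if "op_power (pencil.M (of_real r)) (Suc (Suc n)) u = 0" for u
    using op_power_kernel_stable[OF n, of 2 u] that by simp
  then show ?thesis unfolding pencil_M by (intro exI[of _ "Suc n"]) blast
qed

text \<open>An eigenvector \<open>v\<close> satisfies \<open>(r - s) T J v = - v\<close>, so \<open>\<langle>T J v, J v\<rangle>\<close> is a real multiple of the real
  number \<open>\<langle>v, J v\<rangle>\<close>.\<close>

lemma Im_T_plus_kernel:
  assumes r: "r \<noteq> s" and v: "v + (r - s) *\<^sub>R Tr s (J v) = 0"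
  shows "Im (cinner (Tr s (J v)) (J v)) = 0"
proof -
  have "(r - s) *\<^sub>R Tr s (J v) = - v" using v by (simp add: eq_neg_iff_add_eq_0 add.commute)
  then have "of_real (r - s) * cinner (Tr s (J v)) (J v) = - cinner v (J v)"
    by (metis cinner_scaleR_left cinner_minus_left)
  then have "(r - s) * Im (cinner (Tr s (J v)) (J v)) = - Im (cinner v (J v))"
    by (auto dest: arg_cong[of _ _ Im])
  moreover have "Im (cinner v (J v)) = 0"
  proof -
    have "cnj (cinner v (J v)) = cinner v (J v)" using J_sym by (metis cinner_commute)
    then show ?thesis by (simp add: complex_eq_iff)
  qed
  ultimately show ?thesis using r by simp
qed

text \<open>A kernel chain that is stationary at the first power consists of eigenvectors
  throughout, and on these the quadratic form of \<open>Im T\<close> at \<open>J u\<close>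
  vanishes.\<close>

lemma type_I_if_simple:
  assumes r: "\<not> nonres r"
    and simple: "\<And>u. op_power (id_blinfun + (r - s) *\<^sub>R (Tr s o\<^sub>L J)) 2 u = 0 \<Longrightarrow> u + (r - s) *\<^sub>R Tr s (J u) = 0"
  shows "type_I F lam H0 J r"
proof -
  let ?N = "id_blinfun + (r - s) *\<^sub>R (Tr s o\<^sub>L J)" and ?B = "Im_op (Tr s)"
  have rs: "r \<noteq> s" using r s by auto
  have lam: "lam \<in> Lambda_set F (Hr s)" using s by (simp add: nonres_Lambda)
  have B: "nonneg_op ?B" by (rule nonneg_Im_T_plus[OF perturbed_in_affine lam])
  have N: "?N u = u + (r - s) *\<^sub>R Tr s (J u)" for u by (simp add: blinfun.add_left blinfun.scaleR_left)
  have ker: "op_power ?N n u = 0 \<Longrightarrow> ?N u = 0" for n u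
  proof (cases n)
    case (Suc m)
    assume "op_power ?N n u = 0"
    then have "op_power ?N (m + 1) u = 0" using Suc by simp
    moreover have "op_power ?N 1 u = 0" if "op_power ?N (Suc 1) u = 0" for u
      using simple[of u] that N by (simp add: numeral_2_eq_2)
    ultimately have "op_power ?N 1 u = 0" by (rule op_power_kernel_stable[rotated])
    then show ?thesis by simp
  qed simp
  have "(sqrt_op ?B o\<^sub>L J) o\<^sub>L P_plus F lam H0 J r = 0"
  proof (rule compose_P_plus_eq_0)
    show "clinear_op (sqrt_op ?B o\<^sub>L J)"
      using sqrt_op(1)[OF B] by (intro clinear_op_compose J_clinear) (simp add: nonneg_op_def selfadjoint_op_def)
    fix n u assume "op_power ?N n u = 0"
    then have "Im (cinner (Tr s (J u)) (J u)) = 0" using Im_T_plus_kernel[OF rs] ker N by metis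
    then have "inner (?B (J u)) (J u) = 0" by (simp add: inner_Im_T_plus[OF perturbed_in_affine lam])
    from sqrt_op_kernel[OF B this] show "(sqrt_op ?B o\<^sub>L J) u = 0" by simp
  qed
  then show ?thesis using s unfolding type_I_def by blast
qed

text \<open>The factor \<open>\<epsilon>\<close> carries the sign of \<open>V\<close>, so that one
  argument treats both cases.\<close>

lemma type_I_if_semidefinite:
  assumes r: "\<not> nonres r" and \<epsilon>: "\<epsilon> \<noteq> (0::real)"
    and nonneg: "\<And>x v. (x, v) \<in> perturbation F J \<Longrightarrow> 0 \<le> \<epsilon> * inner v x"
  shows "type_I F lam H0 J r"
proof (rule type_I_if_simple[OF r])
  let ?N = "id_blinfun + (r - s) *\<^sub>R (Tr s o\<^sub>L J)" and ?B = "Im_op (Tr s)" and ?K = "closure (F `` \<D>)"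
  have rs: "r \<noteq> s" using r s by auto
  have lam: "lam \<in> Lambda_set F (Hr s)" using s by (simp add: nonres_Lambda)
  have N: "?N u = u + (r - s) *\<^sub>R Tr s (J u)" for u by (simp add: blinfun.add_left blinfun.scaleR_left)
  have J_inner: "inner (J x) y = inner x (J y)" for x y using J_sym by (simp add: inner_eq_Re_cinner)
  have linH: "linear_graph H0" using H_selfadjoint[OF H0] by (simp add: selfadjoint_graph_def)
  have subD: "subspace \<D>"
    unfolding common_domain[OF H0, symmetric]
    by (rule subspaceI)
      (auto intro: subspace_0[OF linear_graphD(1)[OF linH], unfolded zero_prod_def, THEN DomainI]
        linear_graph_add[OF linH, THEN DomainI] linear_graph_scaleR[OF linH, THEN DomainI])
  have "subspace (F `` \<D>)"
  proof (rule subspaceI)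
    show "0 \<in> F `` \<D>"
      using subspace_0[OF subD] subspace_0[OF linear_graphD(1)[OF F_linear]] by (auto simp: zero_prod_def)
    show "a + b \<in> F `` \<D>" if "a \<in> F `` \<D>" "b \<in> F `` \<D>" for a b
      using that linear_graph_add[OF F_linear] subspace_add[OF subD] by (meson ImageE ImageI)
    show "c *\<^sub>R a \<in> F `` \<D>" if "a \<in> F `` \<D>" for c a
      using that linear_graph_scaleR[OF F_linear] subspace_scale[OF subD] by (meson ImageE ImageI)
  qed
  then have subK: "subspace ?K" by (rule subspace_closure)
  have base: "0 \<le> \<epsilon> * inner (J w) w" if w: "w \<in> F `` \<D>" for w
  proof -
    obtain x where x: "x \<in> \<D>" "(x, w) \<in> F" using w by blast
    obtain v where v: "(x, v) \<in> sandwich_graph F J" by (rule sandwich_exists[OF J x(1)])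
    obtain w' where w': "(x, w') \<in> F" "(J w', v) \<in> adj_graph F" using v by (auto simp: sandwich_graph_iff)
    have "w' = w" by (rule linear_graph_unique[OF F_linear w'(1) x(2)])
    then have "cinner w (J w) = cinner x v" using adj_graphD[OF w'(2) x(2)] by simp
    then have "inner w (J w) = inner x v" by (simp add: inner_eq_Re_cinner)
    then have "inner (J w) w = inner v x" by (simp only: inner_commute)
    then show ?thesis using nonneg v sandwich_subset_perturbation by auto
  qed
  have "closed {w. 0 \<le> \<epsilon> * inner (J w) w}" by (intro closed_Collect_le continuous_intros)
  then have pos: "0 \<le> \<epsilon> * inner (J w) w" if "w \<in> ?K" for w
    using closure_minimal[of "F `` \<D>" "{w. 0 \<le> \<epsilon> * inner (J w) w}"] base that by blast
  fix u assume "op_power ?N 2 u = 0"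
  then have NN: "?N (?N u) = 0" by (simp add: numeral_2_eq_2)
  define v where "v = ?N u"
  have v: "v + (r - s) *\<^sub>R Tr s (J v) = 0" using NN N by (simp add: v_def)
  then have TJv: "(r - s) *\<^sub>R Tr s (J v) = - v" by (simp add: eq_neg_iff_add_eq_0 add.commute)
  have vK: "v \<in> ?K"
  proof -
    have "v = (s - r) *\<^sub>R Tr s (J v)" using TJv by (simp add: algebra_simps)
    then show ?thesis using subspace_scale[OF subK T_plus_range[OF perturbed_in_affine lam]] by metis
  qed
  obtain S where S: "adjoint_ops (Tr s) S" by (rule T_plus_adjoint[OF perturbed_in_affine lam])
  have Tlin: "clinear_op (Tr s)" by (rule T_plus_clinear[OF perturbed_in_affine lam])
  have "inner (?B (J v)) (J v) = 0"
    using Im_T_plus_kernel[OF rs v] by (simp add: inner_Im_T_plus[OF perturbed_in_affine lam])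
  \<comment> \<open>A non-negative operator with vanishing quadratic form kills the vector; thus
    \<open>T\<close> and its adjoint \<open>S\<close> agree on \<open>J v\<close>.\<close>
  then have "?B (J v) = 0" using nonneg_op_norm_sq_le[OF nonneg_Im_T_plus[OF perturbed_in_affine lam], of "J v"] by simp
  then have "norm ((1 / (2 * \<i>)) *\<^sub>C (Tr s (J v) - S (J v))) = 0" using Im_op_adjoint(3)[OF S Tlin] by simp
  then have SJ: "S (J v) = Tr s (J v)" by (simp add: norm_scaleC norm_divide norm_mult)
  \<comment> \<open>\<open>T\<close> may now be moved onto \<open>J v\<close>, where it acts as a
    real multiple of \<open>v\<close>. With \<open>v = u + (r - s) T J u\<close> this gives
    \<open><J v, v> = <J v, u> - <v, J u> = 0\<close>.\<close>
  have "inner (J v) (Tr s (J u)) = inner (Tr s (J v)) (J u)"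
    using S SJ unfolding adjoint_ops_def by (metis inner_commute inner_eq_Re_cinner)
  then have "(r - s) * inner (J v) (Tr s (J u)) = - inner v (J u)"
    using TJv by (metis inner_minus_left inner_scaleR_left)
  moreover have "inner (J v) v = inner (J v) u + (r - s) * inner (J v) (Tr s (J u))"
    using N[of u] by (simp add: v_def[symmetric] inner_add_right)
  ultimately have Jvv: "inner (J v) v = 0" by (simp add: J_inner)
  \<comment> \<open>\<open>v\<close> lies in \<open>?K\<close>, being a multiple of a value of
    \<open>T\<close>, so Cauchy-Schwarz for the semidefinite form on \<open>?K\<close> applies. Thus
    \<open>J v\<close> is orthogonal to \<open>?K\<close>, \<open>T\<close> annihilates it, and
    \<open>v = 0\<close>.\<close>
  have "inner (J v) w = 0" if w: "w \<in> ?K" for w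
  proof -
    have "(\<epsilon> * inner (J v) w)\<^sup>2 \<le> (\<epsilon> * inner (J v) v) * (\<epsilon> * inner (J w) w)"
    proof (rule semidefinite_cauchy_schwarz[where S = ?K])
      show "\<epsilon> * inner (J x) y = \<epsilon> * inner (J y) x" for x y by (simp only: J_inner[of x y] inner_commute[of x "J y"])
    qed (auto simp: blinfun.add_right blinfun.scaleR_right inner_add_left algebra_simps subK vK w pos)
    then show ?thesis using Jvv \<epsilon> by simp
  qed
  then have "Tr s (J v) = 0" using closure_subset by (intro T_plus_kernel[OF perturbed_in_affine lam]) blast
  then show "u + (r - s) *\<^sub>R Tr s (J u) = 0" using v N[of u] by (simp add: v_def)
qed

text \<open>The square root of \<open>Im T\<close> vanishes identically, already before composition
  with \<open>J\<close> and the residue. The spectral assumption concerns \<open>H0\<close> and is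
  carried to the operator at \<open>s\<close> through semi-Fredholmness.\<close>

lemma type_I_off_essential_spectrum:
  assumes "of_real lam \<notin> essential_spectrum H0"
  shows "type_I F lam H0 J r"
proof -
  have lam: "lam \<in> Lambda_set F (Hr s)" using s by (simp add: nonres_Lambda)
  have "semi_Fredholm (shift_graph H0 (of_real lam))"
    using assms by (intro semi_Fredholm_shift[OF H_selfadjoint[OF H0]]) (simp add: essential_spectrum_def)
  then have "semi_Fredholm (shift_graph (Hr s) (of_real lam))" by (rule semi_Fredholm_perturbation[OF H0 J])
  then have cl: "closed (Range (shift_graph (Hr s) (of_real lam)))"
    by (rule closed_Range_if_semi_Fredholm[OF H_selfadjoint[OF perturbed_in_affine]])
  have "sqrt_op (Im_op (Tr s)) x = 0" for x
    by (rule sqrt_op_kernel[OF nonneg_Im_T_plus[OF perturbed_in_affine lam]])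
      (simp add: inner_Im_T_plus[OF perturbed_in_affine lam] Im_T_plus_eq_0[OF perturbed_in_affine lam cl])
  then have "sqrt_op (Im_op (Tr s)) o\<^sub>L J o\<^sub>L P_plus F lam H0 J r = 0" by (intro blinfun_eqI) simp
  then show ?thesis using s unfolding type_I_def by blast
qed

end

text \<open>The reference coupling must be the very \<open>s\<close> that \<open>SOME\<close>
  selects inside \<open>Upsilon\<close>, because the order is expressed through it. Stabilisation of
  the kernel chain allows the least \<open>k\<close> to be evaluated.\<close>

lemma type_I_if_order_1:
  assumes H0: "H0 \<in> \<A>" and J: "J \<in> \<J>" and ex: "regularizing_direction F lam H0 (perturbation F J)"
    and r: "\<not> non_resonant F lam H0 (perturbation F J) r" and order: "resonance_order F lam H0 J r = 1"
  shows "type_I F lam H0 J r"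
proof -
  define s where "s = (SOME s. non_resonant F lam H0 (perturbation F J) s)"
  have s: "non_resonant F lam H0 (perturbation F J) s"
    using ex unfolding regularizing_direction_def s_def by (rule someI_ex)
  let ?N = "id_blinfun + (r - s) *\<^sub>R (T_plus F lam (add_graph H0 s (perturbation F J)) o\<^sub>L J)"
  have U: "Upsilon F lam H0 J r k = {u. op_power ?N k u = 0}" for k
    by (simp add: Upsilon_def Let_def s_def op_power_apply)
  let ?P = "\<lambda>k. 0 < k \<and> Upsilon F lam H0 J r k = Upsilon F lam H0 J r (Suc k)"
  obtain k where "k > 0" "\<And>u. op_power ?N (Suc k) u = 0 \<Longrightarrow> op_power ?N k u = 0"
    using kernel_chain_stabilizes[OF H0 J s, of r] by blast
  then have "?P k" unfolding U by (auto simp: op_power_swap[symmetric])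
  then have "?P (LEAST k. ?P k)" by (rule LeastI)
  then have "?P 1" using order by (simp add: resonance_order_def)
  then have "op_power ?N 1 u = 0" if "op_power ?N 2 u = 0" for u
    using that unfolding U by (auto simp: numeral_2_eq_2)
  then show ?thesis
    by (intro type_I_if_simple[OF H0 J s r]) (auto simp: blinfun.add_left blinfun.scaleR_left)
qed

end

theorem theorem1p39:
  fixes F :: "('h::{complex_hilbert, second_countable_topology} \<times>
      'k::{complex_hilbert, second_countable_topology}) set"
    and \<J> :: "('k \<Rightarrow>\<^sub>L 'k) set"
    and \<A> :: "('h \<times> 'h) set set"
    and \<D> :: "'h set"
    and H0 V :: "('h \<times> 'h) set"
    and J :: "'k \<Rightarrow>\<^sub>L 'k"
    and lam r :: real
  assumes "rigged_affine_space F \<J> \<A> \<D>"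
    and "essentially_regular F \<A> lam"
    and "H0 \<in> \<A>"
    and "J \<in> \<J>" and "V = perturbation F J"
    and "regularizing_direction F lam H0 V"
    and "resonance_point F lam H0 V r"
    and "complex_of_real lam \<notin> essential_spectrum H0 \<or>
      resonance_order F lam H0 J r = 1 \<or>
      nonneg_graph V \<or> nonpos_graph V"
  shows "type_I F lam H0 J r"
proof -
  interpret rigged_affine_space F \<J> \<A> \<D> by (rule assms(1))
  have ex: "regularizing_direction F lam H0 (perturbation F J)"
    and r: "\<not> non_resonant F lam H0 (perturbation F J) r"
    using assms(5-7) by (simp_all add: resonance_point_def)
  obtain s where s: "non_resonant F lam H0 (perturbation F J) s"
    using ex by (auto simp: regularizing_direction_def)
  note facts = assms(3,4) s
  show ?thesis
    using assms(8)
  proof (elim disjE)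
    assume "complex_of_real lam \<notin> essential_spectrum H0"
    then show ?thesis by (rule type_I_off_essential_spectrum[OF facts])
  next
    assume "resonance_order F lam H0 J r = 1"
    then show ?thesis by (rule type_I_if_order_1[OF assms(3,4) ex r])
  next
    assume "nonneg_graph V"
    then show ?thesis
      by (intro type_I_if_semidefinite[OF facts r, of 1])
        (auto simp: nonneg_graph_def assms(5) inner_eq_Re_cinner)
  next
    assume "nonpos_graph V"
    then show ?thesis
      by (intro type_I_if_semidefinite[OF facts r, of "-1"])
        (auto simp: nonpos_graph_def assms(5) inner_eq_Re_cinner)
  qed
qed

end
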